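(* Let $K>1$ and let $d$ be a nonnegative integer. There are constants $n_0$ and $K'$ depending only on $K$ and $d$ such that for every $n\ge n_0$ and every real vector $w=(w_1,\dots,w_n)$ that is not constant and is $K$-balanced, the random polynomial $$P_\pi(x)=\sum_{i=1}^n w_{\pi(i)}x^i,$$ where $\pi$ is a uniformly random permutation of $\{1,\dots,n\}$, satisfies $$\mathbb{E}\,N_{\mathbb{R}}\big(P_\pi^{(d)}\big)\le K'\log n.$$
   Context: For $w\in\mathbb{R}^n$ let $\overline w=\frac1n\sum_{i=1}^n w_i$ and $M_k(w)=\frac1n\sum_{i=1}^n(w_i-\overline w)^k$. The vector $w$ is $K$-balanced if $M_4(w)\le K\,M_2(w)^2$. $P^{(d)}$ denotes the $d$-th derivative of $P$, and $N_{\mathbb{R}}(Q)$ denotes the number of real roots of $Q$ counted with multiplicity. *)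

theory Defs
  imports
    "HOL-Probability.Probability"
    "HOL-Combinatorics.Permutations"
    "HOL-Computational_Algebra.Polynomial"
begin

(* A vector in R^n is a function w :: nat => real, of which only the entries w 1, ..., w n
   are ever used; the length n is passed explicitly. *)

definition vec_mean :: "nat \<Rightarrow> (nat \<Rightarrow> real) \<Rightarrow> real" where
  "vec_mean n w = (\<Sum>i=1..n. w i) / real n"

definition central_moment :: "nat \<Rightarrow> nat \<Rightarrow> (nat \<Rightarrow> real) \<Rightarrow> real" where
  "central_moment k n w = (\<Sum>i=1..n. (w i - vec_mean n w) ^ k) / real n"

definition balanced :: "real \<Rightarrow> nat \<Rightarrow> (nat \<Rightarrow> real) \<Rightarrow> bool" where
  "balanced K n w \<longleftrightarrow> central_moment 4 n w \<le> K * (central_moment 2 n w)\<^sup>2"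

definition constant_vec :: "nat \<Rightarrow> (nat \<Rightarrow> real) \<Rightarrow> bool" where
  "constant_vec n w \<longleftrightarrow> (\<exists>c. \<forall>i\<in>{1..n}. w i = c)"

definition perm_poly :: "nat \<Rightarrow> (nat \<Rightarrow> real) \<Rightarrow> (nat \<Rightarrow> nat) \<Rightarrow> real poly" where
  "perm_poly n w \<pi> = (\<Sum>i=1..n. monom (w (\<pi> i)) i)"

(* The zero polynomial vanishes everywhere and gets the value infinity, whereas the library has
   proots 0 = {#}. *)
definition num_real_roots :: "real poly \<Rightarrow> ennreal" where
  "num_real_roots Q = (if Q = 0 then \<infinity> else of_nat (size (proots Q)))"

definition random_perm :: "nat \<Rightarrow> (nat \<Rightarrow> nat) pmf" where
  "random_perm n = pmf_of_set {\<pi>. \<pi> permutes {1..n}}"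

end

theory Submission
  imports Defs
begin

text \<open>
  Up to powers of \<open>x\<close>, the polynomial \<open>P\<^sub>\<pi>\<^sup>(\<^sup>d\<^sup>)\<close> is \<open>d!\<close> times \<open>W = \<Sum> (i choose d) w\<^bsub>\<pi>(i)\<^esub> x\<^bsup>i-1\<^esup>\<close>.
  By Descartes' rule of signs for power series, the number of roots of \<open>W\<close> in \<open>[0, 1]\<close> is up to an
  additive constant at most the number of sign changes in the coefficients \<open>a\<^sub>k\<close> of
  \<open>W(x) (1 + x)\<^bsup>d+1\<^esup> / (1 - x)\<^sup>2\<close>; reflecting \<open>x\<close> and reversing coefficients covers the other real roots.
  A sign change at \<open>k\<close> forces \<open>\<bar>a\<^sub>k\<bar> \<le> \<bar>a\<^sub>k - a\<^bsub>k-1\<^esub>\<bar>\<close>, where, for centred \<open>w\<close> and \<open>d = 0\<close>,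
  \<open>a\<^sub>k\<close> has order \<open>k\<^bsup>3/2\<^esup>\<close> and its increment order \<open>k\<^bsup>1/2\<^esup>\<close>. So this should have probability \<open>O(1/k)\<close>,
  and summing over \<open>k \<le> n\<close> gives \<open>O(log n)\<close>.

  The probability is bounded by resampling: composing \<open>\<pi>\<close> with random swaps of disjoint pairs of positions
  does not change its law and adds independent random terms to \<open>a\<^sub>k\<close>. Swapping positions at distance
  about \<open>k\<close> changes \<open>a\<^sub>k\<close> by order \<open>k\<close>, and by Littlewood--Offord \<open>a\<^sub>k\<close> lies in a given window of length
  \<open>k\<close> with probability \<open>O(k\<^bsup>-1/2\<^esup>)\<close>; swapping positions at distance about \<open>k\<^bsup>1/2\<^esup>\<close> gains a second factor
  \<open>k\<^bsup>-1/2\<^esup>\<close> for windows of length \<open>k\<^bsup>1/2\<^esup>\<close>. The balance condition provides enough pairs of different values.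
  The mean of \<open>w\<close> may be arbitrarily large, but it contributes to \<open>a\<^sub>k\<close> at least order \<open>k\<close> times what it
  contributes to the increment, so it does not help sign changes.
\<close>

text \<open>The exponent 2 is the smallest that works. With \<open>1 / (1 - x)\<close> alone and
  \<open>d = 0\<close>, the increment is a single entry of order 1 against partial sums of order
  \<open>k^(1/2)\<close>; crossing probabilities of order \<open>k^(-1/2)\<close> would add up to
  \<open>n^(1/2)\<close>. The factor \<open>(1 + x)^(d+1)\<close> is there because of the mean.
  After \<open>x -> -x\<close>, a constant vector with weights \<open>i choose d\<close> contributes
  a rational function with a pole of order \<open>d + 1\<close> at \<open>-1\<close>. For
  \<open>d >= 2\<close> this pole would dominate the double pole at \<open>1\<close>: the smoothed
  coefficients would alternate in sign, and a large mean would force a crossing at almost every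
  \<open>k\<close>. Cancelling the pole costs at most \<open>d + 1\<close> further coefficients and
  keeps the coefficients of the kernel \<open>(1 + x)^(d+1) / (1 - x)\<close> between 1 and
  \<open>2^(d+1)\<close>. The other obstacle is that the window, the size of the increment, is built
  from the same permutation as \<open>a_k\<close>. Littlewood--Offord needs a window that stays
  fixed during the swaps, so the window is cut into parts and each part is frozen while swaps act
  elsewhere.\<close>

section \<open>Real roots in the unit interval and sign changes of smoothed coefficients\<close>

text \<open>A witness for at least \<open>m\<close> sign changes, hence \<open>m + 1\<close>
  indices. Only the sign of \<open>\<sigma>\<close> matters; as any nonzero real is allowed, a
  single nonzero coefficient can serve as its own \<open>\<sigma>\<close> for a chain with
  \<open>m = 0\<close>.\<close>

definition sign_chain :: "(nat \<Rightarrow> real) \<Rightarrow> real \<Rightarrow> (nat \<Rightarrow> nat) \<Rightarrow> nat \<Rightarrow> bool" where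
  "sign_chain a \<sigma> idx m \<longleftrightarrow>
     (\<forall>t\<le>m. \<sigma> * (-1) ^ t * a (idx t) > 0) \<and> (\<forall>t<m. idx t < idx (Suc t))"

text \<open>Here \<open>a\<close> is the coefficient sequence of \<open>(x - r) * B\<close> when
  \<open>b\<close> is that of \<open>B\<close>. Up to positive factors, \<open>a\<close> is minus
  the increment sequence of \<open>b k * r ^ k\<close>. A sequence that starts from 0, ends at 0 and
  changes sign \<open>m\<close> times has increments that change sign at least \<open>m + 1\<close>
  times.\<close>

lemma sign_chain_step:
  fixes a b :: "nat \<Rightarrow> real"
  assumes ch: "sign_chain b \<sigma> idx m" and r: "r > 0"
    and lim: "(\<lambda>k. b k * r ^ k) \<longlonglongrightarrow> 0"
    and a0: "a 0 = - r * b 0" and aS: "\<And>k. a (Suc k) = b k - r * b (Suc k)"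
  shows "\<exists>\<sigma> idx. sign_chain a \<sigma> idx (Suc m)"
proof -
  define s where "s t = \<sigma> * (-1) ^ t" for t :: nat
  have pos: "s t * b (idx t) > 0" if "t \<le> m" for t
    using ch that unfolding sign_chain_def s_def by auto
  have inc: "idx t < idx (Suc t)" if "t < m" for t
    using ch that unfolding sign_chain_def by auto
  have sS: "s (Suc t) = - s t" for t by (simp add: s_def)
  have ex1: "\<exists>j\<le>idx t. (t = 0 \<or> idx (t - 1) < j) \<and> s t * a j < 0" if t: "t \<le> m" for t
  proof -
    \<comment> \<open>The least such \<open>j\<close> is the first index after
      \<open>idx (t - 1)\<close> at which \<open>b\<close> has the sign \<open>s t\<close>. At
      \<open>j - 1\<close> it is zero or of the opposite sign, so both terms of \<open>a j\<close>
      have the sign \<open>- s t\<close>.\<close>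
    define Q where "Q j \<longleftrightarrow> (t = 0 \<or> idx (t - 1) < j) \<and> s t * b j > 0" for j
    have Qt: "Q (idx t)"
      unfolding Q_def using pos[OF t] inc[of "t - 1"] t by (cases t) auto
    define j where "j = (LEAST j. Q j)"
    have Qj: "Q j" unfolding j_def using Qt by (rule LeastI)
    have jle: "j \<le> idx t" unfolding j_def using Qt by (rule Least_le)
    have nQ: "\<not> Q i" if "i < j" for i using that not_less_Least unfolding j_def by blast
    have "s t * a j < 0"
    proof (cases j)
      case 0
      then have "s t * a j = - (r * (s t * b 0))" by (simp add: a0)
      then show ?thesis using Qj 0 r unfolding Q_def by (auto intro: mult_pos_pos)
    next
      case (Suc i)
      have "s t * b i \<le> 0"
      proof (cases "t = 0 \<or> idx (t - 1) < i")
        case True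
        then show ?thesis using nQ[of i] Suc unfolding Q_def by auto
      next
        case False
        then have tp: "t > 0" and "i = idx (t - 1)" using Qj Suc unfolding Q_def by auto
        then have "s (t - 1) * b i > 0" using pos[of "t - 1"] t by auto
        then show ?thesis using sS[of "t - 1"] tp by simp
      qed
      moreover have "r * (s t * b j) > 0" using Qj r unfolding Q_def by simp
      moreover have "s t * a j = s t * b i - r * (s t * b j)"
        unfolding Suc aS by (simp add: algebra_simps)
      ultimately show ?thesis by linarith
    qed
    then show ?thesis using Qj jle unfolding Q_def by auto
  qed
  \<comment> \<open>The additional change comes from the decay: without it
    \<open>b k * r ^ k\<close>, taken with the sign \<open>s m\<close>, would be nondecreasing from
    a positive value on and could not tend to 0.\<close>
  have ex2: "\<exists>j>idx m. s m * a j > 0"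
  proof (rule ccontr)
    assume "\<not> ?thesis"
    then have le: "s m * a j \<le> 0" if "j > idx m" for j using that by force
    define y where "y k = s m * (b k * r ^ k)" for k
    have mono: "y k \<le> y (Suc k)" if "k \<ge> idx m" for k
    proof -
      have "s m * (b k - r * b (Suc k)) \<le> 0" using le[of "Suc k"] aS[of k] that by simp
      then have "s m * b k * r ^ k \<le> s m * (r * b (Suc k)) * r ^ k"
        using r by (intro mult_right_mono) (auto simp: algebra_simps)
      then show ?thesis by (simp add: y_def algebra_simps)
    qed
    have "y (idx m) \<le> y (idx m + k)" for k
      by (induction k) (use mono order_trans in \<open>force+\<close>)
    then have ge: "y k \<ge> y (idx m)" if "k \<ge> idx m" for k
      using that by (metis le_add_diff_inverse)
    have "y \<longlonglongrightarrow> s m * 0" unfolding y_def by (intro tendsto_intros lim)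
    then have "y (idx m) \<le> 0"
      by (intro tendsto_lowerbound[of y 0 sequentially])
         (auto simp: eventually_sequentially intro!: exI[of _ "idx m"] ge)
    moreover have "y (idx m) = (s m * b (idx m)) * r ^ idx m" by (simp add: y_def)
    moreover have "(s m * b (idx m)) * r ^ idx m > 0" by (rule mult_pos_pos) (use pos[of m] r in simp_all)
    ultimately show False by simp
  qed
  from ex2 obtain jl where jl: "jl > idx m" "s m * a jl > 0" by blast
  from ex1 have "\<forall>t. \<exists>j. t \<le> m \<longrightarrow> j \<le> idx t \<and> (t = 0 \<or> idx (t - 1) < j) \<and> s t * a j < 0" by blast
  then obtain f where f: "\<And>t. t \<le> m \<Longrightarrow> f t \<le> idx t \<and> (t = 0 \<or> idx (t - 1) < f t) \<and> s t * a (f t) < 0"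
    by metis
  define idx' where "idx' t = (if t \<le> m then f t else jl)" for t
  have "sign_chain a (- \<sigma>) idx' (Suc m)"
    unfolding sign_chain_def
  proof (intro conjI allI impI)
    fix t assume t: "t \<le> Suc m"
    show "0 < - \<sigma> * (- 1) ^ t * a (idx' t)"
    proof (cases "t \<le> m")
      case True
      then show ?thesis using f[of t] by (simp add: idx'_def s_def)
    next
      case False
      then have "t = Suc m" using t by simp
      then show ?thesis using jl by (simp add: idx'_def s_def)
    qed
  next
    fix t assume t: "t < Suc m"
    show "idx' t < idx' (Suc t)"
    proof (cases "t = m")
      case True
      then show ?thesis using f[of m] jl by (simp add: idx'_def)
    next
      case False
      then show ?thesis using f[of t] f[of "Suc t"] t by (simp add: idx'_def)
    qed
  qed
  then show ?thesis by blast
qed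

section \<open>Descartes' rule for polynomials multiplied by a power series\<close>

abbreviation geo :: "real fps" where "geo \<equiv> Abs_fps (\<lambda>_. 1)"

lemma geo_mult_nth: "fps_nth (F * geo) k = (\<Sum>i=0..k. fps_nth F i)"
  by (simp add: fps_mult_nth)

lemma one_minus_X_geo: "(1 - fps_X) * geo = (1 :: real fps)"
proof (rule fps_ext)
  fix n show "fps_nth ((1 - fps_X) * geo) n = fps_nth (1 :: real fps) n"
    by (cases n) (auto simp: left_diff_distrib)
qed

text \<open>Induction that peels off one root satisfying \<open>C\<close> at a time, each factor
  \<open>x - r\<close> adding a change. The decay is required for every polynomial \<open>Q\<close>
  because it is applied to the successive cofactors of \<open>P\<close>.\<close>

lemma sign_chain_roots:
  fixes P :: "real poly" and G :: "real fps" and C :: "real \<Rightarrow> bool"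
  assumes "P \<noteq> 0" "G \<noteq> 0" "\<And>r. C r \<Longrightarrow> r > 0"
    and lim: "\<And>Q r. C r \<Longrightarrow> (\<lambda>k. fps_nth (fps_of_poly Q * G) k * r ^ k) \<longlonglongrightarrow> 0"
    and "size (filter_mset C (proots P)) = m"
  shows "\<exists>\<sigma> idx. sign_chain (fps_nth (fps_of_poly P * G)) \<sigma> idx m"
  using assms(1,5)
proof (induction m arbitrary: P)
  case 0
  have "fps_of_poly P * G \<noteq> 0" using 0 assms(2) by simp
  then obtain k where "fps_nth (fps_of_poly P * G) k \<noteq> 0" by (metis fps_ext fps_zero_nth)
  then have "sign_chain (fps_nth (fps_of_poly P * G)) (fps_nth (fps_of_poly P * G) k) (\<lambda>_. k) 0"
    unfolding sign_chain_def by (simp flip: power2_eq_square)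
  then show ?case by blast
next
  case (Suc m)
  from size_eq_Suc_imp_elem[OF Suc.prems(2)]
  obtain r where r: "r \<in># filter_mset C (proots P)" by blast
  then have C: "C r" and "poly P r = 0" using Suc.prems by auto
  then obtain Q where Q: "P = [:-r, 1:] * Q" by (metis poly_eq_0_iff_dvd dvdE)
  then have Q0: "Q \<noteq> 0" using Suc.prems by auto
  have "proots P = {#r#} + proots Q" unfolding Q using Q0 by (subst proots_mult) auto
  then have "size (filter_mset C (proots Q)) = m" using Suc.prems C by simp
  then obtain \<sigma> idx where ch: "sign_chain (fps_nth (fps_of_poly Q * G)) \<sigma> idx m"
    using Suc.IH Q0 by blast
  have "fps_of_poly [:-r, 1:] = fps_X - fps_const r"
    by (simp add: fps_of_poly_pCons)
  then have eq: "fps_of_poly P * G = fps_X * (fps_of_poly Q * G) - fps_const r * (fps_of_poly Q * G)"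
    by (simp only: Q fps_of_poly_mult left_diff_distrib mult.assoc)
  show ?case
    by (rule sign_chain_step[OF ch _ lim[OF C]]) (use assms(3)[OF C] in \<open>simp_all add: eq\<close>)
qed

lemma geo_square_nth: "fps_nth (F * geo * geo) k = (\<Sum>i=0..k. (real k + 1 - real i) * fps_nth F i)"
proof (induction k)
  case (Suc k)
  have "fps_nth (F * geo * geo) (Suc k) = fps_nth (F * geo * geo) k + fps_nth (F * geo) (Suc k)"
    by (simp add: geo_mult_nth)
  then show ?case unfolding Suc
    by (simp add: geo_mult_nth sum.distrib[symmetric] algebra_simps)
qed (simp add: geo_mult_nth)

lemma poly_geo_limit:
  assumes "0 < r" "r < 1"
  shows "(\<lambda>k. fps_nth (fps_of_poly Q * (geo * geo)) k * r ^ k) \<longlonglongrightarrow> 0"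
proof (rule Lim_null_comparison)
  define B where "B = (\<Sum>i=0..degree Q. \<bar>coeff Q i\<bar>)"
  have bd: "\<bar>fps_nth (fps_of_poly Q * (geo * geo)) k\<bar> \<le> (real k + 1) * B" for k
  proof -
    have "\<bar>fps_nth (fps_of_poly Q * (geo * geo)) k\<bar> = \<bar>fps_nth (fps_of_poly Q * geo * geo) k\<bar>"
      by (simp add: mult.assoc)
    also have "\<dots> \<le> (\<Sum>i=0..k. \<bar>(real k + 1 - real i) * coeff Q i\<bar>)"
      unfolding geo_square_nth by (simp only: fps_of_poly_nth sum_abs)
    also have "\<dots> \<le> (\<Sum>i=0..k. (real k + 1) * \<bar>coeff Q i\<bar>)"
      by (intro sum_mono) (auto simp: abs_mult intro!: mult_right_mono)
    also have "\<dots> = (real k + 1) * (\<Sum>i=0..k. \<bar>coeff Q i\<bar>)" by (simp add: sum_distrib_left)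
    also have "(\<Sum>i=0..k. \<bar>coeff Q i\<bar>) \<le> (\<Sum>i=0..max k (degree Q). \<bar>coeff Q i\<bar>)"
      by (intro sum_mono2) auto
    also have "\<dots> = B" unfolding B_def
      by (intro sum.mono_neutral_right) (auto simp: coeff_eq_0)
    finally show ?thesis by (simp add: mult_left_mono)
  qed
  show "\<forall>\<^sub>F k in sequentially. norm (fps_nth (fps_of_poly Q * (geo * geo)) k * r ^ k) \<le> B * (real k * r ^ k + r ^ k)"
  proof (intro always_eventually allI)
    fix k
    have "norm (fps_nth (fps_of_poly Q * (geo * geo)) k * r ^ k) \<le> ((real k + 1) * B) * r ^ k"
      using bd[of k] assms by (simp add: abs_mult mult_right_mono)
    then show "norm (fps_nth (fps_of_poly Q * (geo * geo)) k * r ^ k) \<le> B * (real k * r ^ k + r ^ k)"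
      by (simp add: algebra_simps)
  qed
  have "(\<lambda>k. real k * r ^ k) \<longlonglongrightarrow> 0" using powser_times_n_limit_0[of r] assms by simp
  moreover have "(\<lambda>k. r ^ k) \<longlonglongrightarrow> 0" using assms by (intro LIMSEQ_power_zero) auto
  ultimately have "(\<lambda>k. B * (real k * r ^ k + r ^ k)) \<longlonglongrightarrow> B * (0 + 0)" by (intro tendsto_add tendsto_mult tendsto_const)
  then show "(\<lambda>k. B * (real k * r ^ k + r ^ k)) \<longlonglongrightarrow> 0" by simp
qed

lemma size_filter_split:
  assumes "\<And>x. C x \<Longrightarrow> C1 x \<or> C2 x"
  shows "size (filter_mset C M) \<le> size (filter_mset C1 M) + size (filter_mset C2 M)"
  by (induction M) (use assms in auto)

lemma size_filter_eq_count: "size (filter_mset (\<lambda>x. x = y) M) = count M y"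
  by (induction M) auto

text \<open>The factors \<open>x - r\<close> with \<open>r < 1\<close> each add a sign change because the coefficients of \<open>Q / (1 - x)\<^sup>2\<close>
  grow linearly. This fails for \<open>r = 1\<close>, but if \<open>1\<close> is at least a double root then \<open>P / (1 - x)\<^sup>2\<close> is itself a
  polynomial, to which the classical rule of signs applies; at most two roots at \<open>1\<close> are lost.\<close>
lemma roots_unit_interval_sign_chain:
  fixes P :: "real poly"
  assumes P: "P \<noteq> 0"
  shows "\<exists>m \<sigma> idx. sign_chain (fps_nth (fps_of_poly P * geo * geo)) \<sigma> idx m \<and>
           size (filter_mset (\<lambda>r. 0 < r \<and> r \<le> 1) (proots P)) \<le> m + 2"
proof (cases "order 1 P \<le> 2")
  case True
  define m where "m = size (filter_mset (\<lambda>r. 0 < r \<and> r < 1) (proots P))"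
  have "(geo * geo) \<noteq> 0" using one_minus_X_geo by (metis mult_zero_right mult_eq_0_iff zero_neq_one)
  then have "\<exists>\<sigma> idx. sign_chain (fps_nth (fps_of_poly P * (geo * geo))) \<sigma> idx m"
    by (intro sign_chain_roots[where C = "\<lambda>r. 0 < r \<and> r < 1"] poly_geo_limit) (auto simp: m_def P)
  moreover have "size (filter_mset (\<lambda>r. 0 < r \<and> r \<le> 1) (proots P)) \<le>
      size (filter_mset (\<lambda>r. 0 < r \<and> r < 1) (proots P)) + size (filter_mset (\<lambda>r. r = 1) (proots P))"
    by (rule size_filter_split) auto
  then have "size (filter_mset (\<lambda>r. 0 < r \<and> r \<le> 1) (proots P)) \<le> m + 2"
    using True P by (simp add: m_def size_filter_eq_count)
  ultimately show ?thesis by (auto simp: mult.assoc)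
next
  case False
  then have "[:-1, 1:] ^ 2 dvd P"
    using order_1[of 1 P] power_le_dvd[of "[:-1,1:]" "order 1 P" P 2] by simp
  then obtain R where R: "P = [:-1, 1:] ^ 2 * R" by (elim dvdE)
  then have R0: "R \<noteq> 0" using P by auto
  define m where "m = size (filter_mset (\<lambda>r. r > 0) (proots R))"
  have lim: "(\<lambda>k. fps_nth (fps_of_poly Q * 1) k * r ^ k) \<longlonglongrightarrow> 0" for Q :: "real poly" and r :: real
    by (rule tendsto_eventually)
       (auto simp: eventually_sequentially coeff_eq_0 intro!: exI[of _ "Suc (degree Q)"])
  have "\<exists>\<sigma> idx. sign_chain (fps_nth (fps_of_poly R * 1)) \<sigma> idx m"
    by (rule sign_chain_roots[where C = "\<lambda>r. r > 0"]) (use lim in \<open>auto simp: m_def R0\<close>)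
  moreover have "fps_of_poly P * geo * geo = fps_of_poly R"
  proof -
    have "fps_of_poly [:-1, 1:] = - (1 - fps_X :: real fps)"
      by (simp add: fps_of_poly_pCons)
    then have "fps_of_poly P * geo * geo = ((1 - fps_X) * geo) * ((1 - fps_X) * geo) * fps_of_poly R"
      by (simp add: R fps_of_poly_mult power2_eq_square mult_ac)
    then show ?thesis by (simp add: one_minus_X_geo)
  qed
  moreover have "size (filter_mset (\<lambda>r. 0 < r \<and> r \<le> 1) (proots P)) \<le> m + 2"
  proof -
    have "proots P = repeat_mset 2 {#1#} + proots R"
      unfolding R using R0 by (subst proots_mult) (auto simp: proots_power)
    moreover have "size (filter_mset (\<lambda>r. 0 < r \<and> r \<le> 1) (proots R)) \<le> m"
      unfolding m_def using size_filter_split[of "\<lambda>r. 0 < r \<and> r \<le> 1" "\<lambda>r. 0 < r" "\<lambda>_. False" "proots R"] by simp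
    ultimately show ?thesis by (simp add: numeral_2_eq_2)
  qed
  ultimately show ?thesis by auto
qed

text \<open>Beyond \<open>N\<close> the sequence is affine and changes sign at most once. The leading zeros counted by \<open>z\<close>
  are crossings too, which accounts for the roots of a polynomial at \<open>0\<close>.\<close>
lemma sign_chain_crossings:
  fixes a D :: "nat \<Rightarrow> real"
  assumes ch: "sign_chain a \<sigma> idx m"
    and D: "\<And>k. a (Suc k) - a k = D (Suc k)" and D0: "D 0 = a 0"
    and aff: "\<And>k. k \<ge> N \<Longrightarrow> D (Suc k) = \<delta>"
    and z: "\<And>k. k < z \<Longrightarrow> a k = 0" "z \<le> Suc N"
  shows "m + z \<le> Suc (card {k\<in>{0..N}. \<bar>a k\<bar> \<le> \<bar>D k\<bar>})"
proof -
  define s where "s t = \<sigma> * (-1) ^ t" for t :: nat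
  have pos: "s t * a (idx t) > 0" if "t \<le> m" for t
    using ch that unfolding sign_chain_def s_def by auto
  have inc: "idx t < idx (Suc t)" if "t < m" for t
    using ch that unfolding sign_chain_def by auto
  have sS: "s (Suc t) = - s t" for t by (simp add: s_def)
  have ex: "\<exists>k. idx t < k \<and> k \<le> idx (Suc t) \<and> s t * a k \<le> 0 \<and> s t * a (k - 1) > 0" if t: "t < m" for t
  proof -
    define Q where "Q k \<longleftrightarrow> idx t < k \<and> s t * a k \<le> 0" for k
    have Q1: "Q (idx (Suc t))" using pos[of "Suc t"] inc t sS[of t] by (auto simp: Q_def)
    define k where "k = (LEAST k. Q k)"
    have Qk: "Q k" unfolding k_def using Q1 by (rule LeastI)
    have kle: "k \<le> idx (Suc t)" unfolding k_def using Q1 by (rule Least_le)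
    have nQ: "\<not> Q i" if "i < k" for i using that not_less_Least unfolding k_def by blast
    have "s t * a (k - 1) > 0"
    proof (cases "k - 1 = idx t")
      case True
      then show ?thesis using pos[of t] t by simp
    next
      case False
      then show ?thesis using nQ[of "k - 1"] Qk unfolding Q_def by auto
    qed
    then show ?thesis using Qk kle unfolding Q_def by auto
  qed
  then obtain f where f: "\<And>t. t < m \<Longrightarrow> idx t < f t \<and> f t \<le> idx (Suc t) \<and> s t * a (f t) \<le> 0 \<and> s t * a (f t - 1) > 0"
    by metis
  have affine: "a (N + j) = a N + real j * \<delta>" for j
  proof (induction j)
    case (Suc j)
    then show ?case using D[of "N + j"] aff[of "N + j"] by (simp add: algebra_simps)
  qed simp
  have fN: "f t \<le> N" if t: "Suc t < m" for t
  proof (rule ccontr)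
    assume "\<not> f t \<le> N"
    define i1 i2 i3 where "i1 = f t - 1 - N" and "i2 = idx (Suc t) - N" and "i3 = idx (Suc (Suc t)) - N"
    have o: "i1 < i2" "i2 < i3"
      using f[of t] inc[of "Suc t"] t \<open>\<not> f t \<le> N\<close> by (auto simp: i1_def i2_def i3_def)
    have e: "N + i1 = f t - 1" "N + i2 = idx (Suc t)" "N + i3 = idx (Suc (Suc t))"
      using f[of t] inc[of "Suc t"] t \<open>\<not> f t \<le> N\<close> by (auto simp: i1_def i2_def i3_def)
    have p: "s t * a (N + i1) > 0" "s t * a (N + i2) < 0" "s t * a (N + i3) > 0"
      using f[of t] pos[of "Suc t"] pos[of "Suc (Suc t)"] t sS by (auto simp: e)
    have "s t * a (N + i1) + real i1 * (- (s t * \<delta>)) = s t * a (N + i2) + real i2 * (- (s t * \<delta>))"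
      "s t * a (N + i3) + real i3 * (- (s t * \<delta>)) = s t * a (N + i2) + real i2 * (- (s t * \<delta>))"
      unfolding affine by (auto simp: algebra_simps)
    then have "(real i2 - real i1) * (s t * \<delta>) < 0" "(real i3 - real i2) * (s t * \<delta>) > 0"
      using p by (auto simp: algebra_simps)
    then show False using o by (auto simp: zero_less_mult_iff mult_less_0_iff)
  qed
  have ev: "\<bar>a (f t)\<bar> \<le> \<bar>D (f t)\<bar>" if t: "t < m" for t
  proof -
    have "f t > 0" using f[OF t] by auto
    then have "D (f t) = a (f t) - a (f t - 1)" using D[of "f t - 1"] by simp
    moreover have "s t * a (f t) \<le> 0" "s t * a (f t - 1) > 0" using f[OF t] by auto
    ultimately show ?thesis by (auto simp: mult_le_0_iff zero_less_mult_iff)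
  qed
  have idxmono: "idx t \<le> idx t'" if "t \<le> t'" "t' \<le> m" for t t'
    using that
  proof (induction t')
    case (Suc t')
    then show ?case using inc[of t'] by (cases "t = Suc t'") auto
  qed simp
  have smono: "f t < f t'" if "t < t'" "t' < m" for t t'
    using f[of t] f[of t'] that idxmono[of "Suc t" t'] by auto
  have inj: "inj_on f {..<m - 1}"
    by (rule linorder_inj_onI) (use smono in force)+
  have zle: "z \<le> idx 0" using z(1)[of "idx 0"] pos[of 0] by (cases "idx 0 < z") auto
  have zf: "z \<le> f t" if "t < m" for t using f[OF that] zle idxmono[of 0 t] that by auto
  have "{..<z} \<union> f ` {..<m - 1} \<subseteq> {k\<in>{0..N}. \<bar>a k\<bar> \<le> \<bar>D k\<bar>}"
    using z fN ev by auto
  then have "card ({..<z} \<union> f ` {..<m - 1}) \<le> card {k\<in>{0..N}. \<bar>a k\<bar> \<le> \<bar>D k\<bar>}"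
    by (intro card_mono) auto
  moreover have "card ({..<z} \<union> f ` {..<m - 1}) = z + (m - 1)"
    using zf by (subst card_Un_disjoint) (auto simp: card_image[OF inj, simplified] not_less[symmetric])
  ultimately show ?thesis by simp
qed

text \<open>The constant 3 consists of at most two lost roots at 1 and one sign change that may
  occur beyond \<open>N\<close>, where the partial sums of the coefficients no longer
  change.\<close>

lemma roots_le_crossings:
  fixes P :: "real poly"
  assumes P: "P \<noteq> 0" and deg: "degree P \<le> N"
  shows "size (filter_mset (\<lambda>r. 0 \<le> r \<and> r \<le> 1) (proots P)) \<le>
    3 + card {k\<in>{0..N}. \<bar>fps_nth (fps_of_poly P * geo * geo) k\<bar> \<le> \<bar>fps_nth (fps_of_poly P * geo) k\<bar>}"
proof -
  define a D where "a = fps_nth (fps_of_poly P * geo * geo)" and "D = fps_nth (fps_of_poly P * geo)"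
  obtain m \<sigma> idx where ch: "sign_chain a \<sigma> idx m"
    and m: "size (filter_mset (\<lambda>r. 0 < r \<and> r \<le> 1) (proots P)) \<le> m + 2"
    using roots_unit_interval_sign_chain[OF P] unfolding a_def by blast
  define z where "z = order 0 P"
  have "[:-0, 1:] ^ z dvd P" unfolding z_def by (rule order_1)
  then have dv: "monom 1 z dvd P" by (simp add: monom_altdef)
  then have c0: "coeff P k = 0" if "k < z" for k using that monom_1_dvd_iff' by blast
  have zd: "z \<le> degree P" unfolding z_def by (rule order_degree[OF P])
  have "m + z \<le> Suc (card {k\<in>{0..N}. \<bar>a k\<bar> \<le> \<bar>D k\<bar>})"
  proof (rule sign_chain_crossings[OF ch])
    show "a (Suc k) - a k = D (Suc k)" for k
      unfolding a_def D_def by (simp add: geo_mult_nth[of "fps_of_poly P * geo"])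
    show "D 0 = a 0" unfolding a_def D_def by simp
    show "D (Suc k) = D N" if "k \<ge> N" for k
      unfolding D_def geo_mult_nth
      by (rule sum.mono_neutral_right) (use that deg in \<open>auto intro!: coeff_eq_0\<close>)
    show "a k = 0" if "k < z" for k
      unfolding a_def geo_square_nth using c0 that by auto
  qed (use zd deg in auto)
  moreover have "size (filter_mset (\<lambda>r. 0 \<le> r \<and> r \<le> 1) (proots P)) \<le>
      size (filter_mset (\<lambda>r. 0 < r \<and> r \<le> 1) (proots P)) + size (filter_mset (\<lambda>r. r = 0) (proots P))"
    by (rule size_filter_split) auto
  moreover have "size (filter_mset (\<lambda>r. r = 0) (proots P)) = z"
    using P by (simp add: size_filter_eq_count z_def)
  ultimately show ?thesis using m unfolding a_def D_def by simp
qed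

section \<open>The Littlewood--Offord inequality\<close>

text \<open>The LYM inequality by double counting: each \<open>A\<close> owns the listings of
  \<open>U\<close> that have \<open>A\<close> as an initial segment, and a listing owned by two sets
  would make them comparable.\<close>

lemma antichain_LYM:
  assumes fin: "finite U" and sub: "F \<subseteq> Pow U"
    and anti: "\<And>A B. A \<in> F \<Longrightarrow> B \<in> F \<Longrightarrow> A \<subseteq> B \<Longrightarrow> A = B"
  shows "(\<Sum>A\<in>F. fact (card A) * fact (card U - card A)) \<le> (fact (card U) :: nat)"
proof -
  define L where "L A = (\<lambda>(xs, ys). xs @ ys) ` (permutations_of_set A \<times> permutations_of_set (U - A))" for A
  have finF: "finite F" using fin sub by (meson finite_Pow_iff finite_subset)
  have memL: "xs \<in> permutations_of_set U \<and> set (take (card A) xs) = A" if xs: "xs \<in> L A" and AF: "A \<in> F" for xs A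
  proof -
    obtain ys zs where yz: "xs = ys @ zs" "ys \<in> permutations_of_set A" "zs \<in> permutations_of_set (U - A)"
    proof -
      obtain p where p: "p \<in> permutations_of_set A \<times> permutations_of_set (U - A)" "xs = (\<lambda>(xs, ys). xs @ ys) p"
        using xs unfolding L_def by (rule imageE)
      show thesis by (rule that[of "fst p" "snd p"]) (use p in \<open>auto simp: case_prod_beta mem_Times_iff\<close>)
    qed
    then have "length ys = card A" by (simp add: length_finite_permutations_of_set)
    have AU: "A \<subseteq> U" using AF sub by auto
    have sets: "set ys = A" "distinct ys" "set zs = U - A" "distinct zs"
      using yz by (simp_all add: permutations_of_setD)
    have "set (ys @ zs) = U" unfolding set_append sets using AU by blast
    moreover have "distinct (ys @ zs)" unfolding distinct_append sets by (simp add: sets)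
    moreover have "set (take (card A) (ys @ zs)) = A"
      using \<open>length ys = card A\<close> by (simp add: sets)
    ultimately show ?thesis unfolding yz(1) by (simp add: permutations_of_setI)
  qed
  have cardL: "card (L A) = fact (card A) * fact (card U - card A)" if "A \<in> F" for A
  proof -
    have A: "A \<subseteq> U" using that sub by auto
    then have finA: "finite A" using fin by (rule finite_subset)
    have "inj_on (\<lambda>(xs, ys). xs @ ys) (permutations_of_set A \<times> permutations_of_set (U - A))"
    proof (rule inj_onI, clarify)
      fix xs ys xs' ys'
      assume "xs \<in> permutations_of_set A" "xs' \<in> permutations_of_set A" "xs @ ys = xs' @ ys'"
      moreover from this have "length xs = length xs'"
        by (metis length_finite_permutations_of_set)
      ultimately show "xs = xs' \<and> ys = ys'" by simp
    qed
    then show ?thesis unfolding L_def using A finA fin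
      by (subst card_image) (auto simp: card_cartesian_product card_Diff_subset)
  qed
  have "(\<Sum>A\<in>F. fact (card A) * fact (card U - card A)) = (\<Sum>A\<in>F. card (L A))"
    using cardL by simp
  also have "\<dots> = card (\<Union>A\<in>F. L A)"
  proof (rule card_UN_disjoint[symmetric])
    show "\<forall>i\<in>F. finite (L i)" unfolding L_def by auto
    show "\<forall>A\<in>F. \<forall>B\<in>F. A \<noteq> B \<longrightarrow> L A \<inter> L B = {}"
    proof (intro ballI impI, rule ccontr)
      fix A B assume AB: "A \<in> F" "B \<in> F" "A \<noteq> B" "L A \<inter> L B \<noteq> {}"
      then obtain xs where "xs \<in> L A" "xs \<in> L B" by auto
      then have "set (take (card A) xs) = A" "set (take (card B) xs) = B" using memL AB by auto
      then have "A \<subseteq> B \<or> B \<subseteq> A"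
        using set_take_subset_set_take[of "card A" "card B" xs] set_take_subset_set_take[of "card B" "card A" xs]
        by (cases "card A \<le> card B") auto
      then show False using anti AB by blast
    qed
  qed (rule finF)
  also have "\<dots> \<le> card (permutations_of_set U)"
    using memL by (intro card_mono) auto
  also have "\<dots> = fact (card U)" using fin by simp
  finally show ?thesis .
qed

text \<open>Sperner's theorem: every term of the LYM sum is at least the term of the middle size,
  since the binomial coefficient is largest there.\<close>

lemma antichain_card_le:
  assumes fin: "finite U" and sub: "F \<subseteq> Pow U"
    and anti: "\<And>A B. A \<in> F \<Longrightarrow> B \<in> F \<Longrightarrow> A \<subseteq> B \<Longrightarrow> A = B"
  shows "card F \<le> card U choose (card U div 2)"
proof -
  define N where "N = card U"
  define w where "w = fact (N div 2) * (fact (N - N div 2) :: nat)"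
  have "w \<le> fact (card A) * fact (N - card A)" if "A \<in> F" for A
  proof -
    have le: "card A \<le> N" using that sub fin unfolding N_def by (auto intro: card_mono)
    have "fact (card A) * fact (N - card A) * (N choose card A) = fact (N div 2) * fact (N - N div 2) * (N choose (N div 2))"
      using binomial_fact_lemma[OF le] binomial_fact_lemma[of "N div 2" N] by simp
    then have "w * (N choose (N div 2)) = fact (card A) * fact (N - card A) * (N choose card A)"
      by (simp add: w_def)
    also have "\<dots> \<le> fact (card A) * fact (N - card A) * (N choose (N div 2))"
      by (intro mult_left_mono binomial_maximum) auto
    finally show ?thesis by simp
  qed
  then have "card F * w \<le> (\<Sum>A\<in>F. fact (card A) * fact (N - card A))"
    using sum_bounded_below[of F w] by simp
  also have "\<dots> \<le> fact N" unfolding N_def by (rule antichain_LYM[OF assms])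
  also have "\<dots> = w * (N choose (N div 2))"
    using binomial_fact_lemma[of "N div 2" N] by (simp add: w_def)
  finally show ?thesis by (simp add: w_def N_def)
qed

text \<open>The factor \<open>2 * m + 1\<close> makes the induction close: with the ratio
  \<open>2 * (2 * m + 1) / (m + 1)\<close> of consecutive central binomials it only remains that
  \<open>(2 * m + 1) * (2 * m + 3) \<le> 4 * (m + 1)^2\<close>.\<close>

lemma central_binomial_square: "real ((2 * m) choose m) ^ 2 * (2 * real m + 1) \<le> 16 ^ m"
proof (induction m)
  case (Suc m)
  define c where "c = real ((2 * m) choose m)"
  have "Suc m * (Suc (Suc (2*m)) choose Suc m) = Suc (Suc (2*m)) * (Suc (2*m) choose m)"
    using Suc_times_binomial[of m "Suc (2*m)"] by simp
  then have 1: "real (Suc m) * real (Suc (Suc (2*m)) choose Suc m) = real (Suc (Suc (2*m))) * real (Suc (2*m) choose m)"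
    by (metis of_nat_mult)
  have "Suc m * (Suc (2*m) choose m) = Suc (2*m) * (2*m choose m)"
    using binomial_absorb_comp[of "Suc (2*m)" m] by simp
  then have 2: "real (Suc m) * real (Suc (2*m) choose m) = real (Suc (2*m)) * c"
    unfolding c_def by (metis of_nat_mult)
  have "real (Suc m) * (real (Suc m) * real (Suc (Suc (2*m)) choose Suc m)) = real (Suc (Suc (2*m))) * (real (Suc (2*m)) * c)"
    unfolding 1 2[symmetric] by simp
  then have "(real m + 1) * ((real m + 1) * real (Suc (Suc (2*m)) choose Suc m)) = (real m + 1) * (2 * (2*real m+1) * c)"
    by (simp add: algebra_simps del: binomial_Suc_Suc)
  then have e: "(real m + 1) * real ((2 * Suc m) choose Suc m) = 2 * (2*real m+1) * c"
    by (simp del: binomial_Suc_Suc)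
  have "(real m + 1)^2 * (real ((2 * Suc m) choose Suc m) ^ 2 * (2 * real (Suc m) + 1)) =
     ((real m + 1) * real ((2 * Suc m) choose Suc m))^2 * (2 * real m + 3)"
    by (simp add: power2_eq_square algebra_simps)
  also have "\<dots> = (c^2 * (2 * real m + 1)) * (4 * (2*real m + 1) * (2*real m + 3))"
    unfolding e by (simp add: power2_eq_square algebra_simps)
  also have "\<dots> \<le> 16 ^ m * (16 * (real m + 1)^2)"
  proof (rule mult_mono)
    show "c^2 * (2 * real m + 1) \<le> 16 ^ m" using Suc.IH unfolding c_def .
    show "4 * (2*real m + 1) * (2*real m + 3) \<le> 16 * (real m + 1)^2"
      by (simp add: power2_eq_square algebra_simps)
  qed auto
  finally have "(real m + 1)^2 * (real ((2 * Suc m) choose Suc m) ^ 2 * (2 * real (Suc m) + 1)) \<le> (real m + 1)^2 * 16 ^ Suc m"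
    by (simp add: algebra_simps)
  then show ?case by (rule mult_left_le_imp_le) simp
qed simp

lemma middle_binomial_le:
  assumes "N > 0"
  shows "real (N choose (N div 2)) \<le> 2 ^ N / sqrt (real N)"
proof -
  have ev: "real (2 * m choose m) \<le> 2 ^ (2 * m) / sqrt (real (2 * m))" if "m > 0" for m
  proof -
    have "(real (2 * m choose m) * sqrt (real (2*m)))^2 \<le> real (2 * m choose m) ^ 2 * (2 * real m + 1)"
      by (simp add: power_mult_distrib mult_left_mono)
    also have "\<dots> \<le> (2 ^ (2*m))^2"
    proof -
      have "(2 ^ (2*m))^2 = (16 :: real) ^ m" unfolding power_mult[symmetric] by (simp add: power_mult)
      then show ?thesis using central_binomial_square[of m] by simp
    qed
    finally have "real (2 * m choose m) * sqrt (real (2*m)) \<le> 2 ^ (2*m)"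
      by (rule power2_le_imp_le) simp
    then show ?thesis using that by (simp add: field_simps)
  qed
  show ?thesis
  proof (cases "even N")
    case True
    then obtain m where "N = 2 * m" by (elim evenE)
    then show ?thesis using ev[of m] assms by simp
  next
    case False
    then obtain m where N: "N = 2 * m + 1" by (elim oddE)
    have "2 * (N choose m) = (2 * Suc m choose Suc m)"
      using binomial_symmetric[of m N] by (simp add: N)
    then have "2 * real (N choose m) \<le> 2 ^ (2 * Suc m) / sqrt (real (2 * Suc m))"
      using ev[of "Suc m"] by (metis of_nat_mult of_nat_numeral zero_less_Suc)
    also have "\<dots> \<le> 2 ^ (2 * Suc m) / sqrt (real N)"
      by (intro divide_left_mono real_sqrt_le_mono) (auto simp: N)
    finally show ?thesis by (simp add: N)
  qed
qed

lemma sum_Pow_split: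
  fixes f :: "'a set \<Rightarrow> 'b :: comm_monoid_add"
  assumes "finite P" "G \<subseteq> P"
  shows "(\<Sum>S\<in>Pow P. f S) = (\<Sum>R\<in>Pow (P - G). \<Sum>S\<in>Pow G. f (R \<union> S))"
proof -
  have "(\<Sum>R\<in>Pow (P - G). \<Sum>S\<in>Pow G. f (R \<union> S)) = (\<Sum>(R, S)\<in>Pow (P - G) \<times> Pow G. f (R \<union> S))"
    by (rule sum.cartesian_product)
  also have "\<dots> = (\<Sum>S\<in>Pow P. f S)"
    by (rule sum.reindex_bij_witness[of _ "\<lambda>S. (S - G, S \<inter> G)" "\<lambda>(R, S). R \<union> S"]) (use assms in auto)
  finally show ?thesis by simp
qed

text \<open>Erdos's argument. Taking the symmetric difference with the set of negative terms shifts
  all sums by a constant and makes the terms positive. Then nested distinct sets have sums at least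
  \<open>\<delta>\<close> apart, so the sets with sum in a half-open interval of length
  \<open>\<delta>\<close> form an antichain.\<close>

lemma littlewood_offord_half_open:
  fixes u :: "'a \<Rightarrow> real"
  assumes fin: "finite G" and u: "\<And>p. p \<in> G \<Longrightarrow> \<bar>u p\<bar> \<ge> \<delta>" and "\<delta> > 0"
  shows "card {S\<in>Pow G. x \<le> sum u S \<and> sum u S < x + \<delta>} \<le> card G choose (card G div 2)"
proof -
  define Neg where "Neg = {p\<in>G. u p < 0}"
  define flip where "flip S = (S - Neg) \<union> (Neg - S)" for S
  define F where "F = {S\<in>Pow G. x \<le> sum u S \<and> sum u S < x + \<delta>}"
  have ff: "flip (flip S) = S" for S unfolding flip_def by auto
  have fG: "flip S \<subseteq> G" if "S \<subseteq> G" for S using that unfolding flip_def Neg_def by auto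
  have fs: "(\<Sum>p\<in>flip S. \<bar>u p\<bar>) = sum u S - sum u Neg" if "S \<subseteq> G" for S
  proof -
    have fS: "finite S" "finite Neg" using that fin finite_subset unfolding Neg_def by auto
    have "(\<Sum>p\<in>flip S. \<bar>u p\<bar>) = (\<Sum>p\<in>S - Neg. \<bar>u p\<bar>) + (\<Sum>p\<in>Neg - S. \<bar>u p\<bar>)"
      unfolding flip_def using fS by (intro sum.union_disjoint) auto
    also have "(\<Sum>p\<in>S - Neg. \<bar>u p\<bar>) = (\<Sum>p\<in>S - Neg. u p)"
      using that by (intro sum.cong) (auto simp: Neg_def)
    also have "(\<Sum>p\<in>Neg - S. \<bar>u p\<bar>) = - (\<Sum>p\<in>Neg - S. u p)"
      by (subst sum_negf[symmetric], intro sum.cong) (auto simp: Neg_def)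
    also have "(\<Sum>p\<in>S - Neg. u p) = sum u S - (\<Sum>p\<in>S \<inter> Neg. u p)"
      using fS by (subst sum.Int_Diff[of S u Neg]) auto
    also have "(\<Sum>p\<in>Neg - S. u p) = sum u Neg - (\<Sum>p\<in>Neg \<inter> S. u p)"
      using fS by (subst sum.Int_Diff[of Neg u S]) auto
    finally show ?thesis by (simp add: Int_commute)
  qed
  have "card F = card (flip ` F)"
    by (rule card_image[symmetric]) (metis ff inj_onI)
  also have "\<dots> \<le> card G choose (card G div 2)"
  proof (rule antichain_card_le[OF fin])
    show "flip ` F \<subseteq> Pow G" using fG by (auto simp: F_def)
    fix A B assume AB: "A \<in> flip ` F" "B \<in> flip ` F" "A \<subseteq> B"
    then have G: "A \<subseteq> G" "B \<subseteq> G" using fG by (auto simp: F_def)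
    from AB obtain S T where S: "S \<in> F" "A = flip S" and T: "T \<in> F" "B = flip T" by auto
    have lt: "(\<Sum>p\<in>B. \<bar>u p\<bar>) - (\<Sum>p\<in>A. \<bar>u p\<bar>) < \<delta>"
      using S T fs[of S] fs[of T] by (auto simp: F_def)
    show "A = B"
    proof (rule ccontr)
      assume "A \<noteq> B"
      then obtain p where p: "p \<in> B - A" using AB by blast
      have fB: "finite B" using G fin finite_subset by blast
      have "\<delta> \<le> \<bar>u p\<bar>" using u p G by auto
      also have "\<dots> \<le> (\<Sum>p\<in>B - A. \<bar>u p\<bar>)" using p fB by (intro member_le_sum) auto
      also have "\<dots> = (\<Sum>p\<in>B. \<bar>u p\<bar>) - (\<Sum>p\<in>A. \<bar>u p\<bar>)" using AB fB finite_subset by (intro sum_diff) auto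
      finally show False using lt by simp
    qed
  qed
  finally show ?thesis unfolding F_def .
qed

text \<open>Only the terms in \<open>G\<close> are known to be large; the choice outside
  \<open>G\<close> is fixed first and merely shifts the window.\<close>

lemma littlewood_offord:
  fixes u :: "'a \<Rightarrow> real"
  assumes fin: "finite P" and G: "G \<subseteq> P" "G \<noteq> {}"
    and u: "\<And>p. p \<in> G \<Longrightarrow> \<bar>u p\<bar> \<ge> \<delta>" and d: "\<delta> > 0" and T: "T \<ge> 0"
  shows "(\<Sum>S\<in>Pow P. of_bool (\<bar>x + sum u S\<bar> \<le> T)) \<le> (2 * T / \<delta> + 1) * (2 ^ card P / sqrt (card G))"
proof -
  have finG: "finite G" using G fin finite_subset by auto
  have cG: "card G > 0" using G finG by (simp add: card_gt_0_iff)
  \<comment> \<open>The closed window of length \<open>2 * T\<close> is covered by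
    \<open>M + 1\<close> half-open intervals of length \<open>\<delta>\<close>.\<close>
  define M where "M = nat \<lfloor>2 * T / \<delta>\<rfloor>"
  have M: "real M \<le> 2 * T / \<delta>" "2 * T / \<delta> < real M + 1" unfolding M_def using T d by auto
  have one: "(\<Sum>S\<in>Pow G. of_bool (\<bar>y + sum u S\<bar> \<le> T)) \<le> (2 * T / \<delta> + 1) * (2 ^ card G / sqrt (card G))" for y
  proof -
    define W where "W j = {S\<in>Pow G. (- y - T + real j * \<delta>) \<le> sum u S \<and> sum u S < (- y - T + real j * \<delta>) + \<delta>}" for j :: nat
    have "{S\<in>Pow G. \<bar>y + sum u S\<bar> \<le> T} \<subseteq> (\<Union>j\<in>{..M}. W j)"
    proof
      fix S assume S: "S \<in> {S\<in>Pow G. \<bar>y + sum u S\<bar> \<le> T}"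
      define v where "v = (sum u S + y + T) / \<delta>"
      define j where "j = nat \<lfloor>v\<rfloor>"
      have v: "0 \<le> v" "v \<le> 2 * T / \<delta>" unfolding v_def using S d by (auto intro!: divide_right_mono)
      have j: "real j \<le> v" "v < real j + 1" unfolding j_def using v by auto
      have "real j < real M + 1" using j v M by linarith
      then have "j \<le> M" by linarith
      moreover have "sum u S = v * \<delta> - y - T" unfolding v_def using d by simp
      moreover have "real j * \<delta> \<le> v * \<delta>" "v * \<delta> < (real j + 1) * \<delta>" using j d by auto
      ultimately have "S \<in> W j" using S unfolding W_def by (auto simp: algebra_simps)
      then show "S \<in> (\<Union>j\<in>{..M}. W j)" using \<open>j \<le> M\<close> by auto
    qed
    moreover have "finite (\<Union>j\<in>{..M}. W j)" unfolding W_def using finG by auto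
    ultimately have "card {S\<in>Pow G. \<bar>y + sum u S\<bar> \<le> T} \<le> card (\<Union>j\<in>{..M}. W j)" by (intro card_mono)
    also have "\<dots> \<le> (\<Sum>j\<in>{..M}. card (W j))" by (intro card_UN_le) auto
    also have "\<dots> \<le> (\<Sum>j\<in>{..M}. card G choose (card G div 2))"
      unfolding W_def by (intro sum_mono littlewood_offord_half_open finG u d)
    also have "\<dots> = (M + 1) * (card G choose (card G div 2))" by simp
    finally have "real (card {S\<in>Pow G. \<bar>y + sum u S\<bar> \<le> T}) \<le> real ((M + 1) * (card G choose (card G div 2)))"
      by (rule of_nat_mono)
    then have "real (card {S\<in>Pow G. \<bar>y + sum u S\<bar> \<le> T}) \<le> (real M + 1) * real (card G choose (card G div 2))"
      by (simp only: of_nat_mult of_nat_add of_nat_1)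
    also have "\<dots> \<le> (2 * T / \<delta> + 1) * (2 ^ card G / sqrt (card G))"
      using M T d middle_binomial_le[OF cG] by (intro mult_mono) auto
    finally show ?thesis using finG by (simp add: of_bool_def sum.If_cases Int_def)
  qed
  have "(\<Sum>S\<in>Pow P. of_bool (\<bar>x + sum u S\<bar> \<le> T)) =
     (\<Sum>R\<in>Pow (P - G). \<Sum>S\<in>Pow G. of_bool (\<bar>x + (\<Sum>p\<in>R \<union> S. u p)\<bar> \<le> T) :: real)"
    by (rule sum_Pow_split[OF fin G(1)])
  also have "\<dots> = (\<Sum>R\<in>Pow (P - G). \<Sum>S\<in>Pow G. of_bool (\<bar>(x + sum u R) + sum u S\<bar> \<le> T))"
  proof (intro sum.cong refl)
    fix R S assume "R \<in> Pow (P - G)" "S \<in> Pow G"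
    then have "(\<Sum>p\<in>R \<union> S. u p) = sum u R + sum u S"
      using fin finG by (intro sum.union_disjoint) (auto intro: finite_subset)
    then show "of_bool (\<bar>x + (\<Sum>p\<in>R \<union> S. u p)\<bar> \<le> T) = (of_bool (\<bar>(x + sum u R) + sum u S\<bar> \<le> T) :: real)"
      by (simp add: add.assoc)
  qed
  also have "\<dots> \<le> (\<Sum>R\<in>Pow (P - G). (2 * T / \<delta> + 1) * (2 ^ card G / sqrt (card G)))"
    by (intro sum_mono one)
  also have "\<dots> = (2 * T / \<delta> + 1) * (2 ^ card P / sqrt (card G))"
  proof -
    have "card P = card (P - G) + card G" using fin G
      by (metis card_Diff_subset card_mono finG le_add_diff_inverse2)
    then show ?thesis using fin by (simp add: card_Pow power_add)
  qed
  finally show ?thesis .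
qed

section \<open>Resampling a random permutation by swaps\<close>

text \<open>Probabilities and expectations are finite averages of real functions throughout. They
  meet the integral over \<open>random_perm\<close> only in the final theorem.\<close>

definition avg :: "'a set \<Rightarrow> ('a \<Rightarrow> real) \<Rightarrow> real" where
  "avg A f = sum f A / real (card A)"

lemma avg_mono: "(\<And>x. x \<in> A \<Longrightarrow> f x \<le> g x) \<Longrightarrow> avg A f \<le> avg A g"
  unfolding avg_def by (intro divide_right_mono sum_mono) auto

lemma avg_cong: "(\<And>x. x \<in> A \<Longrightarrow> f x = g x) \<Longrightarrow> avg A f = avg A g"
  unfolding avg_def by simp

lemma avg_add: "avg A (\<lambda>x. f x + g x) = avg A f + avg A g"
  unfolding avg_def by (simp add: sum.distrib add_divide_distrib)

lemma avg_diff: "avg A (\<lambda>x. f x - g x) = avg A f - avg A g"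
  unfolding avg_def by (simp add: sum_subtractf diff_divide_distrib)

lemma avg_cmult: "avg A (\<lambda>x. c * f x) = c * avg A f"
  unfolding avg_def by (simp add: sum_distrib_left)

lemma avg_sum: "avg A (\<lambda>x. \<Sum>i\<in>I. f i x) = (\<Sum>i\<in>I. avg A (f i))"
  unfolding avg_def by (simp add: sum.swap[of _ A] sum_divide_distrib)

lemma avg_const: "finite A \<Longrightarrow> A \<noteq> {} \<Longrightarrow> avg A (\<lambda>_. c) = c"
  unfolding avg_def by simp

lemma avg_swap: "avg A (\<lambda>x. avg B (f x)) = avg B (\<lambda>y. avg A (\<lambda>x. f x y))"
  unfolding avg_def by (simp add: sum_divide_distrib[symmetric] sum.swap[of _ A] mult.commute)

lemma avg_Pow: "finite P \<Longrightarrow> avg (Pow P) f = (\<Sum>S\<in>Pow P. f S) / 2 ^ card P"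
  unfolding avg_def by (simp add: card_Pow)

lemma avg_Pow_const: "finite P \<Longrightarrow> avg (Pow P) (\<lambda>_. c) = c"
  by (simp add: avg_Pow card_Pow)

text \<open>A uniformly random \<open>S \<subseteq> P\<close> has mean subset sum \<open>sum u P / 2\<close>.\<close>
definition dev :: "('a \<Rightarrow> real) \<Rightarrow> 'a set \<Rightarrow> 'a set \<Rightarrow> real" where
  "dev u P S = sum u S - sum u P / 2"

lemma sum_Pow_insert:
  fixes f :: "'a set \<Rightarrow> real"
  assumes "finite P" "q \<notin> P"
  shows "(\<Sum>S\<in>Pow (insert q P). f S) = (\<Sum>S\<in>Pow P. f S + f (insert q S))"
proof -
  have "Pow (insert q P) = Pow P \<union> insert q ` Pow P" by (rule Pow_insert)
  then have "(\<Sum>S\<in>Pow (insert q P). f S) = (\<Sum>S\<in>Pow P. f S) + (\<Sum>S\<in>insert q ` Pow P. f S)"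
    using assms by (simp only:) (rule sum.union_disjoint, auto)
  also have "(\<Sum>S\<in>insert q ` Pow P. f S) = (\<Sum>S\<in>Pow P. f (insert q S))"
    by (rule sum.reindex_cong[of "insert q"]) (use assms in \<open>auto simp: inj_on_def\<close>)
  finally show ?thesis by (simp add: sum.distrib)
qed

text \<open>The variance of a sum of independent terms \<open>u p\<close> times a fair 0-1 variable.
  A new element \<open>q\<close> moves the deviation by plus or minus \<open>u q / 2\<close>, and
  the cross terms cancel.\<close>

lemma avg_dev_square:
  assumes "finite P"
  shows "avg (Pow P) (\<lambda>S. (dev u P S)^2) = (\<Sum>p\<in>P. (u p)^2) / 4"
  using assms
proof (induction P)
  case empty
  then show ?case by (simp add: avg_def dev_def)
next
  case (insert q P)
  have "avg (Pow (insert q P)) (\<lambda>S. (dev u (insert q P) S)^2)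
      = (\<Sum>S\<in>Pow P. (dev u (insert q P) S)^2 + (dev u (insert q P) (insert q S))^2) / 2 ^ card (insert q P)"
    unfolding avg_Pow[OF finite.insertI[OF insert.hyps(1)]] sum_Pow_insert[OF insert.hyps(1,2)] ..
  also have "\<dots> = (\<Sum>S\<in>Pow P. 2 * (dev u P S)^2 + (u q)^2 / 2) / 2 ^ card (insert q P)"
  proof (intro arg_cong2[of _ _ _ _ "(/)"] sum.cong refl)
    fix S assume S: "S \<in> Pow P"
    then have "finite S" using insert.hyps(1) finite_subset by blast
    moreover have "q \<notin> S" using S insert.hyps(2) by auto
    ultimately have *: "dev u (insert q P) (insert q S) = dev u P S + u q / 2" "dev u (insert q P) S = dev u P S - u q / 2"
      using insert.hyps by (simp_all add: dev_def field_simps)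
    then show "(dev u (insert q P) S)^2 + (dev u (insert q P) (insert q S))^2 = 2 * (dev u P S)^2 + (u q)^2 / 2"
      unfolding * by (simp add: power2_eq_square field_simps)
  qed
  also have "\<dots> = avg (Pow P) (\<lambda>S. (dev u P S)^2 + (u q)^2 / 4)"
    unfolding avg_Pow[OF insert.hyps(1)] sum_divide_distrib
    by (intro sum.cong refl) (simp add: insert.hyps field_simps)
  also have "\<dots> = (\<Sum>p\<in>P. (u p)^2) / 4 + (u q)^2 / 4"
    using insert by (simp add: avg_add avg_Pow_const)
  also have "\<dots> = (\<Sum>p\<in>insert q P. (u p)^2) / 4" using insert by (simp add: add_divide_distrib)
  finally show ?case .
qed

lemma littlewood_offord_avg:
  fixes u :: "'a \<Rightarrow> real"
  assumes "finite P" "G \<subseteq> P" "real (card G) \<ge> g" "g > 0"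
    and "\<And>p. p \<in> G \<Longrightarrow> \<bar>u p\<bar> \<ge> \<delta>" "\<delta> > 0" "T \<ge> 0"
  shows "avg (Pow P) (\<lambda>S. of_bool (\<bar>x + sum u S\<bar> \<le> T)) \<le> (2 * T / \<delta> + 1) / sqrt g"
proof -
  have "G \<noteq> {}" using assms by auto
  have "avg (Pow P) (\<lambda>S. of_bool (\<bar>x + sum u S\<bar> \<le> T)) \<le> (2 * T / \<delta> + 1) * (2 ^ card P / sqrt (card G)) / 2 ^ card P"
    unfolding avg_Pow[OF assms(1)]
    by (intro divide_right_mono littlewood_offord[OF assms(1,2) \<open>G \<noteq> {}\<close> assms(5-7)]) auto
  also have "\<dots> = (2 * T / \<delta> + 1) / sqrt (card G)" by simp
  also have "\<dots> \<le> (2 * T / \<delta> + 1) / sqrt g"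
    using assms by (intro divide_left_mono mult_pos_pos) auto
  finally show ?thesis .
qed

abbreviation avg3 :: "'a set \<Rightarrow> 'a set \<Rightarrow> 'a set \<Rightarrow> ('a set \<Rightarrow> 'a set \<Rightarrow> 'a set \<Rightarrow> real) \<Rightarrow> real" where
  "avg3 X Y Z f \<equiv> avg (Pow X) (\<lambda>S. avg (Pow Y) (\<lambda>S'. avg (Pow Z) (f S S')))"

text \<open>If the deviation of \<open>Z\<close> is at most that of \<open>Y\<close>, both can be
  moved into the window for \<open>sum u S\<close>, which becomes \<open>T + 2 * y\<close> and no
  longer involves \<open>S''\<close>. Thus the gains from \<open>Z\<close> (given \<open>S\<close>
  and \<open>S'\<close>) and from \<open>X\<close> (given \<open>S'\<close>) multiply, and the size
  of \<open>y\<close> enters only through its second moment.\<close>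

lemma three_group_half:
  fixes u v w :: "'a \<Rightarrow> real"
  assumes fin: "finite X" "finite Y" "finite Z" and g: "g > 0"
    and GX: "GX \<subseteq> X" "real (card GX) \<ge> g" "\<And>p. p \<in> GX \<Longrightarrow> \<bar>u p\<bar> \<ge> \<delta>X"
    and GZ: "GZ \<subseteq> Z" "real (card GZ) \<ge> g" "\<And>p. p \<in> GZ \<Longrightarrow> \<bar>w p\<bar> \<ge> \<delta>"
    and d: "0 < \<delta>" "\<delta> \<le> \<delta>X" and T: "T \<ge> 0"
  shows "avg3 X Y Z (\<lambda>S S' S''. of_bool (\<bar>a + sum u S + sum v S' + sum w S''\<bar> \<le> T \<and> \<bar>dev w Z S''\<bar> \<le> \<bar>dev v Y S'\<bar>))
     \<le> (3 / 2 * (2 * T / \<delta> + 1)^2 + 2 * (\<Sum>p\<in>Y. (v p)^2) / \<delta>X^2) / g"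
proof -
  define Q where "Q = 2 * T / \<delta> + 1"
  define y where "y S' = \<bar>dev v Y S'\<bar>" for S'
  define a' where "a' = a + sum v Y / 2 + sum w Z / 2"
  have dX: "\<delta>X > 0" using d by simp
  have Q: "Q \<ge> 0" unfolding Q_def using T d by simp
  have inner: "avg (Pow Z) (\<lambda>S''.
     of_bool (\<bar>a + sum u S + sum v S' + sum w S''\<bar> \<le> T \<and> \<bar>dev w Z S''\<bar> \<le> \<bar>dev v Y S'\<bar>))
     \<le> of_bool (\<bar>a' + sum u S\<bar> \<le> T + 2 * y S') * (Q / sqrt g)" for S S'
  proof -
    have "avg (Pow Z) (\<lambda>S''.
     of_bool (\<bar>a + sum u S + sum v S' + sum w S''\<bar> \<le> T \<and> \<bar>dev w Z S''\<bar> \<le> \<bar>dev v Y S'\<bar>))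
     \<le> avg (Pow Z) (\<lambda>S''. of_bool (\<bar>a' + sum u S\<bar> \<le> T + 2 * y S') *
           of_bool (\<bar>(a + sum u S + sum v S') + sum w S''\<bar> \<le> T))"
    proof (rule avg_mono)
      fix S''
      have e: "a + sum u S + sum v S' + sum w S'' = a' + sum u S + dev v Y S' + dev w Z S''"
        by (simp add: a'_def dev_def field_simps)
      have "\<bar>a' + sum u S\<bar> \<le> T + 2 * y S'" if "\<bar>a + sum u S + sum v S' + sum w S''\<bar> \<le> T" "\<bar>dev w Z S''\<bar> \<le> \<bar>dev v Y S'\<bar>"
        using that unfolding e y_def by linarith
      then show "of_bool (\<bar>a + sum u S + sum v S' + sum w S''\<bar> \<le> T \<and> \<bar>dev w Z S''\<bar> \<le> \<bar>dev v Y S'\<bar>)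
        \<le> (of_bool (\<bar>a' + sum u S\<bar> \<le> T + 2 * y S') * of_bool (\<bar>(a + sum u S + sum v S') + sum w S''\<bar> \<le> T) :: real)"
        by (auto simp: of_bool_def)
    qed
    also have "\<dots> \<le> of_bool (\<bar>a' + sum u S\<bar> \<le> T + 2 * y S') * (Q / sqrt g)"
      unfolding avg_cmult Q_def
      by (intro mult_left_mono littlewood_offord_avg[OF fin(3) GZ(1,2) g GZ(3) d(1) T]) auto
    finally show ?thesis .
  qed
  have "avg3 X Y Z (\<lambda>S S' S''. of_bool (\<bar>a + sum u S + sum v S' + sum w S''\<bar> \<le> T \<and> \<bar>dev w Z S''\<bar> \<le> \<bar>dev v Y S'\<bar>))
     \<le> avg (Pow X) (\<lambda>S. avg (Pow Y) (\<lambda>S'. of_bool (\<bar>a' + sum u S\<bar> \<le> T + 2 * y S') * (Q / sqrt g)))"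
    by (intro avg_mono inner)
  also have "\<dots> = avg (Pow Y) (\<lambda>S'. (Q / sqrt g) * avg (Pow X) (\<lambda>S. of_bool (\<bar>a' + sum u S\<bar> \<le> T + 2 * y S')))"
    by (subst avg_swap) (simp add: avg_cmult[symmetric] mult.commute)
  also have "\<dots> \<le> avg (Pow Y) (\<lambda>S'. (Q / sqrt g) * ((2 * (T + 2 * y S') / \<delta>X + 1) / sqrt g))"
    using Q g T by (intro avg_mono mult_left_mono littlewood_offord_avg[OF fin(1) GX(1,2) g GX(3) dX])
      (auto simp: y_def)
  also have "\<dots> \<le> avg (Pow Y) (\<lambda>S'. (3 / 2 * Q^2 + 8 / \<delta>X^2 * (dev v Y S')^2) / g)"
  proof (rule avg_mono)
    fix S'
    define z where "z = 4 * y S' / \<delta>X"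
    have "2 * T / \<delta>X + 1 \<le> Q" unfolding Q_def using T d by (simp add: divide_left_mono)
    moreover have "2 * (T + 2 * y S') / \<delta>X + 1 = (2 * T / \<delta>X + 1) + z" using dX by (simp add: z_def field_simps)
    ultimately have "Q * (2 * (T + 2 * y S') / \<delta>X + 1) \<le> Q * (Q + z)"
      using Q by (intro mult_left_mono) auto
    \<comment> \<open>The product \<open>Q * z\<close> is split into squares so that only the square
      of the deviation remains, whose average is known exactly.\<close>
    also have "\<dots> \<le> 3 / 2 * Q^2 + z^2 / 2"
      using zero_le_power2[of "Q - z"] by (simp add: power2_eq_square algebra_simps)
    also have "z^2 / 2 = 8 / \<delta>X^2 * (dev v Y S')^2"
      by (simp add: z_def y_def power_divide power_mult_distrib)
    finally have "Q * (2 * (T + 2 * y S') / \<delta>X + 1) / g \<le> (3 / 2 * Q^2 + 8 / \<delta>X^2 * (dev v Y S')^2) / g"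
      using g by (intro divide_right_mono) auto
    moreover have "(Q / sqrt g) * ((2 * (T + 2 * y S') / \<delta>X + 1) / sqrt g) = Q * (2 * (T + 2 * y S') / \<delta>X + 1) / g"
      using g by (simp only: times_divide_times_eq real_sqrt_mult_self abs_of_pos)
    ultimately show "(Q / sqrt g) * ((2 * (T + 2 * y S') / \<delta>X + 1) / sqrt g) \<le> (3 / 2 * Q^2 + 8 / \<delta>X^2 * (dev v Y S')^2) / g"
      by (simp only:)
  qed
  also have "\<dots> = avg (Pow Y) (\<lambda>S'. 3 / 2 * Q^2 / g + (8 / \<delta>X^2 / g) * (dev v Y S')^2)"
    by (intro avg_cong) (simp add: add_divide_distrib)
  also have "\<dots> = 3 / 2 * Q^2 / g + (8 / \<delta>X^2 / g) * ((\<Sum>p\<in>Y. (v p)^2) / 4)"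
    unfolding avg_add avg_cmult avg_dev_square[OF fin(2)] using fin by (subst avg_const) auto
  also have "\<dots> = (3 / 2 * Q^2 + 2 * (\<Sum>p\<in>Y. (v p)^2) / \<delta>X^2) / g"
    by (simp add: add_divide_distrib)
  finally show ?thesis unfolding Q_def .
qed

text \<open>One of the two fine sums \<open>Y\<close>, \<open>Z\<close> has the larger deviation; it is held fixed while the
  coarse sum \<open>X\<close> has to hit a window of the size of that deviation and the other fine sum a window of
  size \<open>T\<close>. This gains the factor \<open>1 / sqrt g\<close> twice.\<close>
lemma three_group_small_ball:
  fixes u v w :: "'a \<Rightarrow> real"
  assumes fin: "finite X" "finite Y" "finite Z" and g: "g > 0"
    and GX: "GX \<subseteq> X" "real (card GX) \<ge> g" "\<And>p. p \<in> GX \<Longrightarrow> \<bar>u p\<bar> \<ge> \<delta>X"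
    and GY: "GY \<subseteq> Y" "real (card GY) \<ge> g" "\<And>p. p \<in> GY \<Longrightarrow> \<bar>v p\<bar> \<ge> \<delta>"
    and GZ: "GZ \<subseteq> Z" "real (card GZ) \<ge> g" "\<And>p. p \<in> GZ \<Longrightarrow> \<bar>w p\<bar> \<ge> \<delta>"
    and d: "0 < \<delta>" "\<delta> \<le> \<delta>X" and T: "T \<ge> 0"
  shows "avg3 X Y Z (\<lambda>S S' S''. of_bool (\<bar>a + sum u S + sum v S' + sum w S''\<bar> \<le> T))
     \<le> (3 * (2 * T / \<delta> + 1)^2 + 2 * ((\<Sum>p\<in>Y. (v p)^2) + (\<Sum>p\<in>Z. (w p)^2)) / \<delta>X^2) / g"
proof -
  have "avg3 X Y Z (\<lambda>S S' S''. of_bool (\<bar>a + sum u S + sum v S' + sum w S''\<bar> \<le> T))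
     \<le> avg3 X Y Z (\<lambda>S S' S''. of_bool (\<bar>a + sum u S + sum v S' + sum w S''\<bar> \<le> T \<and> \<bar>dev w Z S''\<bar> \<le> \<bar>dev v Y S'\<bar>)
     + of_bool (\<bar>a + sum u S + sum w S'' + sum v S'\<bar> \<le> T \<and> \<bar>dev v Y S'\<bar> \<le> \<bar>dev w Z S''\<bar>))"
    by (intro avg_mono) (auto simp: of_bool_def add_ac)
  also have "\<dots> = avg3 X Y Z (\<lambda>S S' S''. of_bool (\<bar>a + sum u S + sum v S' + sum w S''\<bar> \<le> T \<and> \<bar>dev w Z S''\<bar> \<le> \<bar>dev v Y S'\<bar>))
     + avg3 X Y Z (\<lambda>S S' S''. of_bool (\<bar>a + sum u S + sum w S'' + sum v S'\<bar> \<le> T \<and> \<bar>dev v Y S'\<bar> \<le> \<bar>dev w Z S''\<bar>))"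
    by (simp only: avg_add)
  also have "avg3 X Y Z (\<lambda>S S' S''. of_bool (\<bar>a + sum u S + sum w S'' + sum v S'\<bar> \<le> T \<and> \<bar>dev v Y S'\<bar> \<le> \<bar>dev w Z S''\<bar>))
     = avg (Pow X) (\<lambda>S. avg (Pow Z) (\<lambda>S''. avg (Pow Y) (\<lambda>S'.
     of_bool (\<bar>a + sum u S + sum w S'' + sum v S'\<bar> \<le> T \<and> \<bar>dev v Y S'\<bar> \<le> \<bar>dev w Z S''\<bar>))))"
    by (intro avg_cong avg_swap)
  also have "\<dots> \<le> (3 / 2 * (2 * T / \<delta> + 1)^2 + 2 * (\<Sum>p\<in>Z. (w p)^2) / \<delta>X^2) / g"
    by (rule three_group_half[OF fin(1,3,2) g GX GY d T])
  also have "avg3 X Y Z (\<lambda>S S' S''. of_bool (\<bar>a + sum u S + sum v S' + sum w S''\<bar> \<le> T \<and> \<bar>dev w Z S''\<bar> \<le> \<bar>dev v Y S'\<bar>))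
     \<le> (3 / 2 * (2 * T / \<delta> + 1)^2 + 2 * (\<Sum>p\<in>Y. (v p)^2) / \<delta>X^2) / g"
    by (rule three_group_half[OF fin g GX GZ d T])
  finally show ?thesis by (simp add: add_divide_distrib distrib_left)
qed

section \<open>Swaps of position pairs and the law of a uniform permutation\<close>

abbreviation perms :: "nat set \<Rightarrow> (nat \<Rightarrow> nat) set" where
  "perms I \<equiv> {\<pi>. \<pi> permutes I}"

abbreviation perm_avg :: "nat set \<Rightarrow> ((nat \<Rightarrow> nat) \<Rightarrow> real) \<Rightarrow> real" where
  "perm_avg I \<equiv> avg (perms I)"

lemma avg_perms_const: "finite I \<Longrightarrow> perm_avg I (\<lambda>_. c) = c"
  by (rule avg_const) (auto simp: finite_permutations intro: permutes_id)

lemma avg_perms_compose: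
  assumes "\<sigma> permutes I"
  shows "perm_avg I (\<lambda>\<pi>. f (\<pi> \<circ> \<sigma>)) = perm_avg I f"
  unfolding avg_def using sum_permutations_compose_right[OF assms, of f] by simp

text \<open>This is an involution only if \<open>S\<close> and its translate by \<open>m\<close> are disjoint.\<close>
definition swaps :: "nat \<Rightarrow> nat set \<Rightarrow> nat \<Rightarrow> nat" where
  "swaps m S i = (if i \<in> S then i + m else if m \<le> i \<and> i - m \<in> S then i - m else i)"

abbreviation pair_supp :: "nat \<Rightarrow> nat set \<Rightarrow> nat set" where
  "pair_supp m P \<equiv> P \<union> (\<lambda>i. i + m) ` P"

lemma swaps_permutes:
  assumes S: "S \<subseteq> P" and dis: "P \<inter> (\<lambda>i. i + m) ` P = {}"
  shows "swaps m S permutes pair_supp m P"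
proof -
  have nin: "i + m \<notin> S" if "i \<in> S" for i using that S dis by blast
  have inv: "swaps m S (swaps m S i) = i" for i
    unfolding swaps_def using nin nin[of "i - m"] by auto
  have out: "swaps m S i = i" if "i \<notin> pair_supp m P" for i
  proof -
    have "\<not> (m \<le> i \<and> i - m \<in> S)" using that S by (auto simp: image_iff) (metis le_add_diff_inverse2 subset_iff)
    moreover have "i \<notin> S" using that S by auto
    ultimately show ?thesis unfolding swaps_def by auto
  qed
  have "\<exists>!j. swaps m S j = i" for i using inv by metis
  with out show ?thesis unfolding permutes_def by blast
qed

text \<open>This gives the permuted sum the form required by Littlewood--Offord: for a random swap
  set it is a constant plus a random subset sum.\<close>

lemma sum_swaps:
  fixes c x :: "nat \<Rightarrow> real"
  assumes I: "finite I" "pair_supp m P \<subseteq> I" and S: "S \<subseteq> P" and dis: "P \<inter> (\<lambda>i. i + m) ` P = {}"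
  shows "(\<Sum>i\<in>I. c i * x (\<pi> (swaps m S i))) = (\<Sum>i\<in>I. c i * x (\<pi> i)) +
     (\<Sum>i\<in>S. (c i - c (i + m)) * (x (\<pi> (i + m)) - x (\<pi> i)))"
proof -
  define S' where "S' = (\<lambda>i. i + m) ` S"
  have sub: "S \<union> S' \<subseteq> I" using I S unfolding S'_def by auto
  have fS: "finite S" using sub I finite_subset by blast
  have disS: "S \<inter> S' = {}" using S dis unfolding S'_def by blast
  have val: "swaps m S i = i + m" "swaps m S (i + m) = i" if "i \<in> S" for i
    using that disS unfolding swaps_def S'_def by auto
  have out: "swaps m S i = i" if "i \<notin> S \<union> S'" for i
    using that unfolding swaps_def S'_def by (auto simp: image_iff)
  have "(\<Sum>i\<in>I. c i * x (\<pi> (swaps m S i))) - (\<Sum>i\<in>I. c i * x (\<pi> i)) = (\<Sum>i\<in>I. c i * (x (\<pi> (swaps m S i)) - x (\<pi> i)))"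
    by (simp add: sum_subtractf right_diff_distrib)
  also have "\<dots> = (\<Sum>i\<in>S \<union> S'. c i * (x (\<pi> (swaps m S i)) - x (\<pi> i)))"
    by (rule sum.mono_neutral_right) (use I sub out in auto)
  also have "\<dots> = (\<Sum>i\<in>S. c i * (x (\<pi> (swaps m S i)) - x (\<pi> i))) + (\<Sum>i\<in>S'. c i * (x (\<pi> (swaps m S i)) - x (\<pi> i)))"
    by (rule sum.union_disjoint) (use fS disS in \<open>auto simp: S'_def\<close>)
  also have "(\<Sum>i\<in>S'. c i * (x (\<pi> (swaps m S i)) - x (\<pi> i))) = (\<Sum>i\<in>S. c (i + m) * (x (\<pi> (swaps m S (i + m))) - x (\<pi> (i + m))))"
    unfolding S'_def by (subst sum.reindex) (auto simp: inj_on_def)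
  also have "(\<Sum>i\<in>S. c i * (x (\<pi> (swaps m S i)) - x (\<pi> i))) + \<dots> = (\<Sum>i\<in>S. (c i - c (i + m)) * (x (\<pi> (i + m)) - x (\<pi> i)))"
    unfolding sum.distrib[symmetric] by (intro sum.cong refl) (simp add: val algebra_simps)
  finally show ?thesis by simp
qed

lemma avg_perms_resample:
  assumes fin: "finite P" and P: "pair_supp m P \<subseteq> I" "P \<inter> (\<lambda>i. i + m) ` P = {}"
  shows "perm_avg I f = perm_avg I (\<lambda>\<pi>. avg (Pow P) (\<lambda>S. f (\<pi> \<circ> swaps m S)))"
proof -
  have "perm_avg I (\<lambda>\<pi>. avg (Pow P) (\<lambda>S. f (\<pi> \<circ> swaps m S))) = avg (Pow P) (\<lambda>S. perm_avg I (\<lambda>\<pi>. f (\<pi> \<circ> swaps m S)))"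
    by (rule avg_swap)
  also have "\<dots> = avg (Pow P) (\<lambda>S. perm_avg I f)"
  proof (rule avg_cong)
    fix S assume "S \<in> Pow P"
    then have "swaps m S permutes I"
      using swaps_permutes[of S P m] P permutes_subset by blast
    then show "perm_avg I (\<lambda>\<pi>. f (\<pi> \<circ> swaps m S)) = perm_avg I f" by (rule avg_perms_compose)
  qed
  also have "\<dots> = perm_avg I f" using fin by (intro avg_const) auto
  finally show ?thesis by simp
qed

text \<open>With \<open>\<pi>\<close> fixed, three rounds of swaps produce a constant plus three
  independent subset sums. A pair with one value in \<open>L\<close> and the other in
  \<open>U\<close> gives a large term. If some group has fewer than \<open>g\<close> such pairs, the
  trivial bound 1 is used, which is the source of the \<open>bad\<close> terms. By
  \<open>Tinv\<close> the window stays fixed during the swaps.\<close>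

lemma perm_small_ball:
  fixes c x :: "nat \<Rightarrow> real" and T :: "(nat \<Rightarrow> nat) \<Rightarrow> real"
  assumes I: "finite I"
    and supp: "pair_supp mX X \<subseteq> I" "pair_supp mY Y \<subseteq> I" "pair_supp mZ Z \<subseteq> I"
    and self: "X \<inter> (\<lambda>i. i + mX) ` X = {}" "Y \<inter> (\<lambda>i. i + mY) ` Y = {}" "Z \<inter> (\<lambda>i. i + mZ) ` Z = {}"
    and dis: "pair_supp mX X \<inter> pair_supp mY Y = {}" "pair_supp mX X \<inter> pair_supp mZ Z = {}"
      "pair_supp mY Y \<inter> pair_supp mZ Z = {}"
    and cX: "\<And>i. i \<in> X \<Longrightarrow> \<bar>c i - c (i + mX)\<bar> \<ge> \<kappa>X"
    and cY: "\<And>i. i \<in> Y \<Longrightarrow> \<bar>c i - c (i + mY)\<bar> \<ge> \<kappa>"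
    and cZ: "\<And>i. i \<in> Z \<Longrightarrow> \<bar>c i - c (i + mZ)\<bar> \<ge> \<kappa>"
    and \<kappa>: "0 < \<kappa>" "\<kappa> \<le> \<kappa>X"
    and LU: "\<And>p q. p \<in> L \<Longrightarrow> q \<in> U \<Longrightarrow> \<bar>x q - x p\<bar> \<ge> \<tau>" "\<tau> > 0"
    and T0: "\<And>\<pi>. T \<pi> \<ge> 0"
    and Tinv: "\<And>\<pi> \<sigma>. \<sigma> permutes (pair_supp mX X \<union> pair_supp mY Y \<union> pair_supp mZ Z) \<Longrightarrow> T (\<pi> \<circ> \<sigma>) = T \<pi>"
    and g: "g > 0"
  defines "bad \<equiv> \<lambda>m P \<pi>. of_bool (real (card {i\<in>P. \<pi> i \<in> L \<and> \<pi> (i + m) \<in> U}) < g) :: real"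
    and "q \<equiv> \<lambda>m P \<pi>. (\<Sum>i\<in>P. ((c i - c (i + m)) * (x (\<pi> (i + m)) - x (\<pi> i)))^2)"
  shows "perm_avg I (\<lambda>\<pi>. of_bool (\<bar>a + (\<Sum>i\<in>I. c i * x (\<pi> i))\<bar> \<le> T \<pi>)) \<le>
    perm_avg I (bad mX X) + perm_avg I (bad mY Y) + perm_avg I (bad mZ Z) +
    (3 * perm_avg I (\<lambda>\<pi>. (2 * T \<pi> / (\<kappa> * \<tau>) + 1)^2)
      + 2 * (perm_avg I (q mY Y) + perm_avg I (q mZ Z)) / (\<kappa>X * \<tau>)^2) / g"
proof -
  define F where "F \<pi> = (of_bool (\<bar>a + (\<Sum>i\<in>I. c i * x (\<pi> i))\<bar> \<le> T \<pi>) :: real)" for \<pi>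
  define u where "u m \<pi> i = (c i - c (i + m)) * (x (\<pi> (i + m)) - x (\<pi> i))" for m \<pi> i
  define rhs where "rhs \<pi> = (3 * (2 * T \<pi> / (\<kappa> * \<tau>) + 1)^2 + 2 * (q mY Y \<pi> + q mZ Z \<pi>) / (\<kappa>X * \<tau>)^2) / g" for \<pi>
  have finXYZ: "finite X" "finite Y" "finite Z" using supp I finite_subset by auto
  have q_eq: "q m P \<pi> = (\<Sum>i\<in>P. (u m \<pi> i)^2)" for m P \<pi> unfolding q_def u_def ..
  have q0: "q m P \<pi> \<ge> 0" for m P \<pi> unfolding q_def by (intro sum_nonneg) auto
  have rhs0: "rhs \<pi> \<ge> 0" for \<pi> unfolding rhs_def using g q0[of mY Y \<pi>] q0[of mZ Z \<pi>]
    by (intro divide_nonneg_nonneg add_nonneg_nonneg mult_nonneg_nonneg) auto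
  have "perm_avg I F = perm_avg I (\<lambda>\<pi>. avg (Pow Z) (\<lambda>S''. F (\<pi> \<circ> swaps mZ S'')))"
    by (rule avg_perms_resample[OF finXYZ(3) supp(3) self(3)])
  also have "\<dots> = perm_avg I (\<lambda>\<pi>. avg (Pow Y) (\<lambda>S'. avg (Pow Z) (\<lambda>S''. F (\<pi> \<circ> swaps mY S' \<circ> swaps mZ S''))))"
    by (rule avg_perms_resample[OF finXYZ(2) supp(2) self(2)])
  also have "\<dots> = perm_avg I (\<lambda>\<pi>. avg3 X Y Z (\<lambda>S S' S''. F (\<pi> \<circ> swaps mX S \<circ> swaps mY S' \<circ> swaps mZ S'')))"
    by (rule avg_perms_resample[OF finXYZ(1) supp(1) self(1)])
  also have "\<dots> \<le> perm_avg I (\<lambda>\<pi>. bad mX X \<pi> + bad mY Y \<pi> + bad mZ Z \<pi> + rhs \<pi>)"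
  proof (rule avg_mono)
    fix \<pi> assume "\<pi> \<in> perms I"
    define a0 where "a0 = a + (\<Sum>i\<in>I. c i * x (\<pi> i))"
    have eq: "F (\<pi> \<circ> swaps mX S \<circ> swaps mY S' \<circ> swaps mZ S'') =
        of_bool (\<bar>a0 + sum (u mX \<pi>) S + sum (u mY \<pi>) S' + sum (u mZ \<pi>) S''\<bar> \<le> T \<pi>)"
      if S: "S \<in> Pow X" "S' \<in> Pow Y" "S'' \<in> Pow Z" for S S' S''
    proof -
      let ?A = "pair_supp mX X" and ?B = "pair_supp mY Y" and ?C = "pair_supp mZ Z"
      have p: "swaps mX S permutes ?A" "swaps mY S' permutes ?B" "swaps mZ S'' permutes ?C"
        using S self by (auto intro!: swaps_permutes)
      have "swaps mX S \<circ> swaps mY S' \<circ> swaps mZ S'' permutes (?A \<union> ?B \<union> ?C)"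
        by (intro permutes_compose) (rule permutes_subset[OF p(3)] permutes_subset[OF p(2)] permutes_subset[OF p(1)]; blast)+
      from Tinv[OF this, of \<pi>] have T: "T (\<pi> \<circ> swaps mX S \<circ> swaps mY S' \<circ> swaps mZ S'') = T \<pi>"
        by (simp add: comp_assoc)
      \<comment> \<open>As the supports are disjoint, the swaps of one group do not move the
        positions of another, so all increments can be read off from \<open>\<pi>\<close>
        itself.\<close>
      have fixX: "swaps mX S i = i" if "i \<in> ?B \<union> ?C" for i
        by (rule permutes_not_in[OF p(1)]) (use that dis in blast)
      have fixY: "swaps mY S' i = i" if "i \<in> ?C" for i
        by (rule permutes_not_in[OF p(2)]) (use that dis in blast)
      have "(\<Sum>i\<in>I. c i * x ((\<pi> \<circ> swaps mX S \<circ> swaps mY S' \<circ> swaps mZ S'') i))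
        = (\<Sum>i\<in>I. c i * x ((\<pi> \<circ> swaps mX S \<circ> swaps mY S') (swaps mZ S'' i)))" by simp
      also have "\<dots> = (\<Sum>i\<in>I. c i * x ((\<pi> \<circ> swaps mX S) (swaps mY S' i))) +
        (\<Sum>i\<in>S''. (c i - c (i + mZ)) * (x ((\<pi> \<circ> swaps mX S \<circ> swaps mY S') (i + mZ)) - x ((\<pi> \<circ> swaps mX S \<circ> swaps mY S') i)))"
        using S self by (subst sum_swaps[OF I supp(3)]) auto
      also have "(\<Sum>i\<in>S''. (c i - c (i + mZ)) * (x ((\<pi> \<circ> swaps mX S \<circ> swaps mY S') (i + mZ)) - x ((\<pi> \<circ> swaps mX S \<circ> swaps mY S') i))) = sum (u mZ \<pi>) S''"
      proof (rule sum.cong[OF refl])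
        fix i assume "i \<in> S''"
        then have "i \<in> ?C" "i + mZ \<in> ?C" using S by auto
        then show "(c i - c (i + mZ)) * (x ((\<pi> \<circ> swaps mX S \<circ> swaps mY S') (i + mZ)) - x ((\<pi> \<circ> swaps mX S \<circ> swaps mY S') i)) = u mZ \<pi> i"
          using fixX[of i] fixX[of "i + mZ"] fixY[of i] fixY[of "i + mZ"] by (simp add: u_def)
      qed
      also have "(\<Sum>i\<in>I. c i * x ((\<pi> \<circ> swaps mX S) (swaps mY S' i))) =
        (\<Sum>i\<in>I. c i * x (\<pi> (swaps mX S i))) +
        (\<Sum>i\<in>S'. (c i - c (i + mY)) * (x ((\<pi> \<circ> swaps mX S) (i + mY)) - x ((\<pi> \<circ> swaps mX S) i)))"
        using S self by (subst sum_swaps[OF I supp(2)]) auto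
      also have "(\<Sum>i\<in>S'. (c i - c (i + mY)) * (x ((\<pi> \<circ> swaps mX S) (i + mY)) - x ((\<pi> \<circ> swaps mX S) i))) = sum (u mY \<pi>) S'"
      proof (rule sum.cong[OF refl])
        fix i assume "i \<in> S'"
        then have "i \<in> ?B" "i + mY \<in> ?B" using S by auto
        then show "(c i - c (i + mY)) * (x ((\<pi> \<circ> swaps mX S) (i + mY)) - x ((\<pi> \<circ> swaps mX S) i)) = u mY \<pi> i"
          using fixX[of i] fixX[of "i + mY"] by (simp add: u_def)
      qed
      also have "(\<Sum>i\<in>I. c i * x (\<pi> (swaps mX S i))) = (\<Sum>i\<in>I. c i * x (\<pi> i)) + sum (u mX \<pi>) S"
        using S self unfolding u_def by (subst sum_swaps[OF I supp(1)]) auto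
      finally show ?thesis unfolding F_def T a0_def by (simp add: add.assoc)
    qed
    have "avg3 X Y Z (\<lambda>S S' S''. F (\<pi> \<circ> swaps mX S \<circ> swaps mY S' \<circ> swaps mZ S'')) =
      avg3 X Y Z (\<lambda>S S' S''. of_bool (\<bar>a0 + sum (u mX \<pi>) S + sum (u mY \<pi>) S' + sum (u mZ \<pi>) S''\<bar> \<le> T \<pi>))"
      by (intro avg_cong eq)
    also have "\<dots> \<le> bad mX X \<pi> + bad mY Y \<pi> + bad mZ Z \<pi> + rhs \<pi>"
    proof (cases "bad mX X \<pi> = 0 \<and> bad mY Y \<pi> = 0 \<and> bad mZ Z \<pi> = 0")
      case True
      define G where "G m P = {i\<in>P. \<pi> i \<in> L \<and> \<pi> (i + m) \<in> U}" for m P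
      have G: "real (card (G mX X)) \<ge> g" "real (card (G mY Y)) \<ge> g" "real (card (G mZ Z)) \<ge> g"
        using True unfolding bad_def G_def by (auto simp: not_less)
      have low: "\<bar>u m \<pi> i\<bar> \<ge> k * \<tau>" if "i \<in> G m P" "k \<le> \<bar>c i - c (i + m)\<bar>" "0 < k" for m i P k
        unfolding u_def abs_mult using that LU by (intro mult_mono) (auto simp: G_def)
      have "avg3 X Y Z (\<lambda>S S' S''. of_bool (\<bar>a0 + sum (u mX \<pi>) S + sum (u mY \<pi>) S' + sum (u mZ \<pi>) S''\<bar> \<le> T \<pi>)) \<le> rhs \<pi>"
        unfolding rhs_def q_eq
      proof (rule three_group_small_ball[where GX = "G mX X" and GY = "G mY Y" and GZ = "G mZ Z"])
        show "\<kappa>X * \<tau> \<le> \<bar>u mX \<pi> p\<bar>" if "p \<in> G mX X" for p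
          using that cX \<kappa> by (intro low) (auto simp: G_def)
        show "\<kappa> * \<tau> \<le> \<bar>u mY \<pi> p\<bar>" if "p \<in> G mY Y" for p
          using that cY \<kappa> by (intro low) (auto simp: G_def)
        show "\<kappa> * \<tau> \<le> \<bar>u mZ \<pi> p\<bar>" if "p \<in> G mZ Z" for p
          using that cZ \<kappa> by (intro low) (auto simp: G_def)
      qed (use finXYZ g G \<kappa> LU(2) T0 in \<open>auto simp: G_def\<close>)
      then show ?thesis using True by simp
    next
      case False
      then have "1 \<le> bad mX X \<pi> + bad mY Y \<pi> + bad mZ Z \<pi>" unfolding bad_def by (auto simp: of_bool_def split: if_splits)
      moreover have "avg3 X Y Z (\<lambda>S S' S''. of_bool (\<bar>a0 + sum (u mX \<pi>) S + sum (u mY \<pi>) S' + sum (u mZ \<pi>) S''\<bar> \<le> T \<pi>)) \<le>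
         avg3 X Y Z (\<lambda>S S' S''. 1)"
        by (intro avg_mono) auto
      moreover have "avg3 X Y Z (\<lambda>S S' S''. 1) = 1"
        using finXYZ by (simp add: avg_Pow_const)
      ultimately show ?thesis using rhs0[of \<pi>] by linarith
    qed
    finally show "avg3 X Y Z (\<lambda>S S' S''. F (\<pi> \<circ> swaps mX S \<circ> swaps mY S' \<circ> swaps mZ S''))
      \<le> bad mX X \<pi> + bad mY Y \<pi> + bad mZ Z \<pi> + rhs \<pi>" .
  qed
  also have "\<dots> = perm_avg I (bad mX X) + perm_avg I (bad mY Y) + perm_avg I (bad mZ Z) + perm_avg I rhs"
    by (simp only: avg_add)
  also have "perm_avg I rhs = perm_avg I (\<lambda>\<pi>. (3 / g) * (2 * T \<pi> / (\<kappa> * \<tau>) + 1)^2 +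
      ((2 / (\<kappa>X * \<tau>)^2 / g) * q mY Y \<pi> + (2 / (\<kappa>X * \<tau>)^2 / g) * q mZ Z \<pi>))"
    by (intro avg_cong) (simp add: rhs_def add_divide_distrib distrib_left)
  also have "\<dots> = (3 * perm_avg I (\<lambda>\<pi>. (2 * T \<pi> / (\<kappa> * \<tau>) + 1)^2)
      + 2 * (perm_avg I (q mY Y) + perm_avg I (q mZ Z)) / (\<kappa>X * \<tau>)^2) / g"
    unfolding avg_add avg_cmult by (simp add: add_divide_distrib distrib_left)
  finally show ?thesis unfolding F_def .
qed

section \<open>Moments of permutation statistics\<close>

text \<open>Since \<open>F\<close> does not notice the exchange of \<open>i\<close> with another
  position outside \<open>Q\<close>, all these positions have the same weighted average. Repeated
  use computes joint moments one position at a time, as in drawing without replacement.\<close>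

lemma exchangeable:
  assumes I: "finite I" and Q: "i \<in> I - Q"
    and F: "\<And>\<pi> j. j \<in> I - Q \<Longrightarrow> F (\<pi> \<circ> Transposition.transpose i j) = F \<pi>"
  shows "real (card (I - Q)) * perm_avg I (\<lambda>\<pi>. F \<pi> * f (\<pi> i)) = perm_avg I (\<lambda>\<pi>. F \<pi> * (\<Sum>j\<in>I - Q. f (\<pi> j)))"
proof -
  have eq: "perm_avg I (\<lambda>\<pi>. F \<pi> * f (\<pi> j)) = perm_avg I (\<lambda>\<pi>. F \<pi> * f (\<pi> i))" if j: "j \<in> I - Q" for j
  proof -
    have "Transposition.transpose i j permutes I" using Q j by (intro permutes_swap_id) auto
    from avg_perms_compose[OF this, of "\<lambda>\<pi>. F \<pi> * f (\<pi> j)"]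
    show ?thesis using F[OF j] by simp
  qed
  have "perm_avg I (\<lambda>\<pi>. F \<pi> * (\<Sum>j\<in>I - Q. f (\<pi> j))) = (\<Sum>j\<in>I - Q. perm_avg I (\<lambda>\<pi>. F \<pi> * f (\<pi> j)))"
    unfolding sum_distrib_left by (rule avg_sum)
  also have "\<dots> = real (card (I - Q)) * perm_avg I (\<lambda>\<pi>. F \<pi> * f (\<pi> i))"
    using eq by simp
  finally show ?thesis by simp
qed

lemma perms_sum: "\<pi> \<in> perms I \<Longrightarrow> (\<Sum>j\<in>I. f (\<pi> j)) = sum f I"
  using sum.permute[of \<pi> I f] by (simp add: comp_def)

lemma perms_sum_minus:
  fixes f :: "nat \<Rightarrow> real"
  assumes "\<pi> \<in> perms I" "finite I" "Q \<subseteq> I"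
  shows "(\<Sum>j\<in>I - Q. f (\<pi> j)) = sum f I - (\<Sum>j\<in>Q. f (\<pi> j))"
  using perms_sum[OF assms(1), of f] assms(2,3) by (simp add: sum_diff)

lemma avg_perms_single:
  fixes f :: "nat \<Rightarrow> real"
  assumes I: "finite I" "i \<in> I"
  shows "perm_avg I (\<lambda>\<pi>. f (\<pi> i)) = sum f I / real (card I)"
proof -
  have "real (card I) * perm_avg I (\<lambda>\<pi>. f (\<pi> i)) = perm_avg I (\<lambda>\<pi>. \<Sum>j\<in>I. f (\<pi> j))"
    using exchangeable[of I i "{}" "\<lambda>_. 1" f] I by simp
  also have "\<dots> = perm_avg I (\<lambda>\<pi>. sum f I)" by (intro avg_cong perms_sum)
  also have "\<dots> = sum f I" using I by (simp only: avg_perms_const)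
  moreover have "card I > 0" using I by (auto simp: card_gt_0_iff)
  ultimately show ?thesis by (simp add: field_simps)
qed

lemma avg_perms_pair:
  fixes f h :: "nat \<Rightarrow> real"
  assumes I: "finite I" "i \<in> I" "j \<in> I" "i \<noteq> j"
  shows "(real (card I) - 1) * perm_avg I (\<lambda>\<pi>. f (\<pi> i) * h (\<pi> j)) =
    (sum f I * sum h I - (\<Sum>k\<in>I. f k * h k)) / real (card I)"
proof -
  have c: "real (card (I - {i})) = real (card I) - 1"
    using I card_gt_0_iff[of I] by (subst card_Diff_singleton) (auto simp: Suc_leI)
  have "(real (card I) - 1) * perm_avg I (\<lambda>\<pi>. f (\<pi> i) * h (\<pi> j))
     = perm_avg I (\<lambda>\<pi>. f (\<pi> i) * (\<Sum>k\<in>I - {i}. h (\<pi> k)))"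
    unfolding c[symmetric] by (rule exchangeable) (use I in \<open>auto simp: Transposition.transpose_def\<close>)
  also have "\<dots> = perm_avg I (\<lambda>\<pi>. (\<lambda>k. sum h I * f k - f k * h k) (\<pi> i))"
    by (rule avg_cong) (use I in \<open>simp add: perms_sum_minus algebra_simps\<close>)
  also have "\<dots> = (\<Sum>k\<in>I. sum h I * f k - f k * h k) / real (card I)"
    by (rule avg_perms_single[OF I(1,2)])
  finally show ?thesis by (simp only: sum_subtractf sum_distrib_left[symmetric] mult.commute[of "sum f I"])
qed

text \<open>Centred values drawn without replacement have covariance \<open>- M / (n - 1)\<close>.
  So beyond the diagonal there is only minus a square, and the diagonal factor
  \<open>1 + 1 / (n - 1)\<close> is at most 2.\<close>

lemma avg_perms_linear_square:
  fixes x c :: "nat \<Rightarrow> real"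
  assumes I: "finite I" "A \<subseteq> I" "card I \<ge> 2" and x: "sum x I = 0"
  defines "M \<equiv> (\<Sum>i\<in>I. (x i)^2) / real (card I)"
  shows "perm_avg I (\<lambda>\<pi>. (\<Sum>i\<in>A. c i * x (\<pi> i))^2) \<le> 2 * M * (\<Sum>i\<in>A. (c i)^2)"
proof -
  define n where "n = real (card I)"
  have n: "n \<ge> 2" using I unfolding n_def by simp
  have finA: "finite A" using I finite_subset by blast
  have M0: "M \<ge> 0" unfolding M_def by (intro divide_nonneg_nonneg sum_nonneg) auto
  have E: "perm_avg I (\<lambda>\<pi>. x (\<pi> i) * x (\<pi> j)) = (if i = j then M + M / (n - 1) else 0) - M / (n - 1)"
    if ij: "i \<in> A" "j \<in> A" for i j
  proof (cases "i = j")
    case True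
    have "perm_avg I (\<lambda>\<pi>. (\<lambda>k. x k * x k) (\<pi> i)) = (\<Sum>k\<in>I. x k * x k) / real (card I)"
      by (rule avg_perms_single) (use I ij in auto)
    then show ?thesis using True by (simp add: M_def power2_eq_square)
  next
    case False
    have "(n - 1) * perm_avg I (\<lambda>\<pi>. x (\<pi> i) * x (\<pi> j)) = - M"
      unfolding n_def M_def using avg_perms_pair[of I i j x x] I ij False x by (auto simp: power2_eq_square)
    then show ?thesis using False n by (simp add: field_simps)
  qed
  have "perm_avg I (\<lambda>\<pi>. (\<Sum>i\<in>A. c i * x (\<pi> i))^2) =
     perm_avg I (\<lambda>\<pi>. \<Sum>i\<in>A. \<Sum>j\<in>A. (c i * c j) * (x (\<pi> i) * x (\<pi> j)))"
    by (intro avg_cong) (simp add: power2_eq_square sum_product algebra_simps)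
  also have "\<dots> = (\<Sum>i\<in>A. \<Sum>j\<in>A. (c i * c j) * ((if i = j then M + M / (n - 1) else 0) - M / (n - 1)))"
    unfolding avg_sum avg_cmult by (intro sum.cong refl arg_cong2[of _ _ _ _ "(*)"] E)
  also have "\<dots> = (\<Sum>i\<in>A. (c i)^2 * (M + M / (n - 1)) - c i * sum c A * (M / (n - 1)))"
  proof (intro sum.cong refl)
    fix i assume i: "i \<in> A"
    have "(\<Sum>j\<in>A. (c i * c j) * ((if i = j then M + M / (n - 1) else 0) - M / (n - 1)))
      = (\<Sum>j\<in>A. (if j = i then c i * c i * (M + M / (n - 1)) else 0)) - (\<Sum>j\<in>A. c i * c j * (M / (n - 1)))"
      unfolding sum_subtractf[symmetric] by (intro sum.cong refl) (auto simp: right_diff_distrib)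
    also have "\<dots> = (c i)^2 * (M + M / (n - 1)) - c i * sum c A * (M / (n - 1))"
      using i finA by (simp add: power2_eq_square sum_distrib_left sum_distrib_right sum_divide_distrib)
    finally show "(\<Sum>j\<in>A. (c i * c j) * ((if i = j then M + M / (n - 1) else 0) - M / (n - 1)))
      = (c i)^2 * (M + M / (n - 1)) - c i * sum c A * (M / (n - 1))" .
  qed
  also have "\<dots> = (\<Sum>i\<in>A. (c i)^2) * (M + M / (n - 1)) - (sum c A)^2 * (M / (n - 1))"
    by (simp only: sum_subtractf sum_distrib_right[symmetric] power2_eq_square)
  also have "\<dots> \<le> (\<Sum>i\<in>A. (c i)^2) * (2 * M)"
  proof -
    have "M / (n - 1) \<le> M / 1" using n M0 by (intro divide_left_mono) auto
    then have "(\<Sum>i\<in>A. (c i)^2) * (M + M / (n - 1)) \<le> (\<Sum>i\<in>A. (c i)^2) * (2 * M)"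
      by (intro mult_left_mono sum_nonneg) auto
    moreover have "(sum c A)^2 * (M / (n - 1)) \<ge> 0" using n M0 by auto
    ultimately show ?thesis by linarith
  qed
  finally show ?thesis by (simp add: mult.commute)
qed

lemma avg_perms_diff_square:
  fixes x c :: "nat \<Rightarrow> real"
  assumes I: "finite I" "i \<in> I" "j \<in> I"
  defines "M \<equiv> (\<Sum>i\<in>I. (x i)^2) / real (card I)"
  shows "perm_avg I (\<lambda>\<pi>. (k * (x (\<pi> j) - x (\<pi> i)))^2) \<le> 4 * M * k^2"
proof -
  have "perm_avg I (\<lambda>\<pi>. (k * (x (\<pi> j) - x (\<pi> i)))^2)
     \<le> perm_avg I (\<lambda>\<pi>. (\<lambda>a. 2 * k^2 * (x a)^2) (\<pi> j) + (\<lambda>a. 2 * k^2 * (x a)^2) (\<pi> i))"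
  proof (rule avg_mono)
    fix \<pi>
    have "(x (\<pi> j) - x (\<pi> i))^2 \<le> 2 * (x (\<pi> j))^2 + 2 * (x (\<pi> i))^2"
      using zero_le_power2[of "x (\<pi> j) + x (\<pi> i)"] by (simp add: power2_eq_square algebra_simps)
    then have "k^2 * (x (\<pi> j) - x (\<pi> i))^2 \<le> k^2 * (2 * (x (\<pi> j))^2 + 2 * (x (\<pi> i))^2)"
      by (intro mult_left_mono) auto
    then show "(k * (x (\<pi> j) - x (\<pi> i)))^2 \<le> 2 * k^2 * (x (\<pi> j))^2 + 2 * k^2 * (x (\<pi> i))^2"
      unfolding power_mult_distrib by (simp add: distrib_left mult_ac)
  qed
  also have "\<dots> = 4 * M * k^2"
    unfolding avg_add avg_perms_single[OF I(1,2), of "\<lambda>a. 2 * k^2 * (x a)^2"] avg_perms_single[OF I(1,3), of "\<lambda>a. 2 * k^2 * (x a)^2"]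
    by (simp add: M_def sum_distrib_left[symmetric])
  finally show ?thesis .
qed

text \<open>Two good pairs are not positively correlated. Given the first pair, one value of
  \<open>L\<close> and one of \<open>U\<close> are used up, so the second pair succeeds with
  probability \<open>(l - 1) / (n - 2)\<close> times \<open>(l - 1) / (n - 3)\<close>. The condition
  \<open>2 * l + 1 \<le> n\<close> is exactly \<open>(l - 1) / (n - 3) \<le> l / (n - 1)\<close>,
  and it also gives \<open>(l - 1) / (n - 2) \<le> l / n\<close>.\<close>

lemma avg_perms_two_pairs:
  assumes I: "finite I" and LU: "L \<subseteq> I" "U \<subseteq> I" "L \<inter> U = {}" "card L = l" "card U = l" "2 * l + 1 \<le> card I" "card I \<ge> 4"
    and l0: "l > 0" and i: "i1 \<in> I" "i2 \<in> I" "j1 \<in> I" "j2 \<in> I" "distinct [i1, i2, j1, j2]"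
  defines "p \<equiv> real l ^ 2 / (real (card I) * (real (card I) - 1))"
  shows "perm_avg I (\<lambda>\<pi>. of_bool (\<pi> i1 \<in> L \<and> \<pi> i2 \<in> U)) = p"
    and "perm_avg I (\<lambda>\<pi>. of_bool (\<pi> i1 \<in> L \<and> \<pi> i2 \<in> U) * of_bool (\<pi> j1 \<in> L \<and> \<pi> j2 \<in> U)) \<le> p\<^sup>2"
proof -
  define n where "n = real (card I)"
  define fL fU where "fL a = (of_bool (a \<in> L) :: real)" and "fU a = (of_bool (a \<in> U) :: real)" for a
  have n: "n \<ge> 4" "n \<ge> 2 * real l + 1" unfolding n_def using LU by linarith+
  have sums: "sum fL I = real l" "sum fU I = real l" "(\<Sum>k\<in>I. fL k * fU k) = 0"
  proof -
    have "L = I \<inter> {a. a \<in> L}" "U = I \<inter> {a. a \<in> U}" using LU by auto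
    then show "sum fL I = real l" "sum fU I = real l"
      unfolding fL_def fU_def using I LU by (simp_all add: of_bool_def sum.If_cases)
    show "(\<Sum>k\<in>I. fL k * fU k) = 0" by (rule sum.neutral) (use LU in \<open>auto simp: fL_def fU_def\<close>)
  qed
  define A where "A \<pi> = fL (\<pi> i1) * fU (\<pi> i2)" for \<pi> :: "nat \<Rightarrow> nat"
  have "(n - 1) * perm_avg I A = real l ^ 2 / n"
    unfolding A_def n_def using avg_perms_pair[of I i1 i2 fL fU] I i sums by (simp add: power2_eq_square)
  then have EA: "perm_avg I A = p" unfolding p_def n_def[symmetric] using n by (simp add: field_simps)
  moreover have "(\<lambda>\<pi>. of_bool (\<pi> i1 \<in> L \<and> \<pi> i2 \<in> U)) = A" by (auto simp: A_def fL_def fU_def fun_eq_iff)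
  ultimately show "perm_avg I (\<lambda>\<pi>. of_bool (\<pi> i1 \<in> L \<and> \<pi> i2 \<in> U)) = p" by simp
  have c2: "real (card (I - {i1, i2})) = n - 2" using i I LU by (simp add: n_def card_Diff_subset)
  have c3: "real (card (I - {i1, i2, j1})) = n - 3" using i I LU by (simp add: n_def card_Diff_subset)
  have "(n - 2) * perm_avg I (\<lambda>\<pi>. A \<pi> * fL (\<pi> j1)) = perm_avg I (\<lambda>\<pi>. A \<pi> * (\<Sum>k\<in>I - {i1, i2}. fL (\<pi> k)))"
    unfolding c2[symmetric] by (rule exchangeable) (use I i in \<open>auto simp: Transposition.transpose_def A_def\<close>)
  also have "\<dots> = perm_avg I (\<lambda>\<pi>. (real l - 1) * A \<pi>)"
  proof (rule avg_cong)
    fix \<pi> assume "\<pi> \<in> perms I"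
    then have "(\<Sum>k\<in>I - {i1, i2}. fL (\<pi> k)) = real l - (fL (\<pi> i1) + fL (\<pi> i2))"
      using I i by (subst perms_sum_minus) (auto simp: sums)
    moreover have "A \<pi> * (real l - (fL (\<pi> i1) + fL (\<pi> i2))) = (real l - 1) * A \<pi>"
      using LU(3) by (auto simp: A_def fL_def fU_def of_bool_def)
    ultimately show "A \<pi> * (\<Sum>k\<in>I - {i1, i2}. fL (\<pi> k)) = (real l - 1) * A \<pi>" by simp
  qed
  also have "\<dots> = (real l - 1) * p" by (simp only: avg_cmult EA)
  finally have E3: "perm_avg I (\<lambda>\<pi>. A \<pi> * fL (\<pi> j1)) = (real l - 1) / (n - 2) * p"
    using n by (simp add: field_simps)
  define B where "B \<pi> = A \<pi> * fL (\<pi> j1)" for \<pi>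
  have "(n - 3) * perm_avg I (\<lambda>\<pi>. B \<pi> * fU (\<pi> j2)) = perm_avg I (\<lambda>\<pi>. B \<pi> * (\<Sum>k\<in>I - {i1, i2, j1}. fU (\<pi> k)))"
    unfolding c3[symmetric] by (rule exchangeable) (use I i in \<open>auto simp: Transposition.transpose_def A_def B_def\<close>)
  also have "\<dots> = perm_avg I (\<lambda>\<pi>. (real l - 1) * B \<pi>)"
  proof (rule avg_cong)
    fix \<pi> assume "\<pi> \<in> perms I"
    then have "(\<Sum>k\<in>I - {i1, i2, j1}. fU (\<pi> k)) = real l - (fU (\<pi> i1) + fU (\<pi> i2) + fU (\<pi> j1))"
      using I i by (subst perms_sum_minus) (auto simp: sums)
    moreover have "B \<pi> * (real l - (fU (\<pi> i1) + fU (\<pi> i2) + fU (\<pi> j1))) = (real l - 1) * B \<pi>"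
      using LU(3) by (auto simp: A_def B_def fL_def fU_def of_bool_def)
    ultimately show "B \<pi> * (\<Sum>k\<in>I - {i1, i2, j1}. fU (\<pi> k)) = (real l - 1) * B \<pi>" by simp
  qed
  also have "\<dots> = (real l - 1) * ((real l - 1) / (n - 2) * p)" unfolding avg_cmult B_def E3 ..
  finally have E4: "perm_avg I (\<lambda>\<pi>. B \<pi> * fU (\<pi> j2)) = ((real l - 1) / (n - 3)) * ((real l - 1) / (n - 2)) * p"
    using n by (simp only: nonzero_eq_divide_eq[of "n - 3", symmetric] mult.commute[of "n - 3"]) (simp add: mult_ac)
  have p0: "p \<ge> 0" unfolding p_def n_def[symmetric] using n by auto
  have "((real l - 1) / (n - 3)) * ((real l - 1) / (n - 2)) \<le> p"
  proof -
    from l0 have l: "real l \<ge> 1" by simp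
    have "(real l - 1) / (n - 3) \<le> real l / (n - 1)" "(real l - 1) / (n - 2) \<le> real l / n"
      using n l by (auto simp: field_simps)
    then have "((real l - 1) / (n - 3)) * ((real l - 1) / (n - 2)) \<le> (real l / (n - 1)) * (real l / n)"
      using n l by (intro mult_mono) auto
    then show ?thesis by (simp add: p_def n_def power2_eq_square mult.commute)
  qed
  then have "((real l - 1) / (n - 3)) * ((real l - 1) / (n - 2)) * p \<le> p^2"
    unfolding power2_eq_square using p0 by (rule mult_right_mono)
  moreover have "(\<lambda>\<pi>. of_bool (\<pi> i1 \<in> L \<and> \<pi> i2 \<in> U) * of_bool (\<pi> j1 \<in> L \<and> \<pi> j2 \<in> U)) = (\<lambda>\<pi>. B \<pi> * fU (\<pi> j2))"
    by (auto simp: A_def B_def fL_def fU_def fun_eq_iff)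
  ultimately show "perm_avg I (\<lambda>\<pi>. of_bool (\<pi> i1 \<in> L \<and> \<pi> i2 \<in> U) * of_bool (\<pi> j1 \<in> L \<and> \<pi> j2 \<in> U)) \<le> p\<^sup>2"
    using E4 by simp
qed

text \<open>Chebyshev's inequality: the number of good pairs has mean
  \<open>\<mu> \<ge> \<rho>^2 * card P\<close> and, by the correlation bound, variance at most
  \<open>\<mu>\<close>. The threshold is at most half of the mean.\<close>

lemma few_good_pairs:
  assumes I: "finite I" and LU: "L \<subseteq> I" "U \<subseteq> I" "L \<inter> U = {}" "card L = l" "card U = l" "2 * l + 1 \<le> card I" "card I \<ge> 4"
    and \<rho>: "real l \<ge> \<rho> * real (card I)" "\<rho> > 0"
    and P: "pair_supp m P \<subseteq> I" "P \<inter> (\<lambda>i. i + m) ` P = {}" "P \<noteq> {}"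
  shows "perm_avg I (\<lambda>\<pi>. of_bool (real (card {i\<in>P. \<pi> i \<in> L \<and> \<pi> (i + m) \<in> U}) < \<rho>^2 * real (card P) / 2))
    \<le> 4 / (\<rho>^2 * real (card P))"
proof -
  define n where "n = real (card I)"
  define p where "p = real l ^ 2 / (n * (n - 1))"
  define N where "N = real (card P)"
  define \<mu> where "\<mu> = N * p"
  define E where "E i \<pi> = (of_bool (\<pi> i \<in> L \<and> \<pi> (i + m) \<in> U) :: real)" for i and \<pi> :: "nat \<Rightarrow> nat"
  define G where "G \<pi> = (\<Sum>i\<in>P. E i \<pi>)" for \<pi>
  have finP: "finite P" using P I finite_subset by auto
  have N: "N > 0" unfolding N_def using finP P by (simp add: card_gt_0_iff)
  have n: "n \<ge> 4" unfolding n_def using LU by simp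
  have l: "real l > 0" using \<rho> n unfolding n_def[symmetric] by (metis less_le_trans mult_pos_pos zero_less_numeral)
  then have l0: "l > 0" by simp
  have p: "p \<ge> \<rho>^2"
  proof -
    have "\<rho>^2 * (n * (n - 1)) \<le> \<rho>^2 * n^2" using n by (intro mult_left_mono) (auto simp: power2_eq_square)
    also have "\<dots> = (\<rho> * n)^2" by (simp add: power_mult_distrib)
    also have "\<dots> \<le> real l ^ 2" using \<rho> n unfolding n_def[symmetric] by (intro power_mono) auto
    finally show ?thesis unfolding p_def using n by (subst pos_le_divide_eq) auto
  qed
  then have p0: "p > 0" using \<rho> by (smt (verit) zero_less_power2)
  have \<mu>: "\<mu> \<ge> \<rho>^2 * N" "\<mu> > 0" unfolding \<mu>_def using p N p0 by auto
  have m0: "m \<noteq> 0" using P by auto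
  have inI: "i \<in> I" "i + m \<in> I" if "i \<in> P" for i using that P by auto
  have EE: "E i \<pi> * E i \<pi> = E i \<pi>" for i \<pi> by (simp add: E_def)
  have nsh: "i \<noteq> j + m" "i + m \<noteq> j" if "i \<in> P" "j \<in> P" for i j using that P by auto
  have e1: "perm_avg I (E i) = p" if i: "i \<in> P" for i
  proof -
    \<comment> \<open>The formula for one pair is part of a lemma about four distinct positions, so
      two spare positions are picked.\<close>
    have "card (I - {i, i + m}) \<ge> 2" using LU(7) inI[OF i] m0 by (subst card_Diff_subset) auto
    then obtain j1 j2 where "j1 \<in> I - {i, i + m}" "j2 \<in> I - {i, i + m}" "j1 \<noteq> j2"
      by (metis card_le_Suc0_iff_eq I finite_Diff not_less_eq_eq numeral_2_eq_2)
    then show ?thesis unfolding E_def p_def n_def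
      using avg_perms_two_pairs(1)[OF I LU l0, of i "i + m" j1 j2] inI[OF i] m0 by auto
  qed
  have e2: "perm_avg I (\<lambda>\<pi>. E i \<pi> * E j \<pi>) \<le> p^2" if ij: "i \<in> P" "j \<in> P" "i \<noteq> j" for i j
    unfolding E_def p_def n_def
    by (rule avg_perms_two_pairs(2)[OF I LU l0]) (use inI ij m0 nsh[of i j] nsh[of j i] in auto)
  have EG: "perm_avg I G = \<mu>"
    unfolding G_def avg_sum using e1 by (simp add: \<mu>_def N_def)
  have "perm_avg I (\<lambda>\<pi>. (G \<pi>)^2) = (\<Sum>i\<in>P. \<Sum>j\<in>P. perm_avg I (\<lambda>\<pi>. E i \<pi> * E j \<pi>))"
    unfolding G_def power2_eq_square sum_product avg_sum ..
  also have "\<dots> \<le> (\<Sum>i\<in>P. \<Sum>j\<in>P. (if i = j then p else 0) + p^2)"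
    using e1 e2 p0 by (intro sum_mono) (auto simp: EE)
  also have "\<dots> = \<mu> + \<mu>^2"
    using finP by (simp add: sum.distrib \<mu>_def N_def power2_eq_square distrib_left mult_ac)
  finally have EG2: "perm_avg I (\<lambda>\<pi>. (G \<pi>)^2) \<le> \<mu> + \<mu>^2" .
  have Geq: "real (card {i\<in>P. \<pi> i \<in> L \<and> \<pi> (i + m) \<in> U}) = G \<pi>" for \<pi>
    unfolding G_def E_def using finP by (simp add: of_bool_def sum.If_cases Int_def)
  have "perm_avg I (\<lambda>\<pi>. of_bool (real (card {i\<in>P. \<pi> i \<in> L \<and> \<pi> (i + m) \<in> U}) < \<rho>^2 * real (card P) / 2))
     \<le> perm_avg I (\<lambda>\<pi>. 4 / \<mu>^2 * ((G \<pi>)^2 - (2 * \<mu> * G \<pi> - \<mu>^2)))"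
  proof (rule avg_mono)
    fix \<pi>
    have e: "(G \<pi>)^2 - (2 * \<mu> * G \<pi> - \<mu>^2) = (G \<pi> - \<mu>)^2" by (simp add: power2_eq_square algebra_simps)
    have "1 \<le> 4 / \<mu>^2 * (G \<pi> - \<mu>)^2" if "G \<pi> < \<rho>^2 * N / 2"
    proof -
      have "\<mu> / 2 \<le> \<mu> - G \<pi>" using that \<mu> by linarith
      then have "(\<mu> / 2)^2 \<le> (\<mu> - G \<pi>)^2" using \<mu> by (intro power_mono) auto
      then show ?thesis using \<mu> by (simp add: field_simps power2_commute)
    qed
    then show "of_bool (real (card {i\<in>P. \<pi> i \<in> L \<and> \<pi> (i + m) \<in> U}) < \<rho>^2 * real (card P) / 2)
       \<le> 4 / \<mu>^2 * ((G \<pi>)^2 - (2 * \<mu> * G \<pi> - \<mu>^2))"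
      unfolding Geq N_def[symmetric] e by (auto simp: of_bool_def)
  qed
  also have "\<dots> = 4 / \<mu>^2 * (perm_avg I (\<lambda>\<pi>. (G \<pi>)^2) - (2 * \<mu> * \<mu> - \<mu>^2))"
    unfolding avg_cmult avg_diff avg_perms_const[OF I] EG[symmetric] by simp
  also have "\<dots> \<le> 4 / \<mu>^2 * \<mu>"
    using EG2 \<mu> by (intro mult_left_mono) (auto simp: power2_eq_square)
  also have "\<dots> = 4 / \<mu>" using \<mu> by (simp add: power2_eq_square)
  also have "\<dots> \<le> 4 / (\<rho>^2 * N)" using \<mu> N \<rho> by (intro divide_left_mono) auto
  finally show ?thesis unfolding N_def .
qed

section \<open>Small-ball estimate for a permuted sum\<close>

text \<open>The interval of length \<open>2 * q * m\<close> is cut into blocks of length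
  \<open>m\<close>; the blocks with even number hold the left ends of the pairs and those with odd
  number their partners.\<close>

definition pair_block :: "nat \<Rightarrow> nat \<Rightarrow> nat \<Rightarrow> nat set" where
  "pair_block s m q = {i\<in>{s..<s + 2 * q * m}. even ((i - s) div m)}"

lemma pair_block_shift:
  assumes m: "m > 0"
  shows "(\<lambda>i. i + m) ` pair_block s m q = {i\<in>{s..<s + 2 * q * m}. odd ((i - s) div m)}"
proof (intro equalityI subsetI)
  fix i assume "i \<in> (\<lambda>i. i + m) ` pair_block s m q"
  then obtain j where j: "j \<in> pair_block s m q" and i: "i = j + m" by auto
  define t where "t = (j - s) div m"
  have js: "s \<le> j" "j - s < (2 * q) * m" and ev: "even t" using j by (auto simp: pair_block_def t_def)
  have "t < 2 * q" unfolding t_def using js(2) m by (simp add: less_mult_imp_div_less)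
  then have "t + 2 \<le> 2 * q" using ev by presburger
  moreover have "j - s < (t + 1) * m" unfolding t_def using m
    by (metis Suc_eq_plus1 dividend_less_div_times mult.commute mult_Suc)
  ultimately have "(j - s) + m < 2 * q * m"
    by (metis add_less_cancel_right less_le_trans mult_le_mono1 mult_Suc add.commute add_2_eq_Suc' Suc_eq_plus1)
  moreover have "i - s = (j - s) + m" using js by (simp add: i)
  then have "(i - s) div m = Suc t" using m by (simp add: t_def)
  ultimately show "i \<in> {i\<in>{s..<s + 2 * q * m}. odd ((i - s) div m)}" using js ev by (auto simp: i)
next
  fix i assume i: "i \<in> {i\<in>{s..<s + 2 * q * m}. odd ((i - s) div m)}"
  then have "(i - s) div m \<noteq> 0" by (metis even_zero mem_Collect_eq)
  then have ge: "i - s \<ge> m" using div_less[of "i - s" m] by (meson not_le)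
  then have "(i - s) div m = Suc ((i - m - s) div m)" using le_div_geq[OF m ge] by (simp add: add.commute)
  then have "i - m \<in> pair_block s m q" using i ge by (auto simp: pair_block_def)
  then show "i \<in> (\<lambda>i. i + m) ` pair_block s m q" using ge by (intro image_eqI[of _ _ "i - m"]) auto
qed

lemma pair_block:
  assumes m: "m > 0"
  shows "pair_supp m (pair_block s m q) = {s..<s + 2 * q * m}"
    and "pair_block s m q \<inter> (\<lambda>i. i + m) ` pair_block s m q = {}"
    and "card (pair_block s m q) = q * m"
proof -
  show 1: "pair_supp m (pair_block s m q) = {s..<s + 2 * q * m}"
    unfolding pair_block_shift[OF m] by (auto simp: pair_block_def)
  show 2: "pair_block s m q \<inter> (\<lambda>i. i + m) ` pair_block s m q = {}"
    unfolding pair_block_shift[OF m] by (auto simp: pair_block_def)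
  have fin: "finite (pair_block s m q)" by (simp add: pair_block_def)
  have "2 * (q * m) = card (pair_supp m (pair_block s m q))" unfolding 1 by simp
  also have "\<dots> = 2 * card (pair_block s m q)"
    using fin 2 by (subst card_Un_disjoint) (auto simp: card_image inj_on_def)
  finally show "card (pair_block s m q) = q * m" by simp
qed

text \<open>The form in which balance is used: centred entries of variance \<open>M\<close>, and two
  disjoint index sets of equal size, each a proportion of at least \<open>\<rho>\<close> of all
  entries, whose values are \<open>\<delta>\<close> standard deviations apart.\<close>

locale permuted_sample =
  fixes I :: "nat set" and x :: "nat \<Rightarrow> real" and L U :: "nat set" and l :: nat and M \<rho> \<delta> :: real
  assumes finI: "finite I" and x0: "sum x I = 0"
    and M: "M = (\<Sum>i\<in>I. (x i)^2) / real (card I)" "M > 0"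
    and LU: "L \<subseteq> I" "U \<subseteq> I" "L \<inter> U = {}" "card L = l" "card U = l" "2 * l + 1 \<le> card I" "card I \<ge> 4"
    and \<rho>: "real l \<ge> \<rho> * real (card I)" "\<rho> > 0"
    and gap: "\<And>p q. p \<in> L \<Longrightarrow> q \<in> U \<Longrightarrow> \<bar>x q - x p\<bar> \<ge> \<delta> * sqrt M" and \<delta>: "\<delta> > 0"
begin

text \<open>All blocks have length \<open>4 r\<^sup>2\<close>; \<open>X\<close> consists of pairs at distance \<open>2 r\<^sup>2\<close>, and \<open>Y\<close>, \<open>Z\<close> of pairs at
  distance \<open>2 r\<close>. The distances are even so that alternating coefficients have equal signs on a pair.\<close>
lemma one_system_bound:
  fixes c :: "nat \<Rightarrow> real" and T :: "(nat \<Rightarrow> nat) \<Rightarrow> real"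
  assumes r: "r > 0" and reg: "{s..<s + 12 * r^2} \<subseteq> I"
    and c: "\<And>i j. i \<in> {s..<s + 12 * r^2} \<Longrightarrow> j \<in> {s..<s + 12 * r^2} \<Longrightarrow> i < j \<Longrightarrow> even (j - i) \<Longrightarrow>
      \<gamma> * b * real (j - i) \<le> \<bar>c i - c j\<bar> \<and> \<bar>c i - c j\<bar> \<le> \<Gamma> * b * real (j - i)"
    and pos: "\<gamma> > 0" "b > 0" "\<Gamma> > 0"
    and T0: "\<And>\<pi>. T \<pi> \<ge> 0"
    and Tinv: "\<And>\<pi> \<sigma>. \<sigma> permutes {s..<s + 12 * r^2} \<Longrightarrow> T (\<pi> \<circ> \<sigma>) = T \<pi>"
  shows "perm_avg I (\<lambda>\<pi>. of_bool (\<bar>a + (\<Sum>i\<in>I. c i * x (\<pi> i))\<bar> \<le> T \<pi>)) \<le>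
    (12 + 32 * \<Gamma>^2 / (\<gamma>^2 * \<delta>^2) + 6 * perm_avg I (\<lambda>\<pi>. (T \<pi>)^2) / (\<gamma>^2 * \<delta>^2 * b^2 * real r^2 * M)) / (\<rho>^2 * real r^2)"
proof -
  define X where "X = pair_block s (2 * r^2) 1"
  define Y where "Y = pair_block (s + 4 * r^2) (2 * r) r"
  define Z where "Z = pair_block (s + 8 * r^2) (2 * r) r"
  have m: "2 * r^2 > 0" "2 * r > 0" using r by auto
  have sX: "pair_supp (2 * r^2) X = {s..<s + 4 * r^2}"
    unfolding X_def pair_block(1)[OF m(1)] by (simp add: power2_eq_square)
  have sY: "pair_supp (2 * r) Y = {s + 4 * r^2..<s + 8 * r^2}"
    unfolding Y_def pair_block(1)[OF m(2)] by (simp add: power2_eq_square add_ac)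
  have sZ: "pair_supp (2 * r) Z = {s + 8 * r^2..<s + 12 * r^2}"
    unfolding Z_def pair_block(1)[OF m(2)] by (simp add: power2_eq_square add_ac)
  have self: "X \<inter> (\<lambda>i. i + 2 * r^2) ` X = {}" "Y \<inter> (\<lambda>i. i + 2 * r) ` Y = {}" "Z \<inter> (\<lambda>i. i + 2 * r) ` Z = {}"
    unfolding X_def Y_def Z_def by (rule pair_block(2)[OF m(1)] pair_block(2)[OF m(2)])+
  have cards: "card X = 2 * r^2" "card Y = 2 * r^2" "card Z = 2 * r^2"
    unfolding X_def Y_def Z_def pair_block(3)[OF m(1)] pair_block(3)[OF m(2)] by (simp_all add: power2_eq_square)
  have ne: "X \<noteq> {}" "Y \<noteq> {}" "Z \<noteq> {}" using cards r by force+
  have memX: "i \<in> {s..<s + 12 * r^2} \<and> i + 2 * r^2 \<in> {s..<s + 12 * r^2}" if "i \<in> X" for i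
  proof -
    have "i \<in> pair_supp (2 * r^2) X" "i + 2 * r^2 \<in> pair_supp (2 * r^2) X" using that by auto
    then show ?thesis unfolding sX by auto
  qed
  have memY: "i \<in> {s..<s + 12 * r^2} \<and> i + 2 * r \<in> {s..<s + 12 * r^2}" if "i \<in> Y" for i
  proof -
    have "i \<in> pair_supp (2 * r) Y" "i + 2 * r \<in> pair_supp (2 * r) Y" using that by auto
    then show ?thesis unfolding sY by auto
  qed
  have memZ: "i \<in> {s..<s + 12 * r^2} \<and> i + 2 * r \<in> {s..<s + 12 * r^2}" if "i \<in> Z" for i
  proof -
    have "i \<in> pair_supp (2 * r) Z" "i + 2 * r \<in> pair_supp (2 * r) Z" using that by auto
    then show ?thesis unfolding sZ by auto
  qed
  define \<tau> where "\<tau> = \<delta> * sqrt M"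
  define \<kappa> where "\<kappa> = \<gamma> * b * real (2 * r)"
  define \<kappa>X where "\<kappa>X = \<gamma> * b * real (2 * r^2)"
  \<comment> \<open>Each group has \<open>2 * r^2\<close> pairs, so this is half of the lower bound
    for its expected number of good pairs.\<close>
  define g where "g = \<rho>^2 * real r^2"
  have \<tau>: "\<tau> > 0" unfolding \<tau>_def using \<delta> M by simp
  have \<kappa>: "\<kappa> > 0" unfolding \<kappa>_def using pos r by simp
  have g: "g > 0" unfolding g_def using \<rho> r by simp
  have \<kappa>le: "\<kappa> \<le> \<kappa>X" unfolding \<kappa>_def \<kappa>X_def using pos r
    by (intro mult_left_mono) (auto simp: power2_eq_square simp flip: of_nat_mult)
  have un: "pair_supp (2 * r^2) X \<union> pair_supp (2 * r) Y \<union> pair_supp (2 * r) Z = {s..<s + 12 * r^2}"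
    unfolding sX sY sZ by auto
  define bad where "bad m P \<pi> = (of_bool (real (card {i\<in>P. \<pi> i \<in> L \<and> \<pi> (i + m) \<in> U}) < g) :: real)" for m P and \<pi> :: "nat \<Rightarrow> nat"
  define q where "q m P \<pi> = (\<Sum>i\<in>P. ((c i - c (i + m)) * (x (\<pi> (i + m)) - x (\<pi> i)))^2)" for m P and \<pi> :: "nat \<Rightarrow> nat"
  have main: "perm_avg I (\<lambda>\<pi>. of_bool (\<bar>a + (\<Sum>i\<in>I. c i * x (\<pi> i))\<bar> \<le> T \<pi>)) \<le>
    perm_avg I (bad (2 * r^2) X) + perm_avg I (bad (2 * r) Y) + perm_avg I (bad (2 * r) Z) +
    (3 * perm_avg I (\<lambda>\<pi>. (2 * T \<pi> / (\<kappa> * \<tau>) + 1)^2)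
      + 2 * (perm_avg I (q (2 * r) Y) + perm_avg I (q (2 * r) Z)) / (\<kappa>X * \<tau>)^2) / g"
    unfolding bad_def q_def
  proof (rule perm_small_ball[OF finI _ _ _ self])
    show "\<kappa>X \<le> \<bar>c i - c (i + 2 * r^2)\<bar>" if "i \<in> X" for i
      using c[of i "i + 2 * r^2"] memX[OF that] m by (simp add: \<kappa>X_def)
    show "\<kappa> \<le> \<bar>c i - c (i + 2 * r)\<bar>" if "i \<in> Y" for i
      using c[of i "i + 2 * r"] memY[OF that] m by (simp add: \<kappa>_def)
    show "\<kappa> \<le> \<bar>c i - c (i + 2 * r)\<bar>" if "i \<in> Z" for i
      using c[of i "i + 2 * r"] memZ[OF that] m by (simp add: \<kappa>_def)
    show "T (\<pi> \<circ> \<sigma>) = T \<pi>" if "\<sigma> permutes pair_supp (2 * r^2) X \<union> pair_supp (2 * r) Y \<union> pair_supp (2 * r) Z" for \<sigma> \<pi>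
      using that unfolding un by (rule Tinv)
    show "pair_supp (2 * r^2) X \<subseteq> I" "pair_supp (2 * r) Y \<subseteq> I" "pair_supp (2 * r) Z \<subseteq> I"
      using reg un by blast+
    show "pair_supp (2 * r^2) X \<inter> pair_supp (2 * r) Y = {}" "pair_supp (2 * r^2) X \<inter> pair_supp (2 * r) Z = {}"
      "pair_supp (2 * r) Y \<inter> pair_supp (2 * r) Z = {}"
      unfolding sX sY sZ by auto
  qed (use \<kappa> \<kappa>le gap \<tau> T0 g in \<open>auto simp: \<tau>_def\<close>)
  have bad: "perm_avg I (bad m P) \<le> 2 / g" if P: "pair_supp m P \<subseteq> I" "P \<inter> (\<lambda>i. i + m) ` P = {}" "P \<noteq> {}" "card P = 2 * r^2" for m P
  proof -
    have "\<rho>^2 * real (card P) / 2 = g" using P by (simp add: g_def)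
    then have "perm_avg I (bad m P) \<le> 4 / (\<rho>^2 * real (card P))"
      using few_good_pairs[OF finI LU \<rho> P(1-3)] unfolding bad_def by simp
    also have "\<dots> = 2 / g" using P by (simp add: g_def)
    finally show ?thesis .
  qed
  have bads: "perm_avg I (bad (2 * r^2) X) \<le> 2 / g" "perm_avg I (bad (2 * r) Y) \<le> 2 / g" "perm_avg I (bad (2 * r) Z) \<le> 2 / g"
    using un reg self ne cards by (intro bad; blast)+
  have qb: "perm_avg I (q (2 * r) P) \<le> 32 * M * \<Gamma>^2 * b^2 * real r^4"
    if P: "card P = 2 * r^2" "\<And>i. i \<in> P \<Longrightarrow> i \<in> {s..<s + 12 * r^2} \<and> i + 2 * r \<in> {s..<s + 12 * r^2}" for P
  proof -
    have "perm_avg I (q (2 * r) P) = (\<Sum>i\<in>P. perm_avg I (\<lambda>\<pi>. ((c i - c (i + 2 * r)) * (x (\<pi> (i + 2 * r)) - x (\<pi> i)))^2))"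
      unfolding q_def by (rule avg_sum)
    also have "\<dots> \<le> (\<Sum>i\<in>P. 4 * M * (\<Gamma> * b * real (2 * r))^2)"
    proof (rule sum_mono)
      fix i assume i: "i \<in> P"
      have "perm_avg I (\<lambda>\<pi>. ((c i - c (i + 2 * r)) * (x (\<pi> (i + 2 * r)) - x (\<pi> i)))^2) \<le> 4 * M * (c i - c (i + 2 * r))^2"
        unfolding M(1) by (rule avg_perms_diff_square[OF finI]) (use P(2)[OF i] reg in auto)
      also have "(c i - c (i + 2 * r))^2 \<le> (\<Gamma> * b * real (2 * r))^2"
        using c[of i "i + 2 * r"] P(2)[OF i] m by (intro abs_le_square_iff[THEN iffD1]) (use pos in auto)
      finally show "perm_avg I (\<lambda>\<pi>. ((c i - c (i + 2 * r)) * (x (\<pi> (i + 2 * r)) - x (\<pi> i)))^2) \<le> 4 * M * (\<Gamma> * b * real (2 * r))^2"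
        using M(2) by (simp add: mult_left_mono)
    qed
    also have "\<dots> = 32 * M * \<Gamma>^2 * b^2 * real r^4"
      by (simp add: P power2_eq_square power4_eq_xxxx)
    finally show ?thesis .
  qed
  \<comment> \<open>The two scales match: \<open>2 * r^2\<close> fine swaps of size about
    \<open>r\<close> have total square of order \<open>r^4\<close>, the square of one coarse swap of
    size \<open>2 * r^2\<close>. Hence the quotient is free of \<open>r\<close>.\<close>
  have qs: "2 * (perm_avg I (q (2 * r) Y) + perm_avg I (q (2 * r) Z)) / (\<kappa>X * \<tau>)^2 \<le> 32 * \<Gamma>^2 / (\<gamma>^2 * \<delta>^2)"
  proof -
    have sq: "(\<kappa>X * \<tau>)^2 = 4 * \<gamma>^2 * b^2 * real r^4 * \<delta>^2 * M"
      using M(2) by (simp add: \<kappa>X_def \<tau>_def power_mult_distrib)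
    have "2 * (perm_avg I (q (2 * r) Y) + perm_avg I (q (2 * r) Z)) / (\<kappa>X * \<tau>)^2
      \<le> 2 * (32 * M * \<Gamma>^2 * b^2 * real r^4 + 32 * M * \<Gamma>^2 * b^2 * real r^4) / (\<kappa>X * \<tau>)^2"
      using qb[of Y] qb[of Z] cards memY memZ by (intro divide_right_mono mult_left_mono add_mono) auto
    also have "\<dots> = 32 * \<Gamma>^2 / (\<gamma>^2 * \<delta>^2)"
      unfolding sq using M(2) pos r \<delta> by (simp add: field_simps)
    finally show ?thesis .
  qed
  have Tb: "perm_avg I (\<lambda>\<pi>. (2 * T \<pi> / (\<kappa> * \<tau>) + 1)^2) \<le> 2 * perm_avg I (\<lambda>\<pi>. (T \<pi>)^2) / (\<gamma>^2 * \<delta>^2 * b^2 * real r^2 * M) + 2"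
  proof -
    have "perm_avg I (\<lambda>\<pi>. (2 * T \<pi> / (\<kappa> * \<tau>) + 1)^2) \<le> perm_avg I (\<lambda>\<pi>. (8 / (\<kappa> * \<tau>)^2) * (T \<pi>)^2 + 2)"
    proof (rule avg_mono)
      fix \<pi>
      have "(y + 1)^2 \<le> 2 * y^2 + 2" for y :: real
        using zero_le_power2[of "y - 1"] by (simp add: power2_eq_square algebra_simps)
      from this[of "2 * T \<pi> / (\<kappa> * \<tau>)"]
      show "(2 * T \<pi> / (\<kappa> * \<tau>) + 1)^2 \<le> (8 / (\<kappa> * \<tau>)^2) * (T \<pi>)^2 + 2"
        by (simp add: power_divide power_mult_distrib)
    qed
    also have "\<dots> = (8 / (\<kappa> * \<tau>)^2) * perm_avg I (\<lambda>\<pi>. (T \<pi>)^2) + 2"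
      unfolding avg_add avg_cmult avg_perms_const[OF finI] ..
    also have "(\<kappa> * \<tau>)^2 = 4 * (\<gamma>^2 * \<delta>^2 * b^2 * real r^2 * M)"
      using M(2) by (simp add: \<kappa>_def \<tau>_def power_mult_distrib)
    finally show ?thesis by (simp add: mult_ac)
  qed
  have "perm_avg I (\<lambda>\<pi>. of_bool (\<bar>a + (\<Sum>i\<in>I. c i * x (\<pi> i))\<bar> \<le> T \<pi>)) \<le>
    2 / g + 2 / g + 2 / g + (3 * (2 * perm_avg I (\<lambda>\<pi>. (T \<pi>)^2) / (\<gamma>^2 * \<delta>^2 * b^2 * real r^2 * M) + 2) + 32 * \<Gamma>^2 / (\<gamma>^2 * \<delta>^2)) / g"
    by (rule order_trans[OF main]) (intro add_mono bads divide_right_mono mult_left_mono Tb qs; use g in simp)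
  also have "\<dots> = (12 + 32 * \<Gamma>^2 / (\<gamma>^2 * \<delta>^2) + 6 * perm_avg I (\<lambda>\<pi>. (T \<pi>)^2) / (\<gamma>^2 * \<delta>^2 * b^2 * real r^2 * M)) / g"
    by (simp add: add_divide_distrib distrib_left)
  finally show ?thesis unfolding g_def .
qed

text \<open>The threshold \<open>\<bar>\<Sum> e i * (w + x (\<pi> i))\<bar>\<close> is random as well. It is split into the contributions
  of the first half of the region and of its complement, and each part is compared with the sum after
  resampling only positions that do not enter it. If \<open>w * sum e I\<close> dominates the threshold, the
  assumption on \<open>sum c I\<close> forces the centred sum to be large, which is again a random threshold of this kind.\<close>
lemma crossing_bound:
  fixes c e :: "nat \<Rightarrow> real"
  assumes r: "r > 0" and reg: "{s..<s + 24 * r^2} \<subseteq> I"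
    and c: "\<And>i j. i \<in> {s..<s + 24 * r^2} \<Longrightarrow> j \<in> {s..<s + 24 * r^2} \<Longrightarrow> i < j \<Longrightarrow> even (j - i) \<Longrightarrow>
      \<gamma> * b * real (j - i) \<le> \<bar>c i - c j\<bar> \<and> \<bar>c i - c j\<bar> \<le> \<Gamma> * b * real (j - i)"
    and pos: "\<gamma> > 0" "b > 0" "\<Gamma> > 0" "\<eta> > 0"
    and e2: "(\<Sum>i\<in>I. (e i)^2) \<le> \<Lambda> * b^2 * real r^2"
    and c2: "(\<Sum>i\<in>I. (c i)^2) \<le> \<Lambda> * b^2 * real r^6"
    and mean: "\<bar>sum c I\<bar> \<ge> \<eta> * real r^2 * \<bar>sum e I\<bar>" "\<eta> * real r^2 \<ge> 4"
  shows "perm_avg I (\<lambda>\<pi>. of_bool (\<bar>\<Sum>i\<in>I. c i * (w + x (\<pi> i))\<bar> \<le> \<bar>\<Sum>i\<in>I. e i * (w + x (\<pi> i))\<bar>)) \<le>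
    2 * (12 + 32 * \<Gamma>^2 / (\<gamma>^2 * \<delta>^2) + 6 * \<Lambda> * (64 + 256 / \<eta>^2) / (\<gamma>^2 * \<delta>^2)) / \<rho>^2 / real r^2"
proof -
  define R1 R2 where "R1 = {s..<s + 12 * r^2}" and "R2 = {s + 12 * r^2..<s + 12 * r^2 + 12 * r^2}"
  have R: "R1 \<subseteq> {s..<s + 24 * r^2}" "R2 \<subseteq> {s..<s + 24 * r^2}" "R1 \<inter> R2 = {}" unfolding R1_def R2_def by auto
  define D where "D k A \<pi> = (\<Sum>i\<in>A. k i * x (\<pi> i))" for k :: "nat \<Rightarrow> real" and A and \<pi> :: "nat \<Rightarrow> nat"
  \<comment> \<open>The coefficients are twice those in the bound \<open>2 * \<bar>D e I \<pi>\<bar>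
    + 4 / (\<eta> * real r^2) * \<bar>D c I \<pi>\<bar>\<close> derived below. That bound is then at
    most the mean of \<open>T R1\<close> and \<open>T (I - R1)\<close>, hence at most the larger
    one.\<close>
  define T where "T A \<pi> = 4 * \<bar>D e A \<pi>\<bar> + 8 / (\<eta> * real r^2) * \<bar>D c A \<pi>\<bar>" for A and \<pi> :: "nat \<Rightarrow> nat"
  define a where "a = w * sum c I"
  define C where "C = 12 + 32 * \<Gamma>^2 / (\<gamma>^2 * \<delta>^2) + 6 * \<Lambda> * (64 + 256 / \<eta>^2) / (\<gamma>^2 * \<delta>^2)"
  have \<eta>r: "\<eta> * real r^2 > 0" using mean by linarith
  have T0: "T A \<pi> \<ge> 0" for A \<pi> unfolding T_def using \<eta>r by auto
  have I2: "card I \<ge> 2" using LU by simp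
  have ET: "perm_avg I (\<lambda>\<pi>. (T A \<pi>)^2) \<le> (\<gamma>^2 * \<delta>^2 * b^2 * real r^2 * M) * (\<Lambda> * (64 + 256 / \<eta>^2) / (\<gamma>^2 * \<delta>^2))" if A: "A \<subseteq> I" for A
  proof -
    have "perm_avg I (\<lambda>\<pi>. (T A \<pi>)^2) \<le> perm_avg I (\<lambda>\<pi>. 32 * (D e A \<pi>)^2 + 128 / (\<eta> * real r^2)^2 * (D c A \<pi>)^2)"
    proof (rule avg_mono)
      fix \<pi>
      have "(y + z)^2 \<le> 2 * y^2 + 2 * z^2" for y z :: real
        using zero_le_power2[of "y - z"] by (simp add: power2_eq_square algebra_simps)
      from this[of "4 * \<bar>D e A \<pi>\<bar>" "8 / (\<eta> * real r^2) * \<bar>D c A \<pi>\<bar>"]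
      show "(T A \<pi>)^2 \<le> 32 * (D e A \<pi>)^2 + 128 / (\<eta> * real r^2)^2 * (D c A \<pi>)^2"
        unfolding T_def by (simp add: power_mult_distrib power_divide)
    qed
    also have "\<dots> = 32 * perm_avg I (\<lambda>\<pi>. (D e A \<pi>)^2) + 128 / (\<eta> * real r^2)^2 * perm_avg I (\<lambda>\<pi>. (D c A \<pi>)^2)"
      by (simp only: avg_add avg_cmult)
    also have "\<dots> \<le> 32 * (2 * M * (\<Lambda> * b^2 * real r^2)) + 128 / (\<eta> * real r^2)^2 * (2 * M * (\<Lambda> * b^2 * real r^6))"
    proof (intro add_mono mult_left_mono)
      have sq: "(\<Sum>i\<in>A. (k i)^2) \<le> (\<Sum>i\<in>I. (k i)^2)" for k :: "nat \<Rightarrow> real"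
        using A finI by (intro sum_mono2) auto
      have "perm_avg I (\<lambda>\<pi>. (D k A \<pi>)^2) \<le> 2 * M * (\<Sum>i\<in>A. (k i)^2)" for k
        unfolding D_def M(1) by (rule avg_perms_linear_square[OF finI A I2 x0])
      moreover have "2 * M * (\<Sum>i\<in>A. (k i)^2) \<le> 2 * M * B" if "(\<Sum>i\<in>I. (k i)^2) \<le> B" for k B
        using sq[of k] that M(2) by (intro mult_left_mono) auto
      ultimately show "perm_avg I (\<lambda>\<pi>. (D e A \<pi>)^2) \<le> 2 * M * (\<Lambda> * b^2 * real r^2)"
        "perm_avg I (\<lambda>\<pi>. (D c A \<pi>)^2) \<le> 2 * M * (\<Lambda> * b^2 * real r^6)"
        using e2 c2 order_trans by blast+
    qed auto
    also have "\<dots> = (\<gamma>^2 * \<delta>^2 * b^2 * real r^2 * M) * (\<Lambda> * (64 + 256 / \<eta>^2) / (\<gamma>^2 * \<delta>^2))"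
    proof -
      have "real r^6 = real r^2 * real r^2 * real r^2" by (simp add: eval_nat_numeral)
      then show ?thesis using pos \<delta> r by (simp add: field_simps power2_eq_square)
    qed
    finally show ?thesis .
  qed
  have sys: "perm_avg I (\<lambda>\<pi>. of_bool (\<bar>a + (\<Sum>i\<in>I. c i * x (\<pi> i))\<bar> \<le> T A \<pi>)) \<le> C / (\<rho>^2 * real r^2)"
    if A: "A \<subseteq> I" "A \<inter> {t..<t + 12 * r^2} = {}" and t: "{t..<t + 12 * r^2} \<subseteq> {s..<s + 24 * r^2}" for A t
  proof -
    have "perm_avg I (\<lambda>\<pi>. of_bool (\<bar>a + (\<Sum>i\<in>I. c i * x (\<pi> i))\<bar> \<le> T A \<pi>)) \<le>
     (12 + 32 * \<Gamma>^2 / (\<gamma>^2 * \<delta>^2) + 6 * perm_avg I (\<lambda>\<pi>. (T A \<pi>)^2) / (\<gamma>^2 * \<delta>^2 * b^2 * real r^2 * M)) / (\<rho>^2 * real r^2)"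
    proof (rule one_system_bound[OF r _ _ pos(1-3)])
      show "{t..<t + 12 * r^2} \<subseteq> I" using t reg by blast
      show "\<gamma> * b * real (j - i) \<le> \<bar>c i - c j\<bar> \<and> \<bar>c i - c j\<bar> \<le> \<Gamma> * b * real (j - i)"
        if "i \<in> {t..<t + 12 * r^2}" "j \<in> {t..<t + 12 * r^2}" "i < j" "even (j - i)" for i j
        using c[of i j] that t by blast
      fix \<pi> \<sigma> :: "nat \<Rightarrow> nat" assume "\<sigma> permutes {t..<t + 12 * r^2}"
      then have "\<sigma> i = i" if "i \<in> A" for i using that A(2) permutes_not_in by fastforce
      then have "D k A (\<pi> \<circ> \<sigma>) = D k A \<pi>" for k unfolding D_def by (intro sum.cong) auto
      then show "T A (\<pi> \<circ> \<sigma>) = T A \<pi>" unfolding T_def by simp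
    qed (rule T0)
    also have "\<dots> \<le> C / (\<rho>^2 * real r^2)"
    proof -
      have "\<gamma>^2 * \<delta>^2 * b^2 * real r^2 * M > 0" using pos \<delta> r M(2) by simp
      then have "perm_avg I (\<lambda>\<pi>. (T A \<pi>)^2) / (\<gamma>^2 * \<delta>^2 * b^2 * real r^2 * M) \<le> \<Lambda> * (64 + 256 / \<eta>^2) / (\<gamma>^2 * \<delta>^2)"
        using ET[OF A(1)] by (subst pos_divide_le_eq) (auto simp: mult.commute)
      then show ?thesis unfolding C_def by (intro divide_right_mono) auto
    qed
    finally show ?thesis .
  qed
  have split: "D k I \<pi> = D k R1 \<pi> + D k (I - R1) \<pi>" for k \<pi>
  proof -
    have "I = R1 \<union> (I - R1)" using reg R by blast
    then show ?thesis unfolding D_def using finI by (metis Diff_disjoint finite_Un sum.union_disjoint)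
  qed
  have "perm_avg I (\<lambda>\<pi>. of_bool (\<bar>\<Sum>i\<in>I. c i * (w + x (\<pi> i))\<bar> \<le> \<bar>\<Sum>i\<in>I. e i * (w + x (\<pi> i))\<bar>))
    \<le> perm_avg I (\<lambda>\<pi>. of_bool (\<bar>a + (\<Sum>i\<in>I. c i * x (\<pi> i))\<bar> \<le> T R1 \<pi>) + of_bool (\<bar>a + (\<Sum>i\<in>I. c i * x (\<pi> i))\<bar> \<le> T (I - R1) \<pi>))"
  proof (rule avg_mono)
    fix \<pi>
    have eq: "(\<Sum>i\<in>I. k i * (w + x (\<pi> i))) = w * sum k I + D k I \<pi>" for k
      unfolding D_def by (simp add: distrib_left sum.distrib sum_distrib_left mult.commute)
    have "\<bar>a + D c I \<pi>\<bar> \<le> T R1 \<pi> \<or> \<bar>a + D c I \<pi>\<bar> \<le> T (I - R1) \<pi>"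
      if ev: "\<bar>w * sum c I + D c I \<pi>\<bar> \<le> \<bar>w * sum e I + D e I \<pi>\<bar>"
    proof -
      have "\<bar>a + D c I \<pi>\<bar> \<le> 2 * \<bar>D e I \<pi>\<bar> + 4 / (\<eta> * real r^2) * \<bar>D c I \<pi>\<bar>"
      proof (cases "\<bar>w * sum e I\<bar> \<le> \<bar>D e I \<pi>\<bar>")
        case True
        moreover have "4 / (\<eta> * real r^2) * \<bar>D c I \<pi>\<bar> \<ge> 0" using \<eta>r by auto
        ultimately show ?thesis using ev unfolding a_def by linarith
      next
        case False
        define B where "B = \<bar>w * sum e I\<bar>"
        have 1: "\<bar>a + D c I \<pi>\<bar> \<le> 2 * B" using False ev unfolding a_def B_def by linarith
        have "\<bar>w\<bar> * (\<eta> * real r^2 * \<bar>sum e I\<bar>) \<le> \<bar>w\<bar> * \<bar>sum c I\<bar>" by (intro mult_left_mono mean) auto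
        then have "\<eta> * real r^2 * B \<le> \<bar>a\<bar>" by (simp add: a_def B_def abs_mult algebra_simps)
        \<comment> \<open>This is where \<open>\<eta> * real r^2 \<ge> 4\<close> enters:
          \<open>2 * B\<close> is at most half of \<open>\<eta> * real r^2 * B\<close> and can be
          absorbed, which leaves a bound for \<open>B\<close> in terms of the centred sum
          alone.\<close>
        moreover have "4 * B \<le> \<eta> * real r^2 * B" by (intro mult_right_mono mean) (auto simp: B_def)
        ultimately have "\<eta> * real r^2 * B \<le> 2 * \<bar>D c I \<pi>\<bar>" using 1 by linarith
        then have "2 * B \<le> 4 / (\<eta> * real r^2) * \<bar>D c I \<pi>\<bar>" using \<eta>r by (simp add: field_simps)
        then show ?thesis using 1 by linarith
      qed
      also have "\<dots> \<le> 2 * (\<bar>D e R1 \<pi>\<bar> + \<bar>D e (I - R1) \<pi>\<bar>) + 4 / (\<eta> * real r^2) * (\<bar>D c R1 \<pi>\<bar> + \<bar>D c (I - R1) \<pi>\<bar>)"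
        using \<eta>r unfolding split[of e] split[of c] by (intro add_mono mult_left_mono abs_triangle_ineq) auto
      also have "\<dots> = (T R1 \<pi> + T (I - R1) \<pi>) / 2"
      proof -
        have "8 / (\<eta> * real r^2) = 2 * (4 / (\<eta> * real r^2))" by simp
        then show ?thesis unfolding T_def by (simp only:) (simp add: algebra_simps add_divide_distrib)
      qed
      finally have "\<bar>a + D c I \<pi>\<bar> \<le> (T R1 \<pi> + T (I - R1) \<pi>) / 2" .
      then show ?thesis by (cases "T R1 \<pi> \<le> T (I - R1) \<pi>") auto
    qed
    then show "of_bool (\<bar>\<Sum>i\<in>I. c i * (w + x (\<pi> i))\<bar> \<le> \<bar>\<Sum>i\<in>I. e i * (w + x (\<pi> i))\<bar>)
      \<le> (of_bool (\<bar>a + (\<Sum>i\<in>I. c i * x (\<pi> i))\<bar> \<le> T R1 \<pi>) + of_bool (\<bar>a + (\<Sum>i\<in>I. c i * x (\<pi> i))\<bar> \<le> T (I - R1) \<pi>) :: real)"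
      unfolding eq D_def[symmetric] by (auto simp: of_bool_def)
  qed
  also have "\<dots> = perm_avg I (\<lambda>\<pi>. of_bool (\<bar>a + (\<Sum>i\<in>I. c i * x (\<pi> i))\<bar> \<le> T R1 \<pi>)) + perm_avg I (\<lambda>\<pi>. of_bool (\<bar>a + (\<Sum>i\<in>I. c i * x (\<pi> i))\<bar> \<le> T (I - R1) \<pi>))"
    by (rule avg_add)
  also have "\<dots> \<le> C / (\<rho>^2 * real r^2) + C / (\<rho>^2 * real r^2)"
    by (intro add_mono sys[of R1 "s + 12 * r^2"] sys[of "I - R1" s]) (use R reg in \<open>auto simp: R1_def R2_def\<close>)
  also have "\<dots> = 2 * C / \<rho>^2 / real r^2" by simp
  finally show ?thesis unfolding C_def .
qed

end

section \<open>Balanced vectors and smoothing weights\<close>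

text \<open>A second-moment argument of Paley--Zygmund type: entries below
  \<open>\<delta> * \<sigma>\<close> account for at most half of the positive mass, and the variance
  prevents the rest from sitting on few entries.\<close>

lemma one_sided_large_values:
  fixes y :: "'a \<Rightarrow> real"
  assumes I: "finite I" "card I > 0" and \<sigma>: "\<sigma> > 0" and \<delta>: "\<delta> > 0"
    and m2: "(\<Sum>i\<in>I. (y i)^2) = real (card I) * \<sigma>^2"
    and pos: "(\<Sum>i\<in>I. max (y i) 0) \<ge> real (card I) * (2 * \<delta> * \<sigma>)"
  shows "real (card I) * \<delta>^2 \<le> real (card {i\<in>I. y i \<ge> \<delta> * \<sigma>})"
proof -
  define n where "n = real (card I)"
  \<comment> \<open>Chosen so that the terms \<open>(y i)^2 / (4 * A)\<close> add up to
    \<open>n * \<delta> * \<sigma> / 2\<close>, half of the surplus over the threshold.\<close>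
  define A where "A = \<sigma> / (2 * \<delta>)"
  define N where "N = real (card {i\<in>I. y i \<ge> \<delta> * \<sigma>})"
  have A: "A > 0" using \<sigma> \<delta> by (simp add: A_def)
  have pt: "max (y i) 0 \<le> \<delta> * \<sigma> + A * of_bool (y i \<ge> \<delta> * \<sigma>) + (y i)^2 / (4 * A)" for i
  proof (cases "y i \<ge> \<delta> * \<sigma>")
    case True
    have "y i \<le> A + (y i)^2 / (4 * A)"
      using A zero_le_power2[of "y i - 2 * A"] by (simp add: field_simps power2_eq_square)
    moreover have "0 < \<delta> * \<sigma>" using \<sigma> \<delta> by simp
    ultimately show ?thesis using True by simp
  next
    case False
    moreover have "(y i)^2 / (4 * A) \<ge> 0" using A by simp
    moreover have "0 < \<delta> * \<sigma>" using \<sigma> \<delta> by simp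
    ultimately show ?thesis by simp
  qed
  have "n * (2 * \<delta> * \<sigma>) \<le> (\<Sum>i\<in>I. max (y i) 0)" using pos by (simp add: n_def)
  also have "\<dots> \<le> (\<Sum>i\<in>I. \<delta> * \<sigma> + A * of_bool (y i \<ge> \<delta> * \<sigma>) + (y i)^2 / (4 * A))"
    by (intro sum_mono pt)
  also have "\<dots> = n * (\<delta> * \<sigma>) + A * N + n * \<sigma>^2 / (4 * A)"
    using I by (simp add: sum.distrib n_def N_def m2[symmetric] sum_divide_distrib[symmetric]
        sum_distrib_left[symmetric] of_bool_def sum.If_cases Int_def)
  also have "n * \<sigma>^2 / (4 * A) = n * (\<delta> * \<sigma>) / 2"
    using \<sigma> \<delta> by (simp add: A_def field_simps power2_eq_square)
  finally have "n * (2 * \<delta> * \<sigma>) \<le> n * (\<delta> * \<sigma>) + A * N + n * (\<delta> * \<sigma>) / 2" .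
  moreover have "n * (2 * \<delta> * \<sigma>) = 2 * (n * (\<delta> * \<sigma>))" by simp
  ultimately have "n * (\<delta> * \<sigma>) / 2 \<le> A * N" by linarith
  then have "n * \<delta>^2 \<le> N" using \<sigma> \<delta> by (simp add: A_def field_simps power2_eq_square)
  then show ?thesis by (simp add: n_def N_def)
qed

text \<open>A bounded fourth moment keeps the variance from being carried by a few huge entries:
  those above \<open>a\<close> in absolute value are paid for by the fourth moment, the others by
  \<open>a * \<bar>x i\<bar>\<close>.\<close>

lemma balanced_absolute_moment:
  fixes x :: "'a \<Rightarrow> real"
  assumes I: "finite I" "card I > 0" and K: "K > 0" and \<sigma>: "\<sigma> > 0"
    and m2: "(\<Sum>i\<in>I. (x i)^2) = real (card I) * \<sigma>^2"
    and m4: "(\<Sum>i\<in>I. (x i)^4) \<le> real (card I) * (K * \<sigma>^4)"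
  shows "(\<Sum>i\<in>I. \<bar>x i\<bar>) \<ge> real (card I) * (\<sigma> / (2 * sqrt (2 * K)))"
proof -
  define n where "n = real (card I)"
  \<comment> \<open>With this cutoff the fourth-moment part is at most half of the total
    variance.\<close>
  define a where "a = sqrt (2 * K) * \<sigma>"
  have a: "a > 0" using K \<sigma> by (simp add: a_def)
  have a2: "a^2 = 2 * K * \<sigma>^2" using K by (simp add: a_def power_mult_distrib)
  have pt: "(x i)^2 \<le> a * \<bar>x i\<bar> + (x i)^4 / a^2" for i
  proof (cases "\<bar>x i\<bar> \<le> a")
    case True
    then have "\<bar>x i\<bar> * \<bar>x i\<bar> \<le> a * \<bar>x i\<bar>" by (intro mult_right_mono) auto
    moreover have "(x i)^4 / a^2 \<ge> 0" by simp
    moreover have "(x i)^2 = \<bar>x i\<bar> * \<bar>x i\<bar>" by (simp add: power2_eq_square)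
    ultimately show ?thesis by linarith
  next
    case False
    then have "a^2 \<le> (x i)^2" using a by (intro abs_le_square_iff[THEN iffD1]) auto
    then have "(x i)^2 * a^2 \<le> (x i)^2 * (x i)^2" by (intro mult_left_mono) auto
    then have "(x i)^2 \<le> (x i)^4 / a^2" using a by (simp add: field_simps power4_eq_xxxx power2_eq_square)
    then show ?thesis using a by (simp add: add_increasing)
  qed
  have "n * \<sigma>^2 = (\<Sum>i\<in>I. (x i)^2)" by (simp add: m2 n_def)
  also have "\<dots> \<le> (\<Sum>i\<in>I. a * \<bar>x i\<bar> + (x i)^4 / a^2)" by (intro sum_mono pt)
  also have "\<dots> = a * (\<Sum>i\<in>I. \<bar>x i\<bar>) + (\<Sum>i\<in>I. (x i)^4) / a^2"
    by (simp add: sum.distrib sum_distrib_left sum_divide_distrib)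
  also have "(\<Sum>i\<in>I. (x i)^4) / a^2 \<le> n * (K * \<sigma>^4) / a^2"
    using m4 by (intro divide_right_mono) (auto simp: n_def)
  also have "\<dots> = n * \<sigma>^2 / 2" unfolding a2 using K \<sigma> by (simp add: field_simps power4_eq_xxxx power2_eq_square)
  finally have "n * \<sigma>^2 / 2 \<le> a * (\<Sum>i\<in>I. \<bar>x i\<bar>)" by simp
  then have "n * (\<sigma>^2 / (2 * a)) \<le> (\<Sum>i\<in>I. \<bar>x i\<bar>)" using a by (simp add: field_simps)
  moreover have "\<sigma>^2 / (2 * a) = \<sigma> / (2 * sqrt (2 * K))" using \<sigma> by (simp add: a_def power2_eq_square)
  ultimately show ?thesis by (simp add: n_def)
qed

text \<open>As the entries are centred, positive and negative parts have equal mass, so a large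
  first absolute moment yields many large entries on both sides. The value of
  \<open>\<delta>\<close> makes that moment at least \<open>4 * \<delta> * \<sigma>\<close> per
  entry. The sets are cut to the common size \<open>l\<close>, the integer part of
  \<open>n * \<delta>^2\<close>; for \<open>n \<ge> 2 / \<delta>^2\<close> rounding costs at most
  half, whence the proportion \<open>\<delta>^2 / 2\<close>.\<close>

lemma balanced_sample:
  fixes K :: real
  assumes K: "K > 1"
  shows "\<exists>\<rho> \<delta> n1. \<rho> > 0 \<and> \<delta> > 0 \<and> (\<forall>n\<ge>n1. \<forall>w. \<not> constant_vec n w \<longrightarrow> balanced K n w \<longrightarrow>
    (\<exists>L U l M. permuted_sample {1..n} (\<lambda>i. w i - vec_mean n w) L U l M \<rho> \<delta>))"
proof -
  define \<delta> where "\<delta> = 1 / (8 * sqrt (2 * K))"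
  have \<delta>: "\<delta> > 0" using K by (simp add: \<delta>_def)
  have \<delta>2: "\<delta>^2 = 1 / (128 * K)" using K by (simp add: \<delta>_def power_divide power_mult_distrib)
  have \<delta>2le: "\<delta>^2 \<le> 1 / 128" unfolding \<delta>2 using K by (intro divide_left_mono) auto
  define n1 where "n1 = max 4 (nat \<lceil>2 / \<delta>^2\<rceil>)"
  have "\<exists>L U l M. permuted_sample {1..n} (\<lambda>i. w i - vec_mean n w) L U l M (\<delta>^2 / 2) \<delta>"
    if n: "n \<ge> n1" and nc: "\<not> constant_vec n w" and bal: "balanced K n w" for n w
  proof -
    define x where "x i = w i - vec_mean n w" for i
    define M where "M = (\<Sum>i\<in>{1..n}. (x i)^2) / real n"
    define \<sigma> where "\<sigma> = sqrt M"
    have n4: "n \<ge> 4" "real n \<ge> 2 / \<delta>^2" using n unfolding n1_def by linarith+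
    have x0: "sum x {1..n} = 0" using n4 by (simp add: x_def sum_subtractf vec_mean_def)
    have "M \<noteq> 0"
    proof
      assume "M = 0"
      then have "\<forall>i\<in>{1..n}. (x i)^2 = 0" using n4 unfolding M_def by (subst sum_nonneg_eq_0_iff[symmetric]) auto
      then show False using nc unfolding constant_vec_def x_def by auto
    qed
    moreover have "M \<ge> 0" unfolding M_def by (intro divide_nonneg_nonneg sum_nonneg) auto
    ultimately have M: "M > 0" by simp
    have \<sigma>: "\<sigma> > 0" "\<sigma>^2 = M" using M by (auto simp: \<sigma>_def)
    have m2: "(\<Sum>i\<in>{1..n}. (x i)^2) = real (card {1..n}) * \<sigma>^2" using n4 by (simp add: \<sigma> M_def)
    have m4: "(\<Sum>i\<in>{1..n}. (x i)^4) \<le> real (card {1..n}) * (K * \<sigma>^4)"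
    proof -
      have "\<sigma>^4 = (\<sigma>^2)^2" by (simp flip: power_mult)
      then have "\<sigma>^4 = M^2" by (simp add: \<sigma>)
      moreover have "(\<Sum>i\<in>{1..n}. (x i)^4) / real n \<le> K * M^2"
        using bal unfolding balanced_def central_moment_def x_def[symmetric] M_def .
      ultimately show ?thesis using n4 by (simp add: pos_divide_le_eq mult_ac)
    qed
    have m1: "(\<Sum>i\<in>{1..n}. \<bar>x i\<bar>) \<ge> real (card {1..n}) * (\<sigma> / (2 * sqrt (2 * K)))"
      by (rule balanced_absolute_moment[OF _ _ _ \<sigma>(1) m2 m4]) (use n4 K in auto)
    have e: "\<sigma> / (2 * sqrt (2 * K)) = 4 * \<delta> * \<sigma>" by (simp add: \<delta>_def)
    have p: "(\<Sum>i\<in>{1..n}. max (t * x i) 0) \<ge> real (card {1..n}) * (2 * \<delta> * \<sigma>)" if t: "t = 1 \<or> t = -1" for t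
    proof -
      have "(\<Sum>i\<in>{1..n}. max (t * x i) 0) = (\<Sum>i\<in>{1..n}. (\<bar>x i\<bar> + t * x i) / 2)"
        using t by (intro sum.cong refl) (auto simp: max_def)
      also have "\<dots> = ((\<Sum>i\<in>{1..n}. \<bar>x i\<bar>) + t * sum x {1..n}) / 2"
        by (simp add: sum_divide_distrib[symmetric] sum.distrib sum_distrib_left)
      finally show ?thesis using m1 unfolding e x0 by simp
    qed
    have cards: "real n * \<delta>^2 \<le> real (card {i\<in>{1..n}. t * x i \<ge> \<delta> * \<sigma>})" if t: "t = 1 \<or> t = -1" for t
      using one_sided_large_values[OF _ _ \<sigma>(1) \<delta> _ p[OF t]] m2 n4 t by (auto simp: power_mult_distrib)
    define l where "l = nat \<lfloor>real n * \<delta>^2\<rfloor>"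
    have l: "real l \<le> real n * \<delta>^2" "real n * \<delta>^2 < real l + 1" unfolding l_def using \<delta> by auto
    have "l \<le> card {i\<in>{1..n}. -1 * x i \<ge> \<delta> * \<sigma>}" "l \<le> card {i\<in>{1..n}. 1 * x i \<ge> \<delta> * \<sigma>}"
      using l(1) cards[of 1] cards[of "-1"] by linarith+
    then obtain L U where L: "L \<subseteq> {i\<in>{1..n}. -1 * x i \<ge> \<delta> * \<sigma>}" "card L = l"
      and U: "U \<subseteq> {i\<in>{1..n}. 1 * x i \<ge> \<delta> * \<sigma>}" "card U = l"
      by (meson obtain_subset_with_card_n)
    have d\<sigma>: "\<delta> * \<sigma> > 0" using \<delta> \<sigma> by simp
    have "permuted_sample {1..n} x L U l M (\<delta>^2 / 2) \<delta>"
    proof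
      show "M = (\<Sum>i\<in>{1..n}. (x i)^2) / real (card {1..n})" by (simp add: M_def)
      show "L \<inter> U = {}"
      proof (rule ccontr)
        assume "L \<inter> U \<noteq> {}"
        then obtain i where "i \<in> L" "i \<in> U" by auto
        then have "- x i \<ge> \<delta> * \<sigma>" "x i \<ge> \<delta> * \<sigma>" using L U by auto
        then show False using d\<sigma> by linarith
      qed
      have "real n * \<delta>^2 \<le> real n * (1 / 128)" using \<delta>2le by (intro mult_left_mono) auto
      then have "2 * real l + 1 \<le> real n" using l n4 by linarith
      then show "2 * l + 1 \<le> card {1..n}" by simp
      show "\<delta>^2 / 2 * real (card {1..n}) \<le> real l"
      proof -
        have "2 \<le> real n * \<delta>^2" using n4(2) \<delta> by (simp add: field_simps)
        moreover have "\<delta>^2 / 2 * real (card {1..n}) = real n * \<delta>^2 / 2" by simp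
        ultimately show ?thesis using l by linarith
      qed
      show "\<delta> * sqrt M \<le> \<bar>x q - x p\<bar>" if "p \<in> L" "q \<in> U" for p q
      proof -
        have "- x p \<ge> \<delta> * \<sigma>" "x q \<ge> \<delta> * \<sigma>" using that L U by auto
        then show ?thesis using d\<sigma> unfolding \<sigma>_def by linarith
      qed
    qed (use L U M x0 n4 \<delta> in auto)
    then show ?thesis unfolding x_def by blast
  qed
  then show ?thesis using \<delta> by (intro exI[of _ "\<delta>^2 / 2"] exI[of _ \<delta>] exI[of _ n1]) auto
qed

text \<open>The coefficients of \<open>(1 + X) ^ s / (1 - X)\<close> and \<open>(1 + X) ^ s / (1 - X)\<^sup>2\<close>.\<close>
definition hc :: "nat \<Rightarrow> nat \<Rightarrow> real" where "hc s j = (\<Sum>l=0..j. real (s choose l))"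
definition gc :: "nat \<Rightarrow> nat \<Rightarrow> real" where "gc s j = (\<Sum>l=0..j. hc s l)"

section \<open>Sizes and increments of the kernel coefficients and binomial weights\<close>

lemma one_plus_X_power_nth: "fps_nth ((1 + fps_X) ^ s) l = real (s choose l)"
proof (induction s arbitrary: l)
  case (Suc s)
  then show ?case by (cases l) (simp_all add: distrib_right)
qed (auto simp: binomial_eq_0)

lemma hc_fps: "fps_nth ((1 + fps_X) ^ s * geo) j = hc s j"
  by (simp add: geo_mult_nth hc_def one_plus_X_power_nth)

lemma gc_fps: "fps_nth ((1 + fps_X) ^ s * geo * geo) j = gc s j"
  by (simp add: gc_def hc_fps geo_mult_nth[of "(1 + fps_X) ^ s * geo"])

lemma hc_bounds: "1 \<le> hc s j" "hc s j \<le> 2 ^ s"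
proof -
  have "(\<Sum>l\<in>{0}. real (s choose l)) \<le> hc s j" unfolding hc_def by (intro sum_mono2) auto
  then show "1 \<le> hc s j" by simp
  have "hc s j \<le> (\<Sum>l\<in>{0..max j s}. real (s choose l))" unfolding hc_def by (intro sum_mono2) auto
  also have "\<dots> = (\<Sum>l\<in>{..s}. real (s choose l))" by (intro sum.mono_neutral_right) (auto simp: binomial_eq_0)
  also have "\<dots> = 2 ^ s" by (metis choose_row_sum of_nat_numeral of_nat_power of_nat_sum)
  finally show "hc s j \<le> 2 ^ s" .
qed

lemma gc_diff:
  assumes "i \<le> j"
  shows "real (j - i) \<le> gc s j - gc s i" "gc s j - gc s i \<le> 2 ^ s * real (j - i)"
proof -
  have "{0..j} = {0..i} \<union> {i<..j}" using assms by auto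
  then have "gc s j = gc s i + (\<Sum>l\<in>{i<..j}. hc s l)"
    unfolding gc_def by (metis (no_types, lifting) finite_atLeastAtMost finite_greaterThanAtMost sum.union_disjoint atLeast0AtMost ivl_disj_int_one(3))
  then have e: "gc s j - gc s i = (\<Sum>l\<in>{i<..j}. hc s l)" by simp
  have "(\<Sum>l\<in>{i<..j}. 1) \<le> (\<Sum>l\<in>{i<..j}. hc s l)" by (intro sum_mono hc_bounds)
  then show "real (j - i) \<le> gc s j - gc s i" unfolding e by simp
  have "(\<Sum>l\<in>{i<..j}. hc s l) \<le> (\<Sum>l\<in>{i<..j}. 2 ^ s)" by (intro sum_mono hc_bounds)
  then show "gc s j - gc s i \<le> 2 ^ s * real (j - i)" unfolding e by (simp add: mult.commute)
qed

lemma gc_bounds: "real j + 1 \<le> gc s j" "gc s j \<le> 2 ^ s * (real j + 1)"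
proof -
  have "gc s 0 = hc s 0" by (simp add: gc_def)
  then have "1 \<le> gc s 0" "gc s 0 \<le> 2 ^ s" using hc_bounds by auto
  then show "real j + 1 \<le> gc s j" "gc s j \<le> 2 ^ s * (real j + 1)"
    using gc_diff[of 0 j s] by (auto simp: algebra_simps)
qed

lemma choose_le_power: "real (i choose d) \<le> real i ^ d"
  by (metis binomial_eq_0 binomial_le_pow not_le of_nat_0_le_iff of_nat_le_iff of_nat_power of_nat_0 zero_le_power)

text \<open>For \<open>d = 0\<close> the constant is 1, because division by zero gives 0 and
  \<open>0 ^ 0 = 1\<close>; the estimate therefore covers this case without a separate
  formula.\<close>

lemma choose_ge_power:
  assumes "real N / 2 \<le> real i" "d \<le> i"
  shows "(1 / (2 * real d)) ^ d * real N ^ d \<le> real (i choose d)"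
proof -
  have "(1 / (2 * real d)) ^ d * real N ^ d = (real N / 2 / real d) ^ d"
    by (simp add: power_mult_distrib[symmetric])
  also have "\<dots> \<le> (real i / real d) ^ d"
    using assms by (intro power_mono divide_right_mono) auto
  also have "\<dots> \<le> real (i choose d)" by (rule binomial_ge_n_over_k_pow_k[OF assms(2)])
  finally show ?thesis .
qed

text \<open>By Pascal's rule a unit step adds \<open>j choose (d - 1)\<close>. The bound
  \<open>N ^ (d - 1)\<close> is written as a quotient so that \<open>d = 0\<close>, with increment
  0, is included.\<close>

lemma choose_diff_le:
  assumes "i \<le> j" "j \<le> N" "N > 0"
  shows "real (j choose d) - real (i choose d) \<le> real (j - i) * (real N ^ d / real N)"
  using assms
proof (induction j rule: dec_induct)
  case (step j)
  have "real (Suc j choose d) - real (j choose d) \<le> real N ^ d / real N"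
  proof (cases d)
    case (Suc d')
    have "real (Suc j choose d) - real (j choose d) = real (j choose d')" by (simp add: Suc)
    also have "\<dots> \<le> real j ^ d'" by (rule choose_le_power)
    also have "\<dots> \<le> real N ^ d'" using step by (intro power_mono) auto
    finally show ?thesis using step by (simp add: Suc)
  qed simp
  moreover have "real (j choose d) - real (i choose d) \<le> real (j - i) * (real N ^ d / real N)" using step by simp
  moreover have "real (Suc j - i) = real (j - i) + 1" using step by (simp add: Suc_diff_le)
  ultimately show ?case by (simp only: distrib_right)
qed simp

section \<open>The contribution of the mean\<close>

text \<open>At index \<open>k - 1\<close> the double sum counts each \<open>q i\<close> with weight
  \<open>k - i\<close>, the single sum with weight 1. Without cancellation, and with
  \<open>i \<le> d\<close>, the ratio is at least \<open>k - d\<close>.\<close>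

lemma one_signed_numerator_mean:
  fixes q :: "real fps"
  assumes \<sigma>: "\<sigma> = 1 \<or> \<sigma> = -1" and sgn: "\<And>i. i < k \<Longrightarrow> \<sigma> * fps_nth q i \<ge> 0"
    and zero: "\<And>i. i < k \<Longrightarrow> d < i \<Longrightarrow> fps_nth q i = 0" and k: "d < k"
  shows "\<bar>fps_nth (q * geo * geo) (k - 1)\<bar> \<ge> (real k - real d) * \<bar>fps_nth (q * geo) (k - 1)\<bar>"
proof -
  have "(real k - real d) * \<bar>fps_nth (q * geo) (k - 1)\<bar> \<le> (real k - real d) * (\<Sum>i=0..k-1. \<bar>fps_nth q i\<bar>)"
    unfolding geo_mult_nth using k by (intro mult_left_mono sum_abs) auto
  also have "\<dots> = (\<Sum>i=0..k-1. (real k - real d) * (\<sigma> * fps_nth q i))"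
    unfolding sum_distrib_left
  proof (intro sum.cong refl)
    fix i assume "i \<in> {0..k-1}"
    then have "\<sigma> * fps_nth q i \<ge> 0" using sgn k by auto
    then have "\<bar>fps_nth q i\<bar> = \<sigma> * fps_nth q i" using \<sigma> by auto
    then show "(real k - real d) * \<bar>fps_nth q i\<bar> = (real k - real d) * (\<sigma> * fps_nth q i)" by simp
  qed
  also have "\<dots> \<le> (\<Sum>i=0..k-1. (real (k - 1) + 1 - real i) * (\<sigma> * fps_nth q i))"
  proof (rule sum_mono)
    fix i assume i: "i \<in> {0..k-1}"
    show "(real k - real d) * (\<sigma> * fps_nth q i) \<le> (real (k - 1) + 1 - real i) * (\<sigma> * fps_nth q i)"
    proof (cases "i \<le> d")
      case True
      then show ?thesis using sgn[of i] i k by (intro mult_right_mono) auto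
    next
      case False
      then show ?thesis using zero[of i] i k by simp
    qed
  qed
  also have "\<dots> = \<sigma> * fps_nth (q * geo * geo) (k - 1)"
    by (simp add: geo_square_nth sum_distrib_left mult.left_commute)
  also have "\<dots> \<le> \<bar>fps_nth (q * geo * geo) (k - 1)\<bar>" using \<sigma> by auto
  finally show ?thesis .
qed

text \<open>For alternating signs, multiplying by \<open>(1 + X) ^ Suc d\<close> turns the contribution of the mean into a
  polynomial of degree at most \<open>d\<close> whose coefficients have one sign.\<close>
definition fwd_fps :: "nat \<Rightarrow> real fps" where
  "fwd_fps d = Abs_fps (\<lambda>j. (-1) ^ j * real (Suc j choose d))"

text \<open>With \<open>j = i - 1\<close> and \<open>\<nu> = n\<close> this is the alternating
  weight \<open>(n + 1 - i) choose d\<close>. The generalised binomial keeps Pascal's rule valid at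
  all indices, also where \<open>\<nu> - j\<close> is negative.\<close>

definition rev_fps :: "real \<Rightarrow> nat \<Rightarrow> real fps" where
  "rev_fps \<nu> d = Abs_fps (\<lambda>j. (-1) ^ j * ((\<nu> - real j) gchoose d))"

lemma fwd_fps_0: "(1 + fps_X) * fwd_fps 0 = 1"
proof (rule fps_ext)
  fix n show "fps_nth ((1 + fps_X) * fwd_fps 0) n = fps_nth 1 n"
    by (cases n) (auto simp: fwd_fps_def distrib_right)
qed

lemma fwd_fps_Suc: "(1 + fps_X) * fwd_fps (Suc d) = fps_const (of_bool (d = 0)) - fps_X * fwd_fps d"
proof (rule fps_ext)
  fix n show "fps_nth ((1 + fps_X) * fwd_fps (Suc d)) n = fps_nth (fps_const (of_bool (d = 0)) - fps_X * fwd_fps d) n"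
    by (cases n) (auto simp: fwd_fps_def distrib_right distrib_left)
qed

text \<open>From \<open>d = 1\<close> on, each step of the recursion multiplies the numerator by
  \<open>- X\<close>; for \<open>d = 0\<close> and \<open>d = 1\<close> it is 1. What matters later
  is that it has one sign and degree at most \<open>d\<close>.\<close>

lemma fwd_fps_numerator: "\<exists>\<sigma> m. (\<sigma> = 1 \<or> \<sigma> = -1) \<and> m \<le> d \<and> (1 + fps_X) ^ Suc d * fwd_fps d = fps_const \<sigma> * fps_X ^ m"
proof (induction d)
  case 0
  show ?case by (intro exI[of _ 1] exI[of _ 0]) (simp add: fwd_fps_0)
next
  case (Suc d)
  have e: "(1 + fps_X) ^ Suc (Suc d) * fwd_fps (Suc d) = (1 + fps_X) ^ Suc d * ((1 + fps_X) * fwd_fps (Suc d))"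
    by (simp add: mult_ac)
  show ?case
  proof (cases "d = 0")
    case True
    have "(1 + fps_X) ^ Suc (Suc d) * fwd_fps (Suc d) = (1 + fps_X) - fps_X * ((1 + fps_X) * fwd_fps 0)"
      unfolding e fwd_fps_Suc using True by (simp add: algebra_simps)
    then show ?thesis by (intro exI[of _ 1] exI[of _ 0]) (simp add: fwd_fps_0)
  next
    case False
    obtain \<sigma> m where s: "\<sigma> = 1 \<or> \<sigma> = -1" "m \<le> d" "(1 + fps_X) ^ Suc d * fwd_fps d = fps_const \<sigma> * fps_X ^ m"
      using Suc by blast
    have "(1 + fps_X) ^ Suc (Suc d) * fwd_fps (Suc d) = - (fps_X * ((1 + fps_X) ^ Suc d * fwd_fps d))"
      unfolding e fwd_fps_Suc using False by (simp add: algebra_simps)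
    also have "\<dots> = fps_const (-\<sigma>) * fps_X ^ Suc m"
      unfolding s(3) by (simp add: mult_ac flip: fps_const_neg)
    finally show ?thesis using s(1,2) by (intro exI[of _ "-\<sigma>"] exI[of _ "Suc m"]) auto
  qed
qed

lemma rev_fps_0: "(1 + fps_X) * rev_fps \<nu> 0 = 1"
proof (rule fps_ext)
  fix n show "fps_nth ((1 + fps_X) * rev_fps \<nu> 0) n = fps_nth 1 n"
    by (cases n) (auto simp: rev_fps_def distrib_right)
qed

lemma rev_fps_Suc: "(1 + fps_X) * rev_fps \<nu> (Suc d) = fps_const (\<nu> gchoose Suc d) + fps_X * rev_fps (\<nu> - 1) d"
proof (rule fps_ext)
  fix n show "fps_nth ((1 + fps_X) * rev_fps \<nu> (Suc d)) n = fps_nth (fps_const (\<nu> gchoose Suc d) + fps_X * rev_fps (\<nu> - 1) d) n"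
  proof (cases n)
    case (Suc m)
    have "(\<nu> - real m) gchoose Suc d = ((\<nu> - real m - 1) gchoose d) + ((\<nu> - real m - 1) gchoose Suc d)"
      using gbinomial_Suc_Suc[of "\<nu> - real m - 1" d] by simp
    moreover have "\<nu> - real (Suc m) = \<nu> - real m - 1" "\<nu> - 1 - real m = \<nu> - real m - 1" by simp_all
    ultimately show ?thesis by (simp only: Suc rev_fps_def distrib_right) (simp add: algebra_simps)
  qed (simp add: rev_fps_def)
qed

definition nonneg_upto :: "nat \<Rightarrow> real fps \<Rightarrow> bool" where
  "nonneg_upto d f \<longleftrightarrow> (\<forall>i. fps_nth f i \<ge> 0) \<and> (\<forall>i>d. fps_nth f i = 0)"

lemma nonneg_upto_power: "nonneg_upto d ((1 + fps_X) ^ d)"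
  by (auto simp: nonneg_upto_def one_plus_X_power_nth binomial_eq_0)

lemma nonneg_upto_comb:
  assumes "nonneg_upto (Suc d) f" "nonneg_upto d h" "c \<ge> 0"
  shows "nonneg_upto (Suc d) (fps_const c * f + fps_X * h)"
  using assms unfolding nonneg_upto_def by auto

text \<open>The recursion builds the numerator for \<open>Suc d\<close> and \<open>N\<close> from
  \<open>N choose Suc d\<close> times a power of \<open>1 + X\<close> and \<open>X\<close> times the
  numerator for \<open>d\<close> and \<open>N - 1\<close>; \<open>d \<le> N\<close> persists, and no
  subtraction occurs.\<close>

lemma rev_fps_numerator: "d \<le> N \<Longrightarrow> nonneg_upto d ((1 + fps_X) ^ Suc d * rev_fps (real N) d)"
proof (induction d arbitrary: N)
  case 0
  then show ?case by (simp add: rev_fps_0 nonneg_upto_def)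
next
  case (Suc d)
  have "(1 + fps_X) ^ Suc (Suc d) * rev_fps (real N) (Suc d) = (1 + fps_X) ^ Suc d * ((1 + fps_X) * rev_fps (real N) (Suc d))"
    by (simp add: mult_ac)
  also have "\<dots> = fps_const (real (N choose Suc d)) * (1 + fps_X) ^ Suc d + fps_X * ((1 + fps_X) ^ Suc d * rev_fps (real (N - 1)) d)"
    unfolding rev_fps_Suc using Suc.prems by (simp add: binomial_gbinomial[symmetric] algebra_simps)
  finally show ?case
    using nonneg_upto_comb[OF nonneg_upto_power Suc.IH, of "N - 1" "real (N choose Suc d)"] Suc.prems by simp
qed

text \<open>The weights of a smoothed coefficient (\<open>h = gc s\<close>) or of its increment
  (\<open>h = hc s\<close>) as a linear form in the entries. The sign \<open>\<epsilon> = -1\<close>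
  stands for the substitution of \<open>-x\<close>. Extension by 0 beyond \<open>k\<close> keeps
  \<open>{1..n}\<close> as the index set on which the permutation acts.\<close>

definition smooth_coeff :: "real \<Rightarrow> (nat \<Rightarrow> real) \<Rightarrow> (nat \<Rightarrow> real) \<Rightarrow> nat \<Rightarrow> nat \<Rightarrow> real" where
  "smooth_coeff \<epsilon> \<beta> h k i = (if i \<in> {1..k} then \<epsilon> ^ (i - 1) * \<beta> i * h (k - i) else 0)"

lemma smooth_coeff_sum:
  assumes "k \<le> n"
  shows "(\<Sum>i\<in>{1..n}. smooth_coeff \<epsilon> \<beta> h k i * f i) = (\<Sum>i\<in>{1..k}. \<epsilon> ^ (i - 1) * \<beta> i * h (k - i) * f i)"
proof -
  have "(\<Sum>i\<in>{1..n}. smooth_coeff \<epsilon> \<beta> h k i * f i) = (\<Sum>i\<in>{1..k}. smooth_coeff \<epsilon> \<beta> h k i * f i)"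
    by (rule sum.mono_neutral_right) (use assms in \<open>auto simp: smooth_coeff_def\<close>)
  then show ?thesis by (simp add: smooth_coeff_def)
qed

lemma fps_mult_nth_shift:
  assumes "k > 0"
  shows "fps_nth (F * f) (k - 1) = (\<Sum>i\<in>{1..k}. fps_nth F (i - 1) * fps_nth f (k - i))"
  unfolding fps_mult_nth
  by (rule sum.reindex_bij_witness[of _ "\<lambda>i. i - 1" "\<lambda>i. i + 1"]) (use assms in auto)

lemma alternating_mean:
  assumes k: "d < k" and F: "\<And>i. i \<in> {1..k} \<Longrightarrow> fps_nth F (i - 1) = (-1) ^ (i - 1) * \<beta> i"
    and num: "\<sigma> = 1 \<or> \<sigma> = -1" "\<And>i. i < k \<Longrightarrow> \<sigma> * fps_nth ((1 + fps_X) ^ s * F) i \<ge> 0"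
      "\<And>i. i < k \<Longrightarrow> d < i \<Longrightarrow> fps_nth ((1 + fps_X) ^ s * F) i = 0"
  shows "\<bar>\<Sum>i\<in>{1..k}. (-1) ^ (i - 1) * \<beta> i * gc s (k - i)\<bar> \<ge>
     (real k - real d) * \<bar>\<Sum>i\<in>{1..k}. (-1) ^ (i - 1) * \<beta> i * hc s (k - i)\<bar>"
proof -
  have "(\<Sum>i\<in>{1..k}. (-1) ^ (i - 1) * \<beta> i * gc s (k - i)) = fps_nth (F * ((1 + fps_X) ^ s * geo * geo)) (k - 1)"
    by (subst fps_mult_nth_shift, use k in simp, intro sum.cong refl, simp only: F gc_fps)
  also have "F * ((1 + fps_X) ^ s * geo * geo) = (1 + fps_X) ^ s * F * geo * geo" by (simp only: mult_ac)
  finally have 1: "(\<Sum>i\<in>{1..k}. (-1) ^ (i - 1) * \<beta> i * gc s (k - i)) = fps_nth ((1 + fps_X) ^ s * F * geo * geo) (k - 1)" .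
  have "(\<Sum>i\<in>{1..k}. (-1) ^ (i - 1) * \<beta> i * hc s (k - i)) = fps_nth (F * ((1 + fps_X) ^ s * geo)) (k - 1)"
    by (subst fps_mult_nth_shift, use k in simp, intro sum.cong refl, simp only: F hc_fps)
  also have "F * ((1 + fps_X) ^ s * geo) = (1 + fps_X) ^ s * F * geo" by (simp only: mult_ac)
  finally have 2: "(\<Sum>i\<in>{1..k}. (-1) ^ (i - 1) * \<beta> i * hc s (k - i)) = fps_nth ((1 + fps_X) ^ s * F * geo) (k - 1)" .
  show ?thesis unfolding 1 2 by (rule one_signed_numerator_mean[OF num k])
qed

lemma alternating_mean_fwd:
  assumes k: "d < k"
  shows "\<bar>\<Sum>i\<in>{1..k}. (-1) ^ (i - 1) * real (i choose d) * gc (Suc d) (k - i)\<bar> \<ge>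
     (real k - real d) * \<bar>\<Sum>i\<in>{1..k}. (-1) ^ (i - 1) * real (i choose d) * hc (Suc d) (k - i)\<bar>"
proof -
  obtain \<sigma> m where s: "\<sigma> = 1 \<or> \<sigma> = -1" "m \<le> d" "(1 + fps_X) ^ Suc d * fwd_fps d = fps_const \<sigma> * fps_X ^ m"
    using fwd_fps_numerator by blast
  show ?thesis
  proof (rule alternating_mean[OF k, where F = "fwd_fps d" and \<sigma> = \<sigma>])
    show "fps_nth (fwd_fps d) (i - 1) = (-1) ^ (i - 1) * real (i choose d)" if "i \<in> {1..k}" for i
      using that by (simp add: fwd_fps_def)
  qed (use s in \<open>auto simp: s(3)\<close>)
qed

lemma alternating_mean_rev:
  assumes k: "d < k" "k \<le> n"
  shows "\<bar>\<Sum>i\<in>{1..k}. (-1) ^ (i - 1) * real ((n + 1 - i) choose d) * gc (Suc d) (k - i)\<bar> \<ge>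
     (real k - real d) * \<bar>\<Sum>i\<in>{1..k}. (-1) ^ (i - 1) * real ((n + 1 - i) choose d) * hc (Suc d) (k - i)\<bar>"
proof (rule alternating_mean[OF k(1), where F = "rev_fps (real n) d" and \<sigma> = 1])
  show "fps_nth (rev_fps (real n) d) (i - 1) = (-1) ^ (i - 1) * real ((n + 1 - i) choose d)" if i: "i \<in> {1..k}" for i
  proof -
    have "real n - real (i - 1) = real (n + 1 - i)" using i k by simp
    then show ?thesis by (simp only: rev_fps_def fps_nth_Abs_fps binomial_gbinomial)
  qed
qed (use rev_fps_numerator[of d n] k in \<open>auto simp: nonneg_upto_def\<close>)

text \<open>With nonnegative weights nothing cancels: the sum with \<open>hc\<close> is at most
  \<open>k * b * 2 ^ s\<close>, while \<open>k / 8\<close> positions contribute at least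
  \<open>\<omega> * b * k / 4\<close> each to the sum with \<open>gc\<close>. This is the origin of
  32.\<close>

lemma positive_mean:
  assumes k: "k > 0" and \<beta>: "\<And>i. i \<in> {1..k} \<Longrightarrow> 0 \<le> \<beta> i \<and> \<beta> i \<le> b" and S: "S \<subseteq> {1..k}" "8 * card S \<ge> k"
    and low: "\<And>i. i \<in> S \<Longrightarrow> \<beta> i \<ge> \<omega> * b \<and> 4 * (k - i) \<ge> k" and \<omega>: "\<omega> > 0" "b > 0"
  shows "\<bar>\<Sum>i\<in>{1..k}. \<beta> i * gc s (k - i)\<bar> \<ge> \<omega> / (32 * 2 ^ s) * real k * \<bar>\<Sum>i\<in>{1..k}. \<beta> i * hc s (k - i)\<bar>"
proof -
  have h0: "0 \<le> hc s j" for j using hc_bounds(1)[of s j] by simp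
  have g0: "0 \<le> gc s j" for j using gc_bounds(1)[of j s] by simp
  have "(\<Sum>i\<in>{1..k}. \<beta> i * hc s (k - i)) \<le> (\<Sum>i\<in>{1..k}. b * 2 ^ s)"
    using \<beta> hc_bounds h0 \<omega> by (intro sum_mono mult_mono) auto
  moreover have "(\<Sum>i\<in>{1..k}. \<beta> i * hc s (k - i)) \<ge> 0" using \<beta> h0 by (intro sum_nonneg mult_nonneg_nonneg) auto
  ultimately have "\<omega> / (32 * 2 ^ s) * real k * \<bar>\<Sum>i\<in>{1..k}. \<beta> i * hc s (k - i)\<bar> \<le> \<omega> / (32 * 2 ^ s) * real k * (real k * b * 2 ^ s)"
    using \<omega> by (intro mult_left_mono) auto
  also have "\<dots> = real k / 8 * (\<omega> * b * (real k / 4))" by (simp add: field_simps)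
  also have "\<dots> \<le> real (card S) * (\<omega> * b * (real k / 4))"
    using S(2) \<omega> by (intro mult_right_mono) auto
  also have "\<dots> = (\<Sum>i\<in>S. \<omega> * b * (real k / 4))" by simp
  also have "\<dots> \<le> (\<Sum>i\<in>S. \<beta> i * gc s (k - i))"
  proof (rule sum_mono)
    fix i assume i: "i \<in> S"
    then have "real k \<le> 4 * real (k - i)" using low[OF i] by linarith
    then have "real k / 4 \<le> gc s (k - i)" using gc_bounds(1)[of "k - i" s] by linarith
    then show "\<omega> * b * (real k / 4) \<le> \<beta> i * gc s (k - i)"
      using low[OF i] \<omega> \<beta>[of i] i S by (intro mult_mono) auto
  qed
  also have "\<dots> \<le> (\<Sum>i\<in>{1..k}. \<beta> i * gc s (k - i))"
    using S \<beta> g0 by (intro sum_mono2) (auto intro!: mult_nonneg_nonneg)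
  also have "\<dots> \<le> \<bar>\<dots>\<bar>" by simp
  finally show ?thesis .
qed

section \<open>Crossing probabilities\<close>

abbreviation crossing :: "nat \<Rightarrow> nat \<Rightarrow> (nat \<Rightarrow> real) \<Rightarrow> (nat \<Rightarrow> real) \<Rightarrow> bool" where
  "crossing s k b v \<equiv> \<bar>\<Sum>i\<in>{1..k}. b i * gc s (k - i) * v i\<bar> \<le> \<bar>\<Sum>i\<in>{1..k}. b i * hc s (k - i) * v i\<bar>"

text \<open>The instance of \<open>crossing_bound\<close> for the smoothed coefficients. As
  \<open>k \<le> \<mu> * r^2\<close>, the bounds \<open>b * 2 ^ s\<close> and
  \<open>b * 2 ^ s * k\<close> for the weights give square sums of the required orders
  \<open>r^2\<close> and \<open>r^6\<close>. At even distance the powers of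
  \<open>\<epsilon>\<close> agree, so alternating weights differ like positive ones.\<close>

lemma weighted_crossing_bound:
  fixes \<beta> :: "nat \<Rightarrow> real"
  assumes smp: "permuted_sample {1..n} x L U l M \<rho> \<delta>"
    and k: "k \<le> n" "k > 0" and r: "r > 0" and \<epsilon>: "\<epsilon> = 1 \<or> \<epsilon> = -1"
    and pos: "\<gamma> > 0" "b > 0" "\<Gamma> > 0" "\<eta> > 0"
    and \<beta>: "\<And>i. i \<in> {1..k} \<Longrightarrow> 0 \<le> \<beta> i \<and> \<beta> i \<le> b"
    and reg: "{a..<a + 24 * r^2} \<subseteq> {1..k}"
    and diff: "\<And>i j. i \<in> {a..<a + 24 * r^2} \<Longrightarrow> j \<in> {a..<a + 24 * r^2} \<Longrightarrow> i < j \<Longrightarrow>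
      \<gamma> * b * real (j - i) \<le> \<beta> i * gc s (k - i) - \<beta> j * gc s (k - j) \<and>
      \<beta> i * gc s (k - i) - \<beta> j * gc s (k - j) \<le> \<Gamma> * b * real (j - i)"
    and mean: "\<bar>\<Sum>i\<in>{1..k}. \<epsilon> ^ (i - 1) * \<beta> i * gc s (k - i)\<bar> \<ge>
      \<eta> * real k * \<bar>\<Sum>i\<in>{1..k}. \<epsilon> ^ (i - 1) * \<beta> i * hc s (k - i)\<bar>"
    and size: "real k \<le> \<mu> * real r^2" "\<eta> * real r^2 \<ge> 4"
  shows "perm_avg {1..n} (\<lambda>\<pi>. of_bool (crossing s k (\<lambda>i. \<epsilon> ^ (i - 1) * \<beta> i) (\<lambda>i. (w + x (\<pi> i))))) \<le>
    2 * (12 + 32 * \<Gamma>^2 / (\<gamma>^2 * \<delta>^2) + 6 * (4 ^ s * (\<mu> + \<mu>^3)) * (64 + 256 / \<eta>^2) / (\<gamma>^2 * \<delta>^2)) / \<rho>^2 * \<mu> / real k"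
proof -
  interpret permuted_sample "{1..n}" x L U l M \<rho> \<delta> by (rule smp)
  define \<Lambda> where "\<Lambda> = 4 ^ s * (\<mu> + \<mu>^3)"
  define c e where "c = smooth_coeff \<epsilon> \<beta> (gc s) k" and "e = smooth_coeff \<epsilon> \<beta> (hc s) k"
  have r2: "real r^2 > 0" using r by simp
  have \<mu>: "\<mu> > 0" using size(1) k r2 by (smt (verit) of_nat_0_less_iff mult_nonpos_nonneg)
  have \<Lambda>: "4 ^ s * \<mu> \<le> \<Lambda>" "4 ^ s * \<mu>^3 \<le> \<Lambda>" using \<mu> by (simp_all add: \<Lambda>_def)
  have \<epsilon>1: "\<bar>\<epsilon> ^ j\<bar> = 1" for j using \<epsilon> by (auto simp: power_abs)
  have sq: "(\<Sum>i\<in>{1..n}. (smooth_coeff \<epsilon> \<beta> f k i)^2) \<le> real k * (b * B)^2"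
    if f: "\<And>i. i \<in> {1..k} \<Longrightarrow> 0 \<le> f (k - i) \<and> f (k - i) \<le> B" for f B
  proof -
    have "(\<Sum>i\<in>{1..n}. (smooth_coeff \<epsilon> \<beta> f k i)^2) = (\<Sum>i\<in>{1..k}. (smooth_coeff \<epsilon> \<beta> f k i)^2)"
      by (rule sum.mono_neutral_right) (use k in \<open>auto simp: smooth_coeff_def\<close>)
    also have "\<dots> \<le> (\<Sum>i\<in>{1..k}. (b * B)^2)"
    proof (rule sum_mono)
      fix i assume i: "i \<in> {1..k}"
      then have "\<bar>smooth_coeff \<epsilon> \<beta> f k i\<bar> = \<beta> i * f (k - i)"
        using \<beta>[OF i] f[OF i] \<epsilon>1[of "i - 1"] by (simp add: smooth_coeff_def abs_mult)
      also have "\<dots> \<le> b * B" using \<beta>[OF i] f[OF i] pos by (intro mult_mono) auto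
      finally show "(smooth_coeff \<epsilon> \<beta> f k i)^2 \<le> (b * B)^2"
        by (intro abs_le_square_iff[THEN iffD1]) auto
    qed
    finally show ?thesis by simp
  qed
  have "perm_avg {1..n} (\<lambda>\<pi>. of_bool (\<bar>\<Sum>i\<in>{1..n}. c i * (w + x (\<pi> i))\<bar> \<le> \<bar>\<Sum>i\<in>{1..n}. e i * (w + x (\<pi> i))\<bar>)) \<le>
    2 * (12 + 32 * \<Gamma>^2 / (\<gamma>^2 * \<delta>^2) + 6 * \<Lambda> * (64 + 256 / \<eta>^2) / (\<gamma>^2 * \<delta>^2)) / \<rho>^2 / real r^2"
  proof (rule crossing_bound[OF r _ _ pos _ _ _ size(2)])
    show "{a..<a + 24 * r^2} \<subseteq> {1..n}" using reg k by auto
    show "\<gamma> * b * real (j - i) \<le> \<bar>c i - c j\<bar> \<and> \<bar>c i - c j\<bar> \<le> \<Gamma> * b * real (j - i)"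
      if ij: "i \<in> {a..<a + 24 * r^2}" "j \<in> {a..<a + 24 * r^2}" "i < j" "even (j - i)" for i j
    proof -
      have m: "i \<in> {1..k}" "j \<in> {1..k}" using ij reg by blast+
      have "j - 1 = (i - 1) + (j - i)" using m ij by auto
      moreover have "\<epsilon> ^ (j - i) = 1" using ij(4) \<epsilon> by auto
      ultimately have "\<epsilon> ^ (j - 1) = \<epsilon> ^ (i - 1)" by (simp add: power_add)
      then have "c i - c j = \<epsilon> ^ (i - 1) * (\<beta> i * gc s (k - i) - \<beta> j * gc s (k - j))"
        using m by (simp add: c_def smooth_coeff_def algebra_simps)
      then have "\<bar>c i - c j\<bar> = \<bar>\<beta> i * gc s (k - i) - \<beta> j * gc s (k - j)\<bar>" using \<epsilon>1 by (simp add: abs_mult)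
      moreover have "\<gamma> * b * real (j - i) \<ge> 0" using pos by simp
      ultimately show ?thesis using diff[OF ij(1-3)] by linarith
    qed
    have "(\<Sum>i\<in>{1..n}. (e i)^2) \<le> real k * (b * 2 ^ s)^2"
      unfolding e_def
    proof (rule sq)
      show "0 \<le> hc s (k - i) \<and> hc s (k - i) \<le> 2 ^ s" for i
        using hc_bounds[of s "k - i"] by linarith
    qed
    also have "\<dots> \<le> (\<mu> * real r^2) * (b * 2 ^ s)^2" using size by (intro mult_right_mono) auto
    also have "\<dots> = (4 ^ s * \<mu>) * (b^2 * real r^2)"
      by (simp add: power2_eq_square algebra_simps flip: power_mult_distrib)
    also have "\<dots> \<le> \<Lambda> * (b^2 * real r^2)" using \<Lambda> by (intro mult_right_mono) auto
    finally show "(\<Sum>i\<in>{1..n}. (e i)^2) \<le> \<Lambda> * b^2 * real r^2" by (simp add: mult.assoc)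
    have "(\<Sum>i\<in>{1..n}. (c i)^2) \<le> real k * (b * (2 ^ s * real k))^2"
      unfolding c_def
    proof (rule sq)
      fix i assume i: "i \<in> {1..k}"
      have "gc s (k - i) \<le> 2 ^ s * (real (k - i) + 1)" by (rule gc_bounds)
      also have "\<dots> \<le> 2 ^ s * real k" using i by (intro mult_left_mono) auto
      finally show "0 \<le> gc s (k - i) \<and> gc s (k - i) \<le> 2 ^ s * real k"
        using gc_bounds(1)[of "k - i" s] by linarith
    qed
    also have "\<dots> = (4 ^ s * b^2) * real k ^ 3"
      by (simp add: power2_eq_square power3_eq_cube algebra_simps flip: power_mult_distrib)
    also have "\<dots> \<le> (4 ^ s * b^2) * (\<mu> * real r^2) ^ 3" using size by (intro mult_left_mono power_mono) auto
    also have "\<dots> = (4 ^ s * \<mu>^3) * (b^2 * real r^6)"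
      by (simp add: algebra_simps flip: power_mult)
    also have "\<dots> \<le> \<Lambda> * (b^2 * real r^6)" using \<Lambda> by (intro mult_right_mono) auto
    finally show "(\<Sum>i\<in>{1..n}. (c i)^2) \<le> \<Lambda> * b^2 * real r^6" by (simp add: mult.assoc)
    have rk: "real r^2 \<le> real k"
    proof -
      have "card {a..<a + 24 * r^2} \<le> card {1..k}" using reg by (intro card_mono) auto
      then have "r^2 \<le> k" by simp
      then show ?thesis by (metis of_nat_le_iff of_nat_power)
    qed
    have sums: "sum c {1..n} = (\<Sum>i\<in>{1..k}. \<epsilon> ^ (i - 1) * \<beta> i * gc s (k - i))"
      "sum e {1..n} = (\<Sum>i\<in>{1..k}. \<epsilon> ^ (i - 1) * \<beta> i * hc s (k - i))"
      using smooth_coeff_sum[OF k(1), of \<epsilon> \<beta> _ "\<lambda>_. 1"] by (simp_all add: c_def e_def)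
    have "\<eta> * real r^2 * \<bar>sum e {1..n}\<bar> \<le> \<eta> * real k * \<bar>sum e {1..n}\<bar>"
      using rk pos by (intro mult_right_mono mult_left_mono) auto
    then show "\<eta> * real r^2 * \<bar>sum e {1..n}\<bar> \<le> \<bar>sum c {1..n}\<bar>" using mean unfolding sums by linarith
  qed
  also have "\<dots> \<le> 2 * (12 + 32 * \<Gamma>^2 / (\<gamma>^2 * \<delta>^2) + 6 * \<Lambda> * (64 + 256 / \<eta>^2) / (\<gamma>^2 * \<delta>^2)) / \<rho>^2 * (\<mu> / real k)"
  proof -
    have div: "B / y \<le> B * z" if "1 / y \<le> z" "0 \<le> B" for B y z :: real
      using mult_left_mono[OF that] by simp
    have "1 / real r^2 \<le> \<mu> / real k" using size(1) k r2 by (simp add: field_simps)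
    moreover have "0 \<le> 2 * (12 + 32 * \<Gamma>^2 / (\<gamma>^2 * \<delta>^2) + 6 * \<Lambda> * (64 + 256 / \<eta>^2) / (\<gamma>^2 * \<delta>^2)) / \<rho>^2"
      using \<Lambda> \<mu> by (intro divide_nonneg_nonneg mult_nonneg_nonneg add_nonneg_nonneg) (auto simp: \<Lambda>_def)
    ultimately show ?thesis by (rule div)
  qed
  finally show ?thesis
    unfolding c_def e_def smooth_coeff_sum[OF k(1)] \<Lambda>_def by simp
qed

text \<open>\<open>r\<close> is the integer part of the square root of
  \<open>\<theta> * k / 24\<close>. That root is at least 2, so rounding loses at most a factor 2,
  and \<open>96 = 24 * 2^2\<close>.\<close>

lemma block_length_exists:
  assumes \<theta>: "\<theta> > 0" and k: "real k \<ge> 96 / \<theta>"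
  shows "\<exists>r>0. 24 * real r^2 \<le> \<theta> * real k \<and> real k \<le> 96 / \<theta> * real r^2"
proof -
  define y where "y = sqrt (\<theta> * real k / 24)"
  define r where "r = nat \<lfloor>y\<rfloor>"
  have "\<theta> * real k / 24 \<ge> 4" using k \<theta> by (simp add: field_simps)
  then have "sqrt 4 \<le> y" unfolding y_def by (rule real_sqrt_le_mono)
  then have y2: "y \<ge> 2" by simp
  have yy: "y^2 = \<theta> * real k / 24" unfolding y_def using \<theta> by simp
  have r: "real r \<le> y" "y < real r + 1" unfolding r_def using y2 by linarith+
  have "real r^2 \<le> y^2" using r by (intro power_mono) auto
  then have 1: "24 * real r^2 \<le> \<theta> * real k" unfolding yy by simp
  have "y^2 \<le> (2 * real r)^2" using r y2 by (intro power_mono) auto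
  then have "\<theta> * real k \<le> 96 * real r^2" unfolding yy by (simp add: power_mult_distrib)
  then have "real k \<le> 96 / \<theta> * real r^2" using \<theta> by (simp add: field_simps)
  moreover have "r > 0" using r y2 by linarith
  ultimately show ?thesis using 1 by blast
qed

text \<open>A discrete product rule with competing terms: \<open>gc s (k - i)\<close> falls while
  \<open>i choose d\<close> rises at rate at most \<open>b / k\<close>. Near \<open>k\<close> the
  factor \<open>gc s (k - j)\<close> is at most \<open>\<omega> * k / 4\<close>, so the rise cancels
  at most a quarter of the guaranteed fall.\<close>

lemma fwd_coeff_diff:
  fixes d k :: nat
  defines "\<omega> \<equiv> (1 / (2 * real d)) ^ d" and "b \<equiv> real k ^ d"
  assumes ij: "i < j" "j \<le> k" and low: "real k / 2 \<le> real i" "d \<le> i"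
    and near: "2 ^ s * (real (k - j) + 1) \<le> \<omega> / 4 * real k"
  shows "\<omega> / 2 * b * real (j - i) \<le> real (i choose d) * gc s (k - i) - real (j choose d) * gc s (k - j)"
    and "real (i choose d) * gc s (k - i) - real (j choose d) * gc s (k - j) \<le> 2 * 2 ^ s * b * real (j - i)"
proof -
  define \<Delta> where "\<Delta> = gc s (k - i) - gc s (k - j)"
  have k: "k > 0" using ij by simp
  have b: "b > 0" unfolding b_def using k by simp
  have kd: "k - i - (k - j) = j - i" using ij by simp
  have \<Delta>: "real (j - i) \<le> \<Delta>" "\<Delta> \<le> 2 ^ s * real (j - i)"
    using gc_diff[of "k - j" "k - i" s] ij unfolding \<Delta>_def kd by auto
  have \<Delta>0: "\<Delta> \<ge> 0" using \<Delta>(1) by linarith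
  have \<beta>i: "\<omega> * b \<le> real (i choose d)" "real (i choose d) \<le> b"
  proof -
    show "\<omega> * b \<le> real (i choose d)" unfolding \<omega>_def b_def by (rule choose_ge_power[OF low])
    have "real (i choose d) \<le> real i ^ d" by (rule choose_le_power)
    also have "\<dots> \<le> b" unfolding b_def using ij by (intro power_mono) auto
    finally show "real (i choose d) \<le> b" .
  qed
  have mono: "real (i choose d) \<le> real (j choose d)" using ij binomial_right_mono[of i j d] by simp
  have g0: "gc s (k - j) \<ge> 0" using gc_bounds(1)[of "k - j" s] by linarith
  have eq: "real (i choose d) * gc s (k - i) - real (j choose d) * gc s (k - j) =
    real (i choose d) * \<Delta> - (real (j choose d) - real (i choose d)) * gc s (k - j)"
    unfolding \<Delta>_def by (simp add: algebra_simps)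
  define W where "W = \<omega> * b * real (j - i)"
  have W1: "W \<le> real (i choose d) * \<Delta>"
    unfolding W_def using \<beta>i \<Delta> by (intro mult_mono) auto
  have "(real (j choose d) - real (i choose d)) * gc s (k - j) \<le> (real (j - i) * (b / real k)) * (\<omega> / 4 * real k)"
  proof (rule mult_mono)
    show "real (j choose d) - real (i choose d) \<le> real (j - i) * (b / real k)"
      unfolding b_def using choose_diff_le[of i j k d] ij by simp
    show "gc s (k - j) \<le> \<omega> / 4 * real k" using gc_bounds(2)[of s "k - j"] near by linarith
  qed (use b g0 in auto)
  also have "\<dots> = W / 4" using k by (simp add: W_def)
  finally have W2: "(real (j choose d) - real (i choose d)) * gc s (k - j) \<le> W / 4" .
  have "0 \<le> W" unfolding W_def \<omega>_def using b by simp
  then have "W / 2 \<le> W - W / 4" by simp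
  also have "\<dots> \<le> real (i choose d) * \<Delta> - (real (j choose d) - real (i choose d)) * gc s (k - j)"
    by (rule diff_mono[OF W1 W2])
  finally show "\<omega> / 2 * b * real (j - i) \<le> real (i choose d) * gc s (k - i) - real (j choose d) * gc s (k - j)"
    unfolding eq by (simp add: W_def)
  have "real (i choose d) * \<Delta> \<le> b * (2 ^ s * real (j - i))" using \<beta>i \<Delta> \<Delta>0 b by (intro mult_mono) auto
  moreover have "(real (j choose d) - real (i choose d)) * gc s (k - j) \<ge> 0" using mono g0 by simp
  moreover have "0 \<le> b * (2 ^ s * real (j - i))" using b by simp
  moreover have "2 * 2 ^ s * b * real (j - i) = 2 * (b * (2 ^ s * real (j - i)))" by simp
  ultimately show "real (i choose d) * gc s (k - i) - real (j choose d) * gc s (k - j) \<le> 2 * 2 ^ s * b * real (j - i)"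
    unfolding eq by linarith
qed

text \<open>Both factors decrease in \<open>i\<close>, so the two contributions have the same sign;
  only the lower bound for the weight restricts the positions.\<close>

lemma rev_coeff_diff:
  fixes d n :: nat
  defines "\<omega> \<equiv> (1 / (2 * real d)) ^ d" and "b \<equiv> real n ^ d"
  assumes ij: "1 \<le> i" "i < j" "j \<le> k" "k \<le> n" and low: "real n / 2 \<le> real (n + 1 - i)" "d \<le> n + 1 - i"
  shows "\<omega> / 2 * b * real (j - i) \<le> real ((n + 1 - i) choose d) * gc s (k - i) - real ((n + 1 - j) choose d) * gc s (k - j)"
    and "real ((n + 1 - i) choose d) * gc s (k - i) - real ((n + 1 - j) choose d) * gc s (k - j) \<le> 2 * 2 ^ s * b * real (j - i)"
proof -
  define \<Delta> where "\<Delta> = gc s (k - i) - gc s (k - j)"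
  define \<beta> where "\<beta> i = real ((n + 1 - i) choose d)" for i
  have n: "n > 0" using ij by simp
  have b: "b > 0" unfolding b_def using n by simp
  have kd: "k - i - (k - j) = j - i" "n + 1 - i - (n + 1 - j) = j - i" using ij by auto
  have \<Delta>: "real (j - i) \<le> \<Delta>" "\<Delta> \<le> 2 ^ s * real (j - i)"
    using gc_diff[of "k - j" "k - i" s] ij unfolding \<Delta>_def kd by auto
  have \<Delta>0: "\<Delta> \<ge> 0" using \<Delta>(1) by linarith
  have \<beta>i: "\<omega> * b \<le> \<beta> i" "\<beta> i \<le> b"
  proof -
    show "\<omega> * b \<le> \<beta> i" unfolding \<omega>_def b_def \<beta>_def by (rule choose_ge_power[OF low])
    have "\<beta> i \<le> real (n + 1 - i) ^ d" unfolding \<beta>_def by (rule choose_le_power)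
    also have "\<dots> \<le> b" unfolding b_def using ij by (intro power_mono) auto
    finally show "\<beta> i \<le> b" .
  qed
  have mono: "\<beta> j \<le> \<beta> i" using ij binomial_right_mono[of "n + 1 - j" "n + 1 - i" d] by (simp add: \<beta>_def)
  have g: "gc s (k - j) \<ge> 0" "gc s (k - j) \<le> 2 ^ s * real n"
  proof -
    show "gc s (k - j) \<ge> 0" using gc_bounds(1)[of "k - j" s] by linarith
    have "gc s (k - j) \<le> 2 ^ s * (real (k - j) + 1)" by (rule gc_bounds)
    also have "\<dots> \<le> 2 ^ s * real n" using ij by (intro mult_left_mono) auto
    finally show "gc s (k - j) \<le> 2 ^ s * real n" .
  qed
  have eq: "\<beta> i * gc s (k - i) - \<beta> j * gc s (k - j) = \<beta> i * \<Delta> + (\<beta> i - \<beta> j) * gc s (k - j)"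
    unfolding \<Delta>_def by (simp add: algebra_simps)
  have "\<omega> * b * real (j - i) \<le> \<beta> i * \<Delta>"
    using \<beta>i \<Delta> by (intro mult_mono) (auto simp: \<beta>_def)
  moreover have "(\<beta> i - \<beta> j) * gc s (k - j) \<ge> 0" using mono g by simp
  moreover have "\<omega> / 2 * b * real (j - i) = \<omega> * b * real (j - i) / 2" by simp
  moreover have "0 \<le> \<omega> * b * real (j - i)" unfolding \<omega>_def using b by simp
  ultimately show "\<omega> / 2 * b * real (j - i) \<le> real ((n + 1 - i) choose d) * gc s (k - i) - real ((n + 1 - j) choose d) * gc s (k - j)"
    unfolding \<beta>_def[symmetric] eq by linarith
  have "\<beta> i * \<Delta> \<le> b * (2 ^ s * real (j - i))" using \<beta>i \<Delta> \<Delta>0 b by (intro mult_mono) auto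
  moreover have "(\<beta> i - \<beta> j) * gc s (k - j) \<le> (real (j - i) * (b / real n)) * (2 ^ s * real n)"
  proof (rule mult_mono)
    show "\<beta> i - \<beta> j \<le> real (j - i) * (b / real n)"
      unfolding \<beta>_def b_def using choose_diff_le[of "n + 1 - j" "n + 1 - i" n d] ij kd by auto
  qed (use b g in auto)
  moreover have "(real (j - i) * (b / real n)) * (2 ^ s * real n) = b * (2 ^ s * real (j - i))" using n by simp
  moreover have "2 * 2 ^ s * b * real (j - i) = 2 * (b * (2 ^ s * real (j - i)))" by simp
  ultimately show "real ((n + 1 - i) choose d) * gc s (k - i) - real ((n + 1 - j) choose d) * gc s (k - j) \<le> 2 * 2 ^ s * b * real (j - i)"
    unfolding \<beta>_def[symmetric] eq by linarith
qed

lemma crossing_probability: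
  fixes K :: real and d :: nat
  assumes K: "K > 1"
  obtains C n1 k0 where "C > 0"
    "\<And>n w k \<epsilon> \<beta>. n \<ge> n1 \<Longrightarrow> \<not> constant_vec n w \<Longrightarrow> balanced K n w \<Longrightarrow> k \<in> {k0..n} \<Longrightarrow> \<epsilon> \<in> {1, -1} \<Longrightarrow>
      \<beta> \<in> {\<lambda>i. real (i choose d), \<lambda>i. real ((n + 1 - i) choose d)} \<Longrightarrow>
      perm_avg {1..n} (\<lambda>\<pi>. of_bool (crossing (Suc d) k (\<lambda>i. \<epsilon> ^ (i - 1) * \<beta> i) (\<lambda>i. w (\<pi> i)))) \<le> C / real k"
proof -
  obtain \<rho> \<delta> n1 where \<rho>: "\<rho> > 0" "\<delta> > 0" and smp: "\<And>n w. n \<ge> n1 \<Longrightarrow> \<not> constant_vec n w \<Longrightarrow> balanced K n w \<Longrightarrow>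
    \<exists>L U l M. permuted_sample {1..n} (\<lambda>i. w i - vec_mean n w) L U l M \<rho> \<delta>"
    using balanced_sample[OF K] by blast
  define s where "s = Suc d"
  define \<omega> where "\<omega> = (1 / (2 * real d)) ^ d"
  \<comment> \<open>\<open>\<theta>\<close> is the relative distance from \<open>k\<close> allowed
    by \<open>fwd_coeff_diff\<close>, and \<open>\<eta>\<close> is the constant of
    \<open>positive_mean\<close>. In \<open>k0\<close>, the bound \<open>2 * d + 2\<close> gives
    \<open>k - d \<ge> k / 2\<close> for the alternating mean, \<open>96 / \<theta>\<close> is
    needed for the block length, and \<open>384 / (\<theta> * \<eta>)\<close> yields
    \<open>\<eta> * r^2 \<ge> 4\<close>.\<close>
  define \<theta> where "\<theta> = \<omega> / (4 * 2 ^ s)"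
  define \<eta> where "\<eta> = \<omega> / (32 * 2 ^ s)"
  define \<mu> where "\<mu> = 96 / \<theta>"
  define \<gamma> \<Gamma> where "\<gamma> = \<omega> / 2" and "\<Gamma> = (2 * 2 ^ s :: real)"
  define C where "C = 2 * (12 + 32 * \<Gamma>^2 / (\<gamma>^2 * \<delta>^2) + 6 * (4 ^ s * (\<mu> + \<mu>^3)) * (64 + 256 / \<eta>^2) / (\<gamma>^2 * \<delta>^2)) / \<rho>^2 * \<mu>"
  define k0 where "k0 = max (2 * d + 2) (nat \<lceil>max (96 / \<theta>) (384 / (\<theta> * \<eta>))\<rceil>)"
  have \<omega>: "\<omega> > 0" "\<omega> \<le> 1"
  proof -
    show "\<omega> > 0" unfolding \<omega>_def by (cases "d = 0") auto
    show "\<omega> \<le> 1" unfolding \<omega>_def by (cases "d = 0") (auto intro!: power_le_one)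
  qed
  have "\<omega> \<le> 2 ^ s" by (rule order_trans[OF \<omega>(2)]) simp
  then have \<theta>: "\<theta> > 0" "\<theta> \<le> 1 / 4" and \<eta>: "\<eta> > 0" "\<eta> \<le> 1 / 2"
    using \<omega> unfolding \<theta>_def \<eta>_def by (auto simp: field_simps)
  have pos: "\<gamma> > 0" "\<Gamma> > 0" "\<mu> > 0" using \<omega> \<theta> by (auto simp: \<gamma>_def \<Gamma>_def \<mu>_def)
  have main: "perm_avg {1..n} (\<lambda>\<pi>. of_bool (crossing s k (\<lambda>i. \<epsilon> ^ (i - 1) * \<beta> i) (\<lambda>i. w (\<pi> i)))) \<le> C / real k"
    if n: "n \<ge> n1" "\<not> constant_vec n w" "balanced K n w" and k: "k0 \<le> k" "k \<le> n" and \<epsilon>: "\<epsilon> = 1 \<or> \<epsilon> = -1"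
      and \<beta>: "\<beta> = (\<lambda>i. real (i choose d)) \<or> \<beta> = (\<lambda>i. real ((n + 1 - i) choose d))" for n w k \<epsilon> \<beta>
  proof -
    obtain L U l M where ps: "permuted_sample {1..n} (\<lambda>i. w i - vec_mean n w) L U l M \<rho> \<delta>" using smp[OF n] by blast
    have kd: "k \<ge> 2 * d + 2" using k(1) by (simp add: k0_def)
    have kr: "real k \<ge> 96 / \<theta>" "real k \<ge> 384 / (\<theta> * \<eta>)"
    proof -
      have "nat \<lceil>max (96 / \<theta>) (384 / (\<theta> * \<eta>))\<rceil> \<le> k" using k(1) by (simp add: k0_def)
      then have "max (96 / \<theta>) (384 / (\<theta> * \<eta>)) \<le> real k" by linarith
      then show "real k \<ge> 96 / \<theta>" "real k \<ge> 384 / (\<theta> * \<eta>)" by auto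
    qed
    obtain r where r: "r > 0" "24 * real r^2 \<le> \<theta> * real k" "real k \<le> \<mu> * real r^2"
      using block_length_exists[OF \<theta>(1) kr(1)] unfolding \<mu>_def by blast
    have \<eta>r: "\<eta> * real r^2 \<ge> 4"
    proof -
      have "384 / (\<theta> * \<eta>) \<le> 96 / \<theta> * real r^2" using kr(2) r(3) by (simp add: \<mu>_def)
      then show ?thesis using \<theta> \<eta> by (simp add: field_simps)
    qed
    have \<theta>k: "\<theta> * real k \<le> real k / 4" using \<theta> mult_right_mono[of \<theta> "1/4" "real k"] by simp
    have rk: "24 * r^2 \<le> k"
    proof -
      have "real (24 * r^2) \<le> real k" using r(2) \<theta>k by simp
      then show ?thesis by (simp only: of_nat_le_iff)
    qed
    have k0: "k > 0" using kd by simp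
    have half: "(real k - real d) * y \<ge> \<eta> * real k * y" if "y \<ge> 0" for y
    proof -
      have "\<eta> * real k \<le> 1 / 2 * real k" using \<eta> by (intro mult_right_mono) auto
      also have "\<dots> \<le> real k - real d" using kd by linarith
      finally show ?thesis using that by (intro mult_right_mono)
    qed
    define b where "b = (if \<beta> = (\<lambda>i. real (i choose d)) then real k ^ d else real n ^ d)"
    \<comment> \<open>Increasing weights require swaps at the end of \<open>{1..k}\<close>, where
      \<open>gc\<close> is small; decreasing weights allow them at the start, where the weights are
      large. For \<open>d = 0\<close> the two weights coincide and count as increasing.\<close>
    define a where "a = (if \<beta> = (\<lambda>i. real (i choose d)) then k + 1 - 24 * r^2 else 1)"
    have b: "b > 0" unfolding b_def using k k0 by simp
    have "0 \<le> \<beta> i \<and> \<beta> i \<le> b" if i: "i \<in> {1..k}" for i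
    proof (cases "\<beta> = (\<lambda>i. real (i choose d))")
      case True
      have "real (i choose d) \<le> real i ^ d" by (rule choose_le_power)
      also have "\<dots> \<le> real k ^ d" using i by (intro power_mono) auto
      finally show ?thesis using True by (simp add: b_def)
    next
      case False
      then have F: "\<beta> = (\<lambda>i. real ((n + 1 - i) choose d))" using \<beta> by blast
      have "real ((n + 1 - i) choose d) \<le> real (n + 1 - i) ^ d" by (rule choose_le_power)
      also have "\<dots> \<le> real n ^ d" using i by (intro power_mono) auto
      finally show ?thesis using False F by (simp add: b_def)
    qed
    note \<beta>b = this
    have reg: "{a..<a + 24 * r^2} \<subseteq> {1..k}" using rk by (auto simp: a_def)
    have diff: "\<gamma> * b * real (j - i) \<le> \<beta> i * gc s (k - i) - \<beta> j * gc s (k - j) \<and>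
      \<beta> i * gc s (k - i) - \<beta> j * gc s (k - j) \<le> \<Gamma> * b * real (j - i)"
      if ij: "i \<in> {a..<a + 24 * r^2}" "j \<in> {a..<a + 24 * r^2}" "i < j" for i j
    proof (cases "\<beta> = (\<lambda>i. real (i choose d))")
      case True
      have ge: "k + 1 \<le> i + 24 * r^2" "k + 1 \<le> j + 24 * r^2" "j \<le> k"
        using ij rk True by (auto simp: a_def)
      have "real k + 1 \<le> real i + 24 * real r^2" "real k + 1 \<le> real j + 24 * real r^2"
        using ge(1,2)[THEN of_nat_mono[where 'a = real]] by simp_all
      then have "real k / 2 \<le> real i" and near: "real (k - j) + 1 \<le> \<theta> * real k"
        using r(2) \<theta>k ge(3) by (simp_all add: of_nat_diff)
      moreover have "d \<le> i" using \<open>real k / 2 \<le> real i\<close> kd by linarith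
      moreover have "2 ^ s * (real (k - j) + 1) \<le> \<omega> / 4 * real k"
      proof -
        have "2 ^ s * (real (k - j) + 1) \<le> 2 ^ s * (\<theta> * real k)" using near by (intro mult_left_mono) auto
        then show ?thesis by (simp add: \<theta>_def)
      qed
      ultimately show ?thesis
        using fwd_coeff_diff[of i j k d s] ij ge True unfolding \<omega>_def[symmetric] \<gamma>_def \<Gamma>_def b_def by simp
    next
      case False
      then have F: "\<beta> = (\<lambda>i. real ((n + 1 - i) choose d))" using \<beta> by blast
      have le: "1 \<le> i" "i \<le> 24 * r^2" "j \<le> 24 * r^2" using ij False by (auto simp: a_def)
      have "real i \<le> 24 * real r^2" using le(2)[THEN of_nat_mono[where 'a = real]] by simp
      then have "real i \<le> real k / 4" using r(2) \<theta>k by linarith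
      then have "real n / 2 \<le> real (n + 1 - i)" "d \<le> n + 1 - i" using k kd by linarith+
      then show ?thesis
        using rev_coeff_diff[of i j k n d s] ij le rk k False unfolding \<omega>_def[symmetric] \<gamma>_def \<Gamma>_def b_def by (simp add: F)
    qed
    have mean: "\<bar>\<Sum>i\<in>{1..k}. \<epsilon> ^ (i - 1) * \<beta> i * gc s (k - i)\<bar> \<ge>
      \<eta> * real k * \<bar>\<Sum>i\<in>{1..k}. \<epsilon> ^ (i - 1) * \<beta> i * hc s (k - i)\<bar>"
    proof (cases "\<epsilon> = -1")
      case True
      have "\<bar>\<Sum>i\<in>{1..k}. (-1) ^ (i - 1) * \<beta> i * gc s (k - i)\<bar> \<ge>
        (real k - real d) * \<bar>\<Sum>i\<in>{1..k}. (-1) ^ (i - 1) * \<beta> i * hc s (k - i)\<bar>"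
        using \<beta> alternating_mean_fwd[of d k] alternating_mean_rev[of d k n] kd k unfolding s_def by auto
      then show ?thesis
        unfolding True by (rule order_trans[OF half, rotated]) simp
    next
      case False
      then have \<epsilon>1: "\<epsilon> = 1" using \<epsilon> by blast
      define S where "S = (if \<beta> = (\<lambda>i. real (i choose d)) then {(k + 1) div 2..3 * k div 4} else {1..k div 2})"
      have "\<bar>\<Sum>i\<in>{1..k}. \<beta> i * gc s (k - i)\<bar> \<ge> \<eta> * real k * \<bar>\<Sum>i\<in>{1..k}. \<beta> i * hc s (k - i)\<bar>"
        unfolding \<eta>_def
      proof (rule positive_mean[OF k0 \<beta>b, where S = S])
        show "S \<subseteq> {1..k}" using kd unfolding S_def by auto
        show "k \<le> 8 * card S"
        proof -
          have "3 * k \<le> 4 * (3 * k div 4) + 3" "2 * (Suc k div 2) \<le> Suc k" "k \<le> 2 * (k div 2) + 1" by presburger+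
          then show ?thesis using kd unfolding S_def by auto
        qed
        show "\<omega> * b \<le> \<beta> i \<and> k \<le> 4 * (k - i)" if i: "i \<in> S" for i
        proof (cases "\<beta> = (\<lambda>i. real (i choose d))")
          case True
          have i2: "k \<le> 2 * i" "4 * i \<le> 3 * k" using i True by (auto simp: S_def)
          then have "real k / 2 \<le> real i" "d \<le> i" using kd by linarith+
          from choose_ge_power[OF this] show ?thesis using True i2 unfolding \<omega>_def b_def by auto
        next
          case False
          then have F: "\<beta> = (\<lambda>i. real ((n + 1 - i) choose d))" using \<beta> by blast
          have i2: "1 \<le> i" "2 * i \<le> k" using i False by (auto simp: S_def)
          then have "real n / 2 \<le> real (n + 1 - i)" "d \<le> n + 1 - i" using kd k by linarith+
          from choose_ge_power[OF this] show ?thesis using False i2 unfolding \<omega>_def b_def by (auto simp: F)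
        qed
      qed (use \<omega> b in auto)
      then show ?thesis by (simp add: \<epsilon>1)
    qed
    have "perm_avg {1..n} (\<lambda>\<pi>. of_bool (crossing s k (\<lambda>i. \<epsilon> ^ (i - 1) * \<beta> i) (\<lambda>i. (vec_mean n w + (w (\<pi> i) - vec_mean n w))))) \<le> C / real k"
      unfolding C_def
      by (rule weighted_crossing_bound[OF ps k(2) k0 r(1) \<epsilon> pos(1) b pos(2) \<eta>(1) \<beta>b reg diff mean r(3) \<eta>r])
    then show ?thesis by simp
  qed
  have "C > 0"
    unfolding C_def using pos \<rho>
    by (intro mult_pos_pos divide_pos_pos add_pos_nonneg) auto
  then show ?thesis
    by (rule that, intro main[unfolded s_def]) auto
qed

section \<open>Counting real roots of the permuted polynomial\<close>

text \<open>Multiplicities are carried over by peeling off linear factors, since \<open>T\<close> is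
  multiplicative. It serves for the substitution of \<open>-x\<close> and for the reversal of
  coefficients.\<close>

lemma proots_transfer:
  fixes T :: "real poly \<Rightarrow> real poly"
  assumes mult: "\<And>p q. T (p * q) = T p * T q" and nz: "\<And>p. p \<noteq> 0 \<Longrightarrow> T p \<noteq> 0"
    and root: "\<And>r. C r \<Longrightarrow> poly (T [:-r, 1:]) (\<phi> r) = 0 \<and> C' (\<phi> r)"
    and p: "p \<noteq> 0"
  shows "size (filter_mset C (proots p)) \<le> size (filter_mset C' (proots (T p)))"
  using p
proof (induction "size (filter_mset C (proots p))" arbitrary: p)
  case 0
  show ?case by (simp flip: 0(1))
next
  case (Suc m)
  from size_eq_Suc_imp_elem[OF Suc(2)[symmetric]]
  obtain r where r: "r \<in># filter_mset C (proots p)" by blast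
  then have C: "C r" and "poly p r = 0" using Suc.prems by auto
  then obtain q where q: "p = [:-r, 1:] * q" by (metis poly_eq_0_iff_dvd dvdE)
  then have q0: "q \<noteq> 0" using Suc.prems by auto
  have "proots p = {#r#} + proots q" unfolding q using q0 by (subst proots_mult) auto
  then have s: "size (filter_mset C (proots p)) = Suc (size (filter_mset C (proots q)))" using C by simp
  then have "size (filter_mset C (proots q)) \<le> size (filter_mset C' (proots (T q)))"
    using Suc.hyps q0 by simp
  moreover have "Suc (size (filter_mset C' (proots (T q)))) \<le> size (filter_mset C' (proots (T p)))"
  proof -
    have n: "T [:-r, 1:] \<noteq> 0" "T q \<noteq> 0" using nz q0 by auto
    have "\<phi> r \<in># filter_mset C' (proots (T [:-r, 1:]))" using root[OF C] n by simp
    then have "size (filter_mset C' (proots (T [:-r, 1:]))) \<ge> 1"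
      by (metis One_nat_def Suc_leI size_eq_0_iff_empty empty_iff set_mset_empty not_gr_zero)
    then show ?thesis unfolding q mult using n by (simp add: proots_mult)
  qed
  ultimately show ?case using s by simp
qed

lemma size_proots_mult_ge:
  fixes p q :: "real poly"
  assumes "p \<noteq> 0" "q \<noteq> 0"
  shows "size (filter_mset C (proots p)) \<le> size (filter_mset C (proots (p * q)))"
  using assms by (simp add: proots_mult)

definition weighted_poly :: "nat \<Rightarrow> (nat \<Rightarrow> real) \<Rightarrow> real poly" where
  "weighted_poly n a = (\<Sum>i=1..n. monom (a i) (i - 1))"

lemma coeff_weighted_poly: "coeff (weighted_poly n a) j = (if j < n then a (Suc j) else 0)"
proof -
  have "coeff (weighted_poly n a) j = (\<Sum>i\<in>{1..n}. if i = Suc j then a i else 0)"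
    unfolding weighted_poly_def coeff_sum by (intro sum.cong) auto
  then show ?thesis by simp
qed

definition crossings :: "nat \<Rightarrow> nat \<Rightarrow> (nat \<Rightarrow> real) \<Rightarrow> nat" where
  "crossings s n a = card {k\<in>{1..n}. \<bar>\<Sum>i\<in>{1..k}. a i * gc s (k - i)\<bar> \<le> \<bar>\<Sum>i\<in>{1..k}. a i * hc s (k - i)\<bar>}"

text \<open>Multiplication by \<open>(1 + x) ^ s\<close> loses no roots. Below index
  \<open>n\<close> the smoothed coefficients are the sums in \<open>crossings\<close>, shifted by
  one; the at most \<open>s\<close> indices added by the factor are all counted as
  crossings.\<close>

lemma unit_interval_roots_le_crossings:
  assumes W: "weighted_poly n a \<noteq> 0"
  shows "size (filter_mset (\<lambda>r. 0 \<le> r \<and> r \<le> 1) (proots (weighted_poly n a))) \<le> 3 + s + crossings s n a"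
proof -
  define W where "W = weighted_poly n a"
  define P where "P = W * [:1, 1:] ^ s"
  have n: "n > 0" using W by (cases n) (auto simp: weighted_poly_def)
  have P0: "P \<noteq> 0" using W by (simp add: P_def W_def)
  have "degree W \<le> n - 1" unfolding W_def by (rule degree_le) (auto simp: coeff_weighted_poly)
  moreover have "degree ([:1, 1:] ^ s :: real poly) \<le> s" using degree_power_le[of "[:1, 1:] :: real poly" s] by simp
  ultimately have deg: "degree P \<le> n - 1 + s"
    unfolding P_def using degree_mult_le[of W "[:1, 1:] ^ s"] by linarith
  have fps: "fps_of_poly P = fps_of_poly W * (1 + fps_X) ^ s"
  proof -
    have "fps_of_poly [:1, 1:] = (1 + fps_X :: real fps)" by (simp add: fps_of_poly_pCons)
    then show ?thesis by (simp add: P_def fps_of_poly_mult fps_of_poly_power)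
  qed
  have nth: "fps_nth (fps_of_poly W * f) (k - 1) = (\<Sum>i\<in>{1..k}. a i * fps_nth f (k - i))" if "k \<in> {1..n}" for f k
    using that by (subst fps_mult_nth_shift) (auto simp: W_def coeff_weighted_poly intro!: sum.cong)
  have A: "fps_nth (fps_of_poly P * geo * geo) (k - 1) = (\<Sum>i\<in>{1..k}. a i * gc s (k - i))" if "k \<in> {1..n}" for k
  proof -
    have "fps_of_poly P * geo * geo = fps_of_poly W * ((1 + fps_X) ^ s * geo * geo)" unfolding fps by (simp only: mult_ac)
    then show ?thesis by (simp only: nth[OF that] gc_fps)
  qed
  have D: "fps_nth (fps_of_poly P * geo) (k - 1) = (\<Sum>i\<in>{1..k}. a i * hc s (k - i))" if "k \<in> {1..n}" for k
  proof -
    have "fps_of_poly P * geo = fps_of_poly W * ((1 + fps_X) ^ s * geo)" unfolding fps by (simp only: mult_ac)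
    then show ?thesis by (simp only: nth[OF that] hc_fps)
  qed
  define E where "E = {k\<in>{1..n}. \<bar>\<Sum>i\<in>{1..k}. a i * gc s (k - i)\<bar> \<le> \<bar>\<Sum>i\<in>{1..k}. a i * hc s (k - i)\<bar>}"
  have "{k\<in>{0..n - 1 + s}. \<bar>fps_nth (fps_of_poly P * geo * geo) k\<bar> \<le> \<bar>fps_nth (fps_of_poly P * geo) k\<bar>}
    \<subseteq> {n..<n + s} \<union> (\<lambda>k. k - 1) ` E"
  proof
    fix k assume k: "k \<in> {k\<in>{0..n - 1 + s}. \<bar>fps_nth (fps_of_poly P * geo * geo) k\<bar> \<le> \<bar>fps_nth (fps_of_poly P * geo) k\<bar>}"
    show "k \<in> {n..<n + s} \<union> (\<lambda>k. k - 1) ` E"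
    proof (cases "k < n")
      case True
      then have "Suc k \<in> E" using k A[of "Suc k"] D[of "Suc k"] by (auto simp: E_def)
      then show ?thesis by (intro UnI2 image_eqI[of _ _ "Suc k"]) auto
    next
      case False
      then show ?thesis using k n by auto
    qed
  qed
  then have "card {k\<in>{0..n - 1 + s}. \<bar>fps_nth (fps_of_poly P * geo * geo) k\<bar> \<le> \<bar>fps_nth (fps_of_poly P * geo) k\<bar>}
    \<le> card ({n..<n + s} \<union> (\<lambda>k. k - 1) ` E)" by (intro card_mono) (auto simp: E_def)
  also have "\<dots> \<le> card {n..<n + s} + card ((\<lambda>k. k - 1) ` E)" by (rule card_Un_le)
  also have "\<dots> \<le> s + card E" by (intro add_mono card_image_le) (auto simp: E_def)
  finally have "card {k\<in>{0..n - 1 + s}. \<bar>fps_nth (fps_of_poly P * geo * geo) k\<bar> \<le> \<bar>fps_nth (fps_of_poly P * geo) k\<bar>} \<le> s + crossings s n a"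
    by (simp add: crossings_def E_def)
  moreover have "size (filter_mset (\<lambda>r. 0 \<le> r \<and> r \<le> 1) (proots W)) \<le> size (filter_mset (\<lambda>r. 0 \<le> r \<and> r \<le> 1) (proots P))"
    unfolding P_def using W by (intro size_proots_mult_ge) (auto simp: W_def)
  ultimately show ?thesis using roots_le_crossings[OF P0 deg] unfolding W_def by linarith
qed

lemma pcompose_weighted_poly: "pcompose (weighted_poly n a) [:0, -1:] = weighted_poly n (\<lambda>i. (-1) ^ (i - 1) * a i)"
  by (rule poly_eqI) (simp add: coeff_pcompose_linear coeff_weighted_poly)

text \<open>\<open>reflect_poly\<close> reverses relative to the degree, which drops below
  \<open>n - 1\<close> when top coefficients vanish; the monomial restores the missing powers of
  \<open>x\<close>.\<close>

lemma reflect_weighted_poly: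
  assumes "weighted_poly n a \<noteq> 0"
  shows "monom 1 (n - 1 - degree (weighted_poly n a)) * reflect_poly (weighted_poly n a) = weighted_poly n (\<lambda>i. a (n + 1 - i))"
proof (rule poly_eqI)
  fix j
  define W where "W = weighted_poly n a"
  have n: "n > 0" using assms by (cases n) (auto simp: weighted_poly_def)
  have deg: "degree W \<le> n - 1" unfolding W_def by (rule degree_le) (auto simp: coeff_weighted_poly)
  show "coeff (monom 1 (n - 1 - degree (weighted_poly n a)) * reflect_poly (weighted_poly n a)) j = coeff (weighted_poly n (\<lambda>i. a (n + 1 - i))) j"
  proof (cases "j < n")
    case True
    show ?thesis
    proof (cases "n - 1 - degree W \<le> j")
      case c: True
      have "coeff (monom 1 (n - 1 - degree W) * reflect_poly W) j = coeff (reflect_poly W) (j - (n - 1 - degree W))"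
        using c by (simp add: coeff_monom_mult)
      also have "\<dots> = coeff W (n - 1 - j)"
        using c True deg by (auto simp: coeff_reflect_poly)
      also have "\<dots> = a (n + 1 - Suc j)" using True unfolding W_def by (simp add: coeff_weighted_poly Suc_diff_Suc)
      finally show ?thesis using True by (simp add: W_def coeff_weighted_poly)
    next
      case c: False
      then have "coeff W (n - 1 - j) = 0" by (intro coeff_eq_0) auto
      then have "a (n - j) = 0" using True unfolding W_def by (simp add: coeff_weighted_poly Suc_diff_Suc)
      then show ?thesis using c True by (simp add: W_def coeff_weighted_poly coeff_monom_mult)
    qed
  next
    case False
    then have "degree W < j - (n - 1 - degree W)" using deg n by auto
    then show ?thesis using False by (auto simp: W_def coeff_weighted_poly coeff_monom_mult coeff_reflect_poly)
  qed
qed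

text \<open>The line is covered by \<open>[0, 1]\<close>, \<open>[-1, 0]\<close> and the images of
  these intervals under inversion; double counting at the common endpoints is harmless for an upper
  bound.\<close>

lemma real_roots_le_crossings:
  assumes W0: "weighted_poly n a \<noteq> 0"
  shows "size (proots (weighted_poly n a)) \<le> 4 * (3 + s) + crossings s n a + crossings s n (\<lambda>i. (-1) ^ (i - 1) * a i)
    + crossings s n (\<lambda>i. a (n + 1 - i)) + crossings s n (\<lambda>i. (-1) ^ (i - 1) * a (n + 1 - i))"
proof -
  define U where "U r \<longleftrightarrow> 0 \<le> r \<and> r \<le> 1" for r :: real
  define Neg where "Neg r \<longleftrightarrow> -1 \<le> r \<and> r \<le> 0" for r :: real
  let ?W = "weighted_poly n a" and ?R = "weighted_poly n (\<lambda>i. a (n + 1 - i))"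
  have neg: "size (filter_mset Neg (proots (weighted_poly n f))) \<le> 3 + s + crossings s n (\<lambda>i. (-1) ^ (i - 1) * f i)"
    if f: "weighted_poly n f \<noteq> 0" for f
  proof -
    have nz: "pcompose p [:0, -1:] \<noteq> 0" if "p \<noteq> 0" for p :: "real poly"
      using that by (simp add: pcompose_eq_0_iff)
    have "size (filter_mset Neg (proots (weighted_poly n f))) \<le> size (filter_mset U (proots (pcompose (weighted_poly n f) [:0, -1:])))"
      by (rule proots_transfer[where T = "\<lambda>p. pcompose p [:0, -1:]" and \<phi> = "\<lambda>r. - r", OF pcompose_mult nz _ f])
         (auto simp: poly_pcompose U_def Neg_def)
    also have "\<dots> \<le> 3 + s + crossings s n (\<lambda>i. (-1) ^ (i - 1) * f i)"
      using nz[OF f] unfolding pcompose_weighted_poly U_def by (rule unit_interval_roots_le_crossings)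
    finally show ?thesis .
  qed
  have R0: "?R \<noteq> 0" unfolding reflect_weighted_poly[OF W0, symmetric] using W0 by simp
  have refl: "size (filter_mset C (proots ?W)) \<le> size (filter_mset C' (proots ?R))"
    if C: "\<And>r. C r \<Longrightarrow> r \<noteq> 0 \<and> C' (inverse r)" for C C'
  proof -
    have "size (filter_mset C (proots ?W)) \<le> size (filter_mset C' (proots (reflect_poly ?W)))"
      by (rule proots_transfer[where T = reflect_poly and \<phi> = inverse, OF reflect_poly_mult _ _ W0])
         (use C in \<open>auto simp: poly_reflect_poly_nz\<close>)
    also have "\<dots> \<le> size (filter_mset C' (proots ?R))"
      unfolding reflect_weighted_poly[OF W0, symmetric] using W0 by (subst mult.commute, intro size_proots_mult_ge) auto
    finally show ?thesis .
  qed
  have 1: "size (filter_mset U (proots ?W)) \<le> 3 + s + crossings s n a"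
    using W0 unfolding U_def by (rule unit_interval_roots_le_crossings)
  have 2: "size (filter_mset Neg (proots ?W)) \<le> 3 + s + crossings s n (\<lambda>i. (-1) ^ (i - 1) * a i)"
    using W0 by (rule neg)
  have "size (filter_mset (\<lambda>r. r \<ge> 1) (proots ?W)) \<le> size (filter_mset U (proots ?R))"
    by (rule refl) (auto simp: U_def inverse_le_1_iff)
  also have "\<dots> \<le> 3 + s + crossings s n (\<lambda>i. a (n + 1 - i))"
    using R0 unfolding U_def by (rule unit_interval_roots_le_crossings)
  finally have 3: "size (filter_mset (\<lambda>r. r \<ge> 1) (proots ?W)) \<le> 3 + s + crossings s n (\<lambda>i. a (n + 1 - i))" .
  have "size (filter_mset (\<lambda>r. r \<le> -1) (proots ?W)) \<le> size (filter_mset Neg (proots ?R))"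
  proof (rule refl)
    fix r :: real assume "r \<le> -1"
    then have "inverse (- r) \<le> 1" "inverse (- r) \<ge> 0" by (simp_all only: inverse_le_1_iff) auto
    then show "r \<noteq> 0 \<and> Neg (inverse r)" using \<open>r \<le> -1\<close> unfolding inverse_minus_eq Neg_def by linarith
  qed
  also have "\<dots> \<le> 3 + s + crossings s n (\<lambda>i. (-1) ^ (i - 1) * a (n + 1 - i))"
    using R0 by (rule neg)
  finally have 4: "size (filter_mset (\<lambda>r. r \<le> -1) (proots ?W)) \<le> 3 + s + crossings s n (\<lambda>i. (-1) ^ (i - 1) * a (n + 1 - i))" .
  have "size (filter_mset (\<lambda>_. True) (proots ?W)) \<le> size (filter_mset (\<lambda>r. U r \<or> Neg r) (proots ?W)) + size (filter_mset (\<lambda>r. r \<ge> 1 \<or> r \<le> -1) (proots ?W))"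
    by (rule size_filter_split) (auto simp: U_def Neg_def)
  moreover have "size (filter_mset (\<lambda>r. U r \<or> Neg r) (proots ?W)) \<le> size (filter_mset U (proots ?W)) + size (filter_mset Neg (proots ?W))"
    by (rule size_filter_split)
  moreover have "size (filter_mset (\<lambda>r. r \<ge> 1 \<or> r \<le> -1) (proots ?W)) \<le> size (filter_mset (\<lambda>r. r \<ge> 1) (proots ?W)) + size (filter_mset (\<lambda>r. r \<le> -1) (proots ?W))"
    by (rule size_filter_split)
  moreover have "size (filter_mset (\<lambda>_. True) (proots ?W)) = size (proots ?W)" by simp
  ultimately have "size (proots ?W) \<le> size (filter_mset U (proots ?W)) + size (filter_mset Neg (proots ?W))
      + size (filter_mset (\<lambda>r. r \<ge> 1) (proots ?W)) + size (filter_mset (\<lambda>r. r \<le> -1) (proots ?W))"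
    by linarith
  also have "\<dots> \<le> (3 + s + crossings s n a) + (3 + s + crossings s n (\<lambda>i. (-1) ^ (i - 1) * a i))
    + (3 + s + crossings s n (\<lambda>i. a (n + 1 - i))) + (3 + s + crossings s n (\<lambda>i. (-1) ^ (i - 1) * a (n + 1 - i)))"
    by (intro add_mono 1 2 3 4)
  finally show ?thesis by (simp add: algebra_simps)
qed

lemma higher_pderiv_perm_poly:
  "monom 1 d * (pderiv ^^ d) (perm_poly n w \<pi>) = smult (fact d) (monom 1 1 * weighted_poly n (\<lambda>i. real (i choose d) * w (\<pi> i)))"
proof (rule poly_eqI)
  fix i
  have c: "coeff (perm_poly n w \<pi>) i = (if i \<in> {1..n} then w (\<pi> i) else 0)" for i
    unfolding perm_poly_def coeff_sum by (simp add: if_distrib[of "\<lambda>x. x = _"])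
  show "coeff (monom 1 d * (pderiv ^^ d) (perm_poly n w \<pi>)) i =
    coeff (smult (fact d) (monom 1 1 * weighted_poly n (\<lambda>i. real (i choose d) * w (\<pi> i)))) i"
  proof (cases "d \<le> i")
    case True
    have e1: "real (i choose d) = pochhammer (real i - real d + 1) d / fact d"
      unfolding binomial_gbinomial by (rule gbinomial_pochhammer')
    have e2: "real i - real d + 1 = real (Suc (i - d))" using True by simp
    have p: "pochhammer (real (Suc (i - d))) d = fact d * real (i choose d)"
      unfolding e1 e2 by (simp only: times_divide_eq_right nonzero_mult_div_cancel_left[OF fact_nonzero])
    have "coeff (monom 1 d * (pderiv ^^ d) (perm_poly n w \<pi>)) i = fact d * real (i choose d) * coeff (perm_poly n w \<pi>) i"
    proof -
      have "coeff (monom 1 d * (pderiv ^^ d) (perm_poly n w \<pi>)) i = coeff ((pderiv ^^ d) (perm_poly n w \<pi>)) (i - d)"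
        using True by (simp add: coeff_monom_mult)
      also have "\<dots> = fact d * real (i choose d) * coeff (perm_poly n w \<pi>) (i - d + d)"
        by (simp only: coeff_higher_pderiv p)
      finally show ?thesis using True by simp
    qed
    then show ?thesis unfolding c by (cases i) (auto simp: coeff_monom_mult coeff_weighted_poly)
  next
    case False
    then show ?thesis by (cases i) (auto simp: coeff_monom_mult coeff_weighted_poly)
  qed
qed

lemma real_roots_higher_pderiv:
  fixes n d :: nat and w :: "nat \<Rightarrow> real" and \<pi> :: "nat \<Rightarrow> nat"
  defines "W \<equiv> weighted_poly n (\<lambda>i. real (i choose d) * w (\<pi> i))"
  assumes "W \<noteq> 0"
  shows "num_real_roots ((pderiv ^^ d) (perm_poly n w \<pi>)) \<le> ennreal (1 + real (size (proots W)))"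
proof -
  define Q where "Q = (pderiv ^^ d) (perm_poly n w \<pi>)"
  have eq: "monom 1 d * Q = smult (fact d) (monom 1 1 * W)"
    unfolding Q_def W_def by (rule higher_pderiv_perm_poly)
  have m: "monom 1 d \<noteq> (0 :: real poly)" for d by simp
  have Q: "Q \<noteq> 0" using eq assms(2) by (metis m mult_eq_0_iff smult_eq_0_iff fact_nonzero mult_zero_right)
  have "size (proots Q) \<le> size (proots (monom 1 d * Q))" using Q m[of d] by (simp add: proots_mult)
  also have "\<dots> = size (proots (monom 1 1) + proots W)" unfolding eq using assms(2) m[of 1] by (simp add: proots_mult)
  also have "\<dots> = 1 + size (proots W)"
  proof -
    have "monom 1 1 = [:-0, 1 :: real:]" by (simp add: monom_altdef)
    then have "size (proots (monom 1 1 :: real poly)) = 1" by (simp only: proots_linear_factor size_single)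
    then show ?thesis by simp
  qed
  finally have "real (size (proots Q)) \<le> 1 + real (size (proots W))" by linarith
  then have "ennreal (real (size (proots Q))) \<le> ennreal (1 + real (size (proots W)))" by (rule ennreal_leI)
  then show ?thesis using Q unfolding Q_def[symmetric] num_real_roots_def by (simp add: ennreal_of_nat_eq_real_of_nat)
qed

text \<open>The zero polynomial would count as infinitely many roots. Entries in \<open>L\<close>
  differ from those in \<open>U\<close>, so one of the two sets avoids the value 0 and supplies
  \<open>l > d\<close> nonzero entries; these cannot all lie at positions where
  \<open>i choose d\<close> vanishes.\<close>

lemma weighted_poly_nonzero:
  assumes ps: "permuted_sample {1..n} (\<lambda>i. w i - c) L U l M \<rho> \<delta>" and n: "\<rho> * real n > real d" and \<pi>: "\<pi> permutes {1..n}"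
  shows "weighted_poly n (\<lambda>i. real (i choose d) * w (\<pi> i)) \<noteq> 0"
proof
  interpret permuted_sample "{1..n}" "\<lambda>i. w i - c" L U l M \<rho> \<delta> by (rule ps)
  assume z: "weighted_poly n (\<lambda>i. real (i choose d) * w (\<pi> i)) = 0"
  have "\<delta> * sqrt M > 0" using \<delta> M(2) by simp
  then have ne: "w q \<noteq> w p" if "p \<in> L" "q \<in> U" for p q using gap[OF that] by auto
  obtain Z where Z: "Z \<subseteq> {1..n}" "card Z = l" "\<And>i. i \<in> Z \<Longrightarrow> w i \<noteq> 0"
  proof (cases "\<exists>p\<in>L. w p = 0")
    case True
    then show ?thesis using ne that[of U] LU by metis
  next
    case False
    then show ?thesis using that[of L] LU by blast
  qed
  have l: "l > d" using \<rho> n by simp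
  have sub: "inv \<pi> ` Z \<subseteq> {1..<d}"
  proof
    fix i assume "i \<in> inv \<pi> ` Z"
    then obtain j where j: "j \<in> Z" "i = inv \<pi> j" by auto
    then have pi: "\<pi> i = j" using permutes_inverses(1)[OF \<pi>] by simp
    have i: "i \<in> {1..n}" using j Z(1) permutes_in_image[OF permutes_inv[OF \<pi>]] by blast
    have "coeff (weighted_poly n (\<lambda>i. real (i choose d) * w (\<pi> i))) (i - 1) = 0" unfolding z by simp
    then have "real (i choose d) * w (\<pi> i) = 0" using i by (simp add: coeff_weighted_poly split: if_splits)
    then have "i choose d = 0" using Z(3)[OF j(1)] pi by simp
    then show "i \<in> {1..<d}" using i by auto
  qed
  have "card (inv \<pi> ` Z) = l"
    using Z(2) card_image[of "inv \<pi>" Z] permutes_inj[OF permutes_inv[OF \<pi>]] by (metis inj_on_subset subset_UNIV)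
  moreover have "card (inv \<pi> ` Z) \<le> card {1..<d}" by (rule card_mono[OF _ sub]) simp
  ultimately show False using l by simp
qed

lemma avg_crossings_le:
  assumes C: "C > 0" and n: "n > 0"
    and b: "\<And>k. k \<in> {k0..n} \<Longrightarrow> perm_avg {1..n} (\<lambda>\<pi>. of_bool (\<bar>\<Sum>i\<in>{1..k}. a \<pi> i * gc s (k - i)\<bar> \<le> \<bar>\<Sum>i\<in>{1..k}. a \<pi> i * hc s (k - i)\<bar>)) \<le> C / real k"
  shows "perm_avg {1..n} (\<lambda>\<pi>. real (crossings s n (a \<pi>))) \<le> real k0 + C * (ln (real n) + 1)"
proof -
  define E where "E k \<pi> = (of_bool (\<bar>\<Sum>i\<in>{1..k}. a \<pi> i * gc s (k - i)\<bar> \<le> \<bar>\<Sum>i\<in>{1..k}. a \<pi> i * hc s (k - i)\<bar>) :: real)" for k \<pi>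
  have "perm_avg {1..n} (\<lambda>\<pi>. real (crossings s n (a \<pi>))) = perm_avg {1..n} (\<lambda>\<pi>. \<Sum>k\<in>{1..n}. E k \<pi>)"
    unfolding crossings_def E_def by (intro avg_cong) (simp add: of_bool_def sum.If_cases Int_def)
  also have "\<dots> = (\<Sum>k\<in>{1..n}. perm_avg {1..n} (E k))" by (rule avg_sum)
  also have "\<dots> \<le> (\<Sum>k\<in>{1..n}. of_bool (k < k0) + C * inverse (real k))"
  proof (rule sum_mono)
    fix k assume k: "k \<in> {1..n}"
    show "perm_avg {1..n} (E k) \<le> of_bool (k < k0) + C * inverse (real k)"
    proof (cases "k < k0")
      case True
      have "perm_avg {1..n} (E k) \<le> perm_avg {1..n} (\<lambda>_. 1)" by (intro avg_mono) (simp add: E_def)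
      also have "\<dots> = 1" by (intro avg_perms_const) simp
      finally show ?thesis using True C by (simp add: add_increasing2)
    next
      case False
      then show ?thesis using b[of k] k unfolding E_def by (simp add: divide_inverse)
    qed
  qed
  also have "\<dots> = real (card {k\<in>{1..n}. k < k0}) + C * harm n"
    by (simp add: sum.distrib harm_def sum_distrib_left of_bool_def sum.If_cases Int_def)
  also have "\<dots> \<le> real k0 + C * (ln (real n) + 1)"
  proof (intro add_mono mult_left_mono)
    have "card {k\<in>{1..n}. k < k0} \<le> card {..<k0}" by (intro card_mono) auto
    then show "real (card {k\<in>{1..n}. k < k0}) \<le> real k0" by simp
    have "harm n - ln (real n) \<le> harm 1 - ln (real 1)"
      using euler_mascheroni_sequence_decreasing[of 1 n] n by simp
    then show "harm n \<le> ln (real n) + 1" by (simp add: harm_expand)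
  qed (use C in simp)
  finally show ?thesis .
qed

lemma crossings_cong:
  assumes "\<And>i. i \<in> {1..n} \<Longrightarrow> a i = b i"
  shows "crossings s n a = crossings s n b"
proof -
  have "(\<Sum>i\<in>{1..k}. a i * f (k - i)) = (\<Sum>i\<in>{1..k}. b i * f (k - i))" if "k \<in> {1..n}" for k f
    using assms that by (intro sum.cong) auto
  then have "{k\<in>{1..n}. \<bar>\<Sum>i\<in>{1..k}. a i * gc s (k - i)\<bar> \<le> \<bar>\<Sum>i\<in>{1..k}. a i * hc s (k - i)\<bar>}
    = {k\<in>{1..n}. \<bar>\<Sum>i\<in>{1..k}. b i * gc s (k - i)\<bar> \<le> \<bar>\<Sum>i\<in>{1..k}. b i * hc s (k - i)\<bar>}" by auto
  then show ?thesis unfolding crossings_def by (rule arg_cong)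
qed

theorem theorem3p7:
  fixes K :: real and d :: nat
  assumes "K > 1"
  shows "\<exists>(n0::nat) (K'::real). K' > 0 \<and>
    (\<forall>n\<ge>n0. \<forall>w :: nat \<Rightarrow> real. \<not> constant_vec n w \<longrightarrow> balanced K n w \<longrightarrow>
      (\<integral>\<^sup>+ \<pi>. num_real_roots ((pderiv ^^ d) (perm_poly n w \<pi>)) \<partial>measure_pmf (random_perm n))
        \<le> ennreal (K' * ln (real n)))"
proof (rule crossing_probability[OF assms, of d])
  fix C :: real and n1 k0 :: nat
  assume C: "C > 0" and cross0: "\<And>n w k \<epsilon> \<beta>. n \<ge> n1 \<Longrightarrow> \<not> constant_vec n w \<Longrightarrow> balanced K n w \<Longrightarrow>
      k \<in> {k0..n} \<Longrightarrow> \<epsilon> \<in> {1, -1} \<Longrightarrow> \<beta> \<in> {\<lambda>i. real (i choose d), \<lambda>i. real ((n + 1 - i) choose d)} \<Longrightarrow>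
      perm_avg {1..n} (\<lambda>\<pi>. of_bool (crossing (Suc d) k (\<lambda>i. \<epsilon> ^ (i - 1) * \<beta> i) (\<lambda>i. w (\<pi> i)))) \<le> C / real k"
  define s where "s = Suc d"
  note cross = cross0[folded s_def]
  obtain \<rho> \<delta> n2 where \<rho>: "\<rho> > 0" and smp: "\<And>n w. n \<ge> n2 \<Longrightarrow> \<not> constant_vec n w \<Longrightarrow> balanced K n w \<Longrightarrow>
      \<exists>L U l M. permuted_sample {1..n} (\<lambda>i. w i - vec_mean n w) L U l M \<rho> \<delta>"
    using balanced_sample[OF assms] by blast
  define A where "A = 1 + 4 * (3 + real s) + 4 * real k0"
  \<comment> \<open>The 3 ensures \<open>ln n \<ge> 1\<close>, which lets \<open>A\<close> and
    \<open>ln n + 1\<close> be absorbed into multiples of \<open>ln n\<close>; the last entry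
    ensures \<open>\<rho> * n > d\<close> for the nonvanishing.\<close>
  define n0 where "n0 = Max {3, n1, n2, nat \<lceil>real d / \<rho>\<rceil> + 1}"
  have A: "A > 0" unfolding A_def by simp
  have main: "(\<integral>\<^sup>+ \<pi>. num_real_roots ((pderiv ^^ d) (perm_poly n w \<pi>)) \<partial>measure_pmf (random_perm n))
        \<le> ennreal ((A + 8 * C) * ln (real n))"
    if n: "n \<ge> n0" and w: "\<not> constant_vec n w" "balanced K n w" for n w
  proof -
    have n': "n \<ge> 3" "n \<ge> n1" "n \<ge> n2" "n \<ge> nat \<lceil>real d / \<rho>\<rceil> + 1" using n by (simp_all add: n0_def)
    have "real d / \<rho> < real n" using n'(4) by linarith
    then have dn: "\<rho> * real n > real d" using \<rho> by (simp add: field_simps)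
    define P where "P = perms {1..n}"
    have P: "finite P" "P \<noteq> {}" unfolding P_def by (auto simp: finite_permutations intro: permutes_id)
    define cr where "cr \<epsilon> \<beta> \<pi> = real (crossings s n (\<lambda>i. \<epsilon> ^ (i - 1) * (\<beta> i * w (\<pi> i))))" for \<epsilon> \<beta> and \<pi> :: "nat \<Rightarrow> nat"
    define fw bw where "fw = (\<lambda>i. real (i choose d))" and "bw = (\<lambda>i. real ((n + 1 - i) choose d))"
    \<comment> \<open>Reversing the coefficients replaces \<open>\<pi>\<close> by
      \<open>\<pi> \<circ> \<sigma>\<close>, which is again uniform, and the weight
      \<open>i choose d\<close> by \<open>(n + 1 - i) choose d\<close>.\<close>
    define \<sigma> where "\<sigma> i = (if i \<in> {1..n} then n + 1 - i else i)" for i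
    have \<sigma>: "\<sigma> permutes {1..n}"
      by (rule bij_imp_permutes[OF bij_betw_byWitness[where f' = \<sigma>]]) (auto simp: \<sigma>_def)
    define g where "g \<pi> = (1 + 4 * (3 + real s)) + (cr 1 fw \<pi> + cr (-1) fw \<pi> + cr 1 bw (\<pi> \<circ> \<sigma>) + cr (-1) bw (\<pi> \<circ> \<sigma>))" for \<pi>
    have le: "num_real_roots ((pderiv ^^ d) (perm_poly n w \<pi>)) \<le> ennreal (g \<pi>)" if \<pi>: "\<pi> \<in> P" for \<pi>
    proof -
      obtain L U l M where ps: "permuted_sample {1..n} (\<lambda>i. w i - vec_mean n w) L U l M \<rho> \<delta>"
        using smp[OF n'(3) w] by blast
      define a where "a i = fw i * w (\<pi> i)" for i
      have W0: "weighted_poly n a \<noteq> 0"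
        unfolding a_def fw_def using weighted_poly_nonzero[OF ps dn] \<pi> by (simp add: P_def)
      have "num_real_roots ((pderiv ^^ d) (perm_poly n w \<pi>)) \<le> ennreal (1 + real (size (proots (weighted_poly n a))))"
        using W0 unfolding a_def fw_def by (rule real_roots_higher_pderiv)
      also have "\<dots> \<le> ennreal (g \<pi>)"
      proof (rule ennreal_leI)
        have "real (crossings s n a) = cr 1 fw \<pi>" "real (crossings s n (\<lambda>i. (-1) ^ (i - 1) * a i)) = cr (-1) fw \<pi>"
          by (simp_all add: cr_def a_def[abs_def])
        moreover have "crossings s n (\<lambda>i. \<epsilon> ^ (i - 1) * a (n + 1 - i)) = crossings s n (\<lambda>i. \<epsilon> ^ (i - 1) * (bw i * w ((\<pi> \<circ> \<sigma>) i)))" for \<epsilon>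
          by (rule crossings_cong) (simp add: a_def fw_def bw_def \<sigma>_def)
        from this[of 1] this[of "-1"]
        have "real (crossings s n (\<lambda>i. a (n + 1 - i))) = cr 1 bw (\<pi> \<circ> \<sigma>)"
          "real (crossings s n (\<lambda>i. (-1) ^ (i - 1) * a (n + 1 - i))) = cr (-1) bw (\<pi> \<circ> \<sigma>)"
          unfolding cr_def by simp_all
        ultimately show "1 + real (size (proots (weighted_poly n a))) \<le> g \<pi>"
          using real_roots_le_crossings[OF W0, of s, THEN of_nat_mono[where 'a = real]] unfolding g_def by simp
      qed
      finally show ?thesis .
    qed
    have g0: "g \<pi> \<ge> 0" for \<pi> unfolding g_def cr_def by (intro add_nonneg_nonneg) auto
    have crb: "avg P (cr \<epsilon> \<beta>) \<le> real k0 + C * (ln (real n) + 1)" if "\<epsilon> \<in> {1, -1}" "\<beta> \<in> {fw, bw}" for \<epsilon> \<beta>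
      unfolding P_def cr_def
    proof (rule avg_crossings_le[OF C])
      fix k assume "k \<in> {k0..n}"
      from cross[OF n'(2) w this that[unfolded fw_def bw_def]]
      show "perm_avg {1..n} (\<lambda>\<pi>. of_bool (\<bar>\<Sum>i\<in>{1..k}. \<epsilon> ^ (i - 1) * (\<beta> i * w (\<pi> i)) * gc s (k - i)\<bar>
        \<le> \<bar>\<Sum>i\<in>{1..k}. \<epsilon> ^ (i - 1) * (\<beta> i * w (\<pi> i)) * hc s (k - i)\<bar>)) \<le> C / real k"
        by (simp add: mult_ac)
    qed (use n' in simp)
    have comp: "avg P (\<lambda>\<pi>. f (\<pi> \<circ> \<sigma>)) = avg P f" for f unfolding P_def by (rule avg_perms_compose[OF \<sigma>])
    have "avg P g = (1 + 4 * (3 + real s)) + (avg P (cr 1 fw) + avg P (cr (-1) fw) + avg P (cr 1 bw) + avg P (cr (-1) bw))"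
      unfolding g_def avg_add comp avg_const[OF P] ..
    also have "\<dots> \<le> A + 4 * C * (ln (real n) + 1)"
      using crb[of 1 fw] crb[of "-1" fw] crb[of 1 bw] crb[of "-1" bw] by (simp add: A_def)
    also have "\<dots> \<le> (A + 8 * C) * ln (real n)"
    proof -
      have "exp 1 \<le> (3 :: real)" by (rule exp_le)
      then have "exp 1 \<le> real n" using n' by linarith
      then have ln1: "1 \<le> ln (real n)" using n' by (subst ln_ge_iff) auto
      then have "A \<le> A * ln (real n)" "4 * C * (ln (real n) + 1) \<le> 4 * C * (2 * ln (real n))"
        using A C by (auto intro!: mult_left_mono)
      then show ?thesis by (simp add: algebra_simps)
    qed
    finally have avg: "avg P g \<le> (A + 8 * C) * ln (real n)" .
    have "(\<integral>\<^sup>+ \<pi>. num_real_roots ((pderiv ^^ d) (perm_poly n w \<pi>)) \<partial>measure_pmf (random_perm n))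
      = (\<Sum>\<pi>\<in>P. num_real_roots ((pderiv ^^ d) (perm_poly n w \<pi>))) / of_nat (card P)"
      unfolding random_perm_def P_def[symmetric] using P by (simp add: nn_integral_pmf_of_set)
    also have "\<dots> \<le> (\<Sum>\<pi>\<in>P. ennreal (g \<pi>)) / of_nat (card P)"
      using le by (intro divide_right_mono_ennreal sum_mono)
    also have "\<dots> = ennreal (avg P g)"
      using g0 P by (simp add: avg_def sum_ennreal divide_ennreal sum_nonneg card_gt_0_iff ennreal_of_nat_eq_real_of_nat)
    also have "\<dots> \<le> ennreal ((A + 8 * C) * ln (real n))" using avg by (rule ennreal_leI)
    finally show ?thesis .
  qed
  show ?thesis
    using main A C by (intro exI[of _ n0] exI[of _ "A + 8 * C"]) auto
qed

end
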